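(* Let $\Bbbk$ be a field with $\operatorname{char}\Bbbk\neq2$. The $\Bbbk$-algebra isomorphism $\mathcal{B}:\Bbbk[u_i,v_{ij},w_{ij}]\to\Bbbk[u_i,u^+_{ij},u^-_{ij}]$ given by $u_i\mapsto u_i$, $v_{ij}\mapsto u^+_{ij}+u^-_{ij}$, $w_{ij}\mapsto u^+_{ij}-u^-_{ij}$ induces a graded $\Bbbk$-algebra isomorphism $\Bbbk[u_i,v_{ij},w_{ij}]/\mathcal{I}\to\Bbbk[u_i,u^+_{ij},u^-_{ij}]/\mathcal{J}\cong H^*(Y_n;\Bbbk)$, where $\mathcal{I}$ is the ideal generated by the set $\mathcal{G}$ consisting of (for all $i<j<k$) $u_i^2$, $v_{ij}w_{ij}$, $u_iw_{ij}-u_jv_{ij}$, $-2u_iw_{ij}+v_{ij}^2$, $2u_iw_{ij}+w_{ij}^2$, $u_iv_{ij}-2u_iu_j-u_jw_{ij}$, $v_{ij}w_{jk}-w_{ij}w_{ik}-v_{ik}v_{jk}$, $w_{ij}w_{jk}-v_{ij}w_{ik}-w_{ik}w_{jk}$, $v_{ij}v_{jk}-v_{ij}v_{ik}-v_{ik}w_{jk}$, $w_{ij}v_{jk}-w_{ij}v_{ik}-w_{ik}v_{jk}$. Moreover, $\mathcal{G}$ is a quadratic Gröbner basis of $\mathcal{I}$ with respect to any monomial order $\prec$ on $\Bbbk[u_i,v_{ij},w_{ij}]$ extending the partial order $V_1\prec V_2\prec\cdots\prec V_n$ (every variable of $V_a$ is smaller than every variable of $V_b$ for $a<b$), where $V_k=\{u_k,v_{1k},w_{1k},\dots,v_{k-1,k},w_{k-1,k}\}$;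 the initial terms of the generators are, in the order listed, $u_i^2$, $v_{ij}w_{ij}$, $u_jv_{ij}$, $v_{ij}^2$, $w_{ij}^2$, $u_jw_{ij}$, $v_{ik}v_{jk}$, $w_{ik}w_{jk}$, $v_{ik}w_{jk}$, $w_{ik}v_{jk}$. The corresponding standard monomial $\Bbbk$-basis of $\Bbbk[u_i,v_{ij},w_{ij}]/\mathcal{I}$ is the set $\mathcal{V}$ of squarefree monomials that are products of at most one variable from each of $V_1,\dots,V_n$.
   Context: Indices satisfy $1\le i\le n$ for $u_i$ and $1\le i<j\le n$ for the other variables. $Y_n=\{(x_1,\dots,x_n)\in(\mathbb{R}^3)^n:x_i\ne0,\ x_i\ne\pm x_j\ (i<j)\}$. It is known that $H^*(Y_n;\Bbbk)\cong\Bbbk[u_i,u^+_{ij},u^-_{ij}]/\mathcal{J}$ (grade-doubling), where $\mathcal{J}$ is generated, for $i<j<k$, by $u_i^2,(u^+_{ij})^2,(u^-_{ij})^2$, $u_iu^+_{ij}-u_iu^-_{ij}-u^+_{ij}u^-_{ij}$, $u_iu^+_{ij}-u_iu_j-u^+_{ij}u_j$, $u_iu_j-u_iu^-_{ij}-u_ju^-_{ij}$, $u^+_{ij}u^+_{jk}-u^+_{ij}u^+_{ik}-u^+_{ik}u^+_{jk}$, $u^-_{ij}u^+_{jk}-u^-_{ij}u^-_{ik}-u^-_{ik}u^+_{jk}$, $-u^-_{ij}u^-_{jk}+u^-_{ij}u^+_{ik}-u^+_{ik}u^-_{jk}$, $-u^+_{ij}u^-_{jk}+u^+_{ij}u^-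_{ik}-u^-_{ik}u^-_{jk}$.
   Formalization: The monomial order must also satisfy xy ≺ y'y'' for x in V_a and y, y', y'' in V_b (a<b); comparing single variables alone is not enough: for lex with w_12≻u_2≻v_12≻u_1 the initial term of u_1w_12−u_2v_12 is u_1w_12. *)

theory Defs
  imports "HOL-Homology.Simplices" "HOL-Algebra.QuotRing" "HOL-Algebra.Module"
    "HOL-Library.Poly_Mapping" "HOL-Computational_Algebra.Computational_Algebra"
begin

section \<open>Graded algebras over a field\<close>

text \<open>The scalars are the elements of a type \<open>'k\<close> of class \<^class>\<open>field\<close>; \<open>deg_part A d\<close> is the
  homogeneous component of degree \<open>d\<close>.\<close>

record ('k, 'a) graded_algebra = "('k, 'a) module" +
  deg_part :: "nat \<Rightarrow> 'a set"

definition quotient_algebra ::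
    "('k, 'a, 'z) graded_algebra_scheme \<Rightarrow> 'a set \<Rightarrow> ('k, 'a set) graded_algebra" where
  "quotient_algebra A I =
    \<lparr>carrier = carrier (A Quot I), monoid.mult = monoid.mult (A Quot I), one = one (A Quot I),
     zero = zero (A Quot I), add = add (A Quot I),
     module.smult = (\<lambda>c X. \<Union>x\<in>X. I +>\<^bsub>A\<^esub> (c \<odot>\<^bsub>A\<^esub> x)),
     deg_part = (\<lambda>d. (\<lambda>x. I +>\<^bsub>A\<^esub> x) ` deg_part A d)\<rparr>"

text \<open>Isomorphisms of \<open>'k\<close>-algebras multiplying degrees by \<open>s\<close>: \<open>s = 1\<close> gives the graded
  isomorphisms, \<open>s = 2\<close> the grade-doubling ones.\<close>

definition graded_algebra_iso ::
    "nat \<Rightarrow> ('k, 'a, 'y) graded_algebra_scheme \<Rightarrow> ('k, 'b, 'z) graded_algebra_scheme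
      \<Rightarrow> ('a \<Rightarrow> 'b) set" where
  "graded_algebra_iso s A B =
    {f \<in> ring_iso A B.
       (\<forall>c. \<forall>x\<in>carrier A. f (c \<odot>\<^bsub>A\<^esub> x) = c \<odot>\<^bsub>B\<^esub> f x) \<and>
       (\<forall>d. f ` deg_part A d = deg_part B (s * d))}"

text \<open>The family \<open>(e s)\<^sub>s\<close> indexed by \<open>S\<close> is a basis of the underlying vector space. Uniqueness of
  the coefficients makes \<open>e\<close> injective on \<open>S\<close>.\<close>

definition is_basis ::
    "('k::zero, 'a, 'z) graded_algebra_scheme \<Rightarrow> ('s \<Rightarrow> 'a) \<Rightarrow> 's set \<Rightarrow> bool" where
  "is_basis A e S \<longleftrightarrow>
     e ` S \<subseteq> carrier A \<and>
     (\<forall>x\<in>carrier A. \<exists>!c. {s. c s \<noteq> 0} \<subseteq> S \<and> finite {s. c s \<noteq> 0} \<and>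
        x = (\<Oplus>\<^bsub>A\<^esub>s\<in>{s. c s \<noteq> 0}. c s \<odot>\<^bsub>A\<^esub> e s))"


section \<open>Polynomial algebras and Groebner bases\<close>

type_synonym 'x mon = "'x \<Rightarrow>\<^sub>0 nat"
type_synonym ('x, 'k) mpoly = "'x mon \<Rightarrow>\<^sub>0 'k"

definition monomials :: "'x set \<Rightarrow> 'x mon set" where
  "monomials X = {m. Poly_Mapping.keys m \<subseteq> X}"

definition total_degree :: "'x mon \<Rightarrow> nat" where
  "total_degree m = (\<Sum>x\<in>Poly_Mapping.keys m. Poly_Mapping.lookup m x)"

definition pterm :: "'x mon \<Rightarrow> ('x, 'k::field) mpoly" where
  "pterm m = Poly_Mapping.single m 1"

definition pconst :: "'k \<Rightarrow> ('x, 'k::field) mpoly" where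
  "pconst c = Poly_Mapping.single 0 c"

definition pvar :: "'x \<Rightarrow> ('x, 'k::field) mpoly" where
  "pvar x = pterm (Poly_Mapping.single x 1)"

definition polys :: "'x set \<Rightarrow> ('x, 'k::field) mpoly set" where
  "polys X = {p. Poly_Mapping.keys p \<subseteq> monomials X}"

definition poly_algebra :: "'x set \<Rightarrow> ('k::field, ('x, 'k) mpoly) graded_algebra" where
  "poly_algebra X =
    \<lparr>carrier = polys X, monoid.mult = (*), one = 1, zero = 0, add = (+),
     module.smult = (\<lambda>c p. pconst c * p),
     deg_part = (\<lambda>d. {p \<in> polys X. \<forall>m\<in>Poly_Mapping.keys p. total_degree m = d})\<rparr>"

text \<open>The \<open>'k\<close>-algebra homomorphism with \<open>x \<mapsto> s x\<close> on the variables.\<close>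

definition poly_subst ::
    "('x \<Rightarrow> ('y, 'k::field) mpoly) \<Rightarrow> ('x, 'k) mpoly \<Rightarrow> ('y, 'k) mpoly" where
  "poly_subst s p =
    (\<Sum>m\<in>Poly_Mapping.keys p.
       pconst (Poly_Mapping.lookup p m) *
       (\<Prod>x\<in>Poly_Mapping.keys m. s x ^ Poly_Mapping.lookup m x))"

text \<open>Monomials are written additively: \<open>m + t\<close> is the product of \<open>m\<close> and \<open>t\<close>, and \<open>0\<close> is the
  monomial \<open>1\<close>. The relation is the strict order.\<close>

definition monomial_order :: "'x set \<Rightarrow> ('x mon \<Rightarrow> 'x mon \<Rightarrow> bool) \<Rightarrow> bool" where
  "monomial_order X lt \<longleftrightarrow>
     irreflp_on (monomials X) lt \<and> transp_on (monomials X) lt \<and>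
     totalp_on (monomials X) lt \<and>
     (\<forall>m\<in>monomials X. m \<noteq> 0 \<longrightarrow> lt 0 m) \<and>
     (\<forall>m\<in>monomials X. \<forall>m'\<in>monomials X. \<forall>t\<in>monomials X.
        lt m m' \<longrightarrow> lt (m + t) (m' + t))"

definition lead_mon :: "('x mon \<Rightarrow> 'x mon \<Rightarrow> bool) \<Rightarrow> ('x, 'k::field) mpoly \<Rightarrow> 'x mon" where
  "lead_mon lt p =
    (THE m. m \<in> Poly_Mapping.keys p \<and> (\<forall>m'\<in>Poly_Mapping.keys p. m' \<noteq> m \<longrightarrow> lt m' m))"

text \<open>Initial terms are taken without their coefficients.\<close>

definition initial_term ::
    "('x mon \<Rightarrow> 'x mon \<Rightarrow> bool) \<Rightarrow> ('x, 'k::field) mpoly \<Rightarrow> ('x, 'k) mpoly" where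
  "initial_term lt p = pterm (lead_mon lt p)"

definition initial_ideal ::
    "'x set \<Rightarrow> ('x mon \<Rightarrow> 'x mon \<Rightarrow> bool) \<Rightarrow> ('x, 'k::field) mpoly set \<Rightarrow> ('x, 'k) mpoly set" where
  "initial_ideal X lt I = Idl\<^bsub>poly_algebra X\<^esub> (initial_term lt ` (I - {0}))"

definition groebner_basis ::
    "'x set \<Rightarrow> ('x mon \<Rightarrow> 'x mon \<Rightarrow> bool) \<Rightarrow> ('x, 'k::field) mpoly set
      \<Rightarrow> ('x, 'k) mpoly set \<Rightarrow> bool" where
  "groebner_basis X lt I G \<longleftrightarrow>
     finite G \<and> G \<subseteq> I - {0} \<and>
     initial_ideal X lt I = Idl\<^bsub>poly_algebra X\<^esub> (initial_term lt ` G)"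

definition standard_monomials ::
    "'x set \<Rightarrow> ('x mon \<Rightarrow> 'x mon \<Rightarrow> bool) \<Rightarrow> ('x, 'k::field) mpoly set \<Rightarrow> 'x mon set" where
  "standard_monomials X lt I = {m \<in> monomials X. pterm m \<notin> initial_ideal X lt I}"


section \<open>Singular cohomology algebras\<close>

text \<open>A cochain is a finite sum of homogeneous ones: \<open>\<phi> p\<close> is its component of degree \<open>p\<close>, a function
  on singular p-simplices extended by \<open>0\<close>.\<close>

type_synonym ('a, 'k) cochain = "nat \<Rightarrow> ((nat \<Rightarrow> real) \<Rightarrow> 'a) \<Rightarrow> 'k"

definition cochains :: "'a topology \<Rightarrow> ('a, 'k::field) cochain set" where
  "cochains X =
    {\<phi>. (\<forall>p \<sigma>. \<phi> p \<sigma> \<noteq> 0 \<longrightarrow> singular_simplex p X \<sigma>) \<and> finite {p. \<exists>\<sigma>. \<phi> p \<sigma> \<noteq> 0}}"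

definition coboundary :: "'a topology \<Rightarrow> ('a, 'k::field) cochain \<Rightarrow> ('a, 'k) cochain" where
  "coboundary X \<phi> =
    (\<lambda>p \<sigma>. if 0 < p \<and> singular_simplex p X \<sigma>
           then \<Sum>k\<le>p. (-1) ^ k * \<phi> (p - 1) (singular_face p k \<sigma>) else 0)"

text \<open>The faces of a \<open>(p + q)\<close>-simplex spanned by its first \<open>p + 1\<close> and its last \<open>q + 1\<close> vertices.\<close>

definition front_face :: "nat \<Rightarrow> ((nat \<Rightarrow> real) \<Rightarrow> 'a) \<Rightarrow> (nat \<Rightarrow> real) \<Rightarrow> 'a" where
  "front_face p \<sigma> = restrict \<sigma> (standard_simplex p)"

definition back_face :: "nat \<Rightarrow> nat \<Rightarrow> ((nat \<Rightarrow> real) \<Rightarrow> 'a) \<Rightarrow> (nat \<Rightarrow> real) \<Rightarrow> 'a" where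
  "back_face p q \<sigma> = restrict (\<lambda>x. \<sigma> (\<lambda>i. if i < p then 0 else x (i - p))) (standard_simplex q)"

definition cup ::
    "'a topology \<Rightarrow> ('a, 'k::field) cochain \<Rightarrow> ('a, 'k) cochain \<Rightarrow> ('a, 'k) cochain" where
  "cup X \<phi> \<psi> =
    (\<lambda>r \<sigma>. if singular_simplex r X \<sigma>
           then \<Sum>p\<le>r. \<phi> p (front_face p \<sigma>) * \<psi> (r - p) (back_face p (r - p) \<sigma>) else 0)"

definition cocycle_algebra :: "'a topology \<Rightarrow> ('k::field, ('a, 'k) cochain) graded_algebra" where
  "cocycle_algebra X =
    \<lparr>carrier = {\<phi> \<in> cochains X. coboundary X \<phi> = (\<lambda>p \<sigma>. 0)},
     monoid.mult = cup X,
     one = (\<lambda>p \<sigma>. if p = 0 \<and> singular_simplex 0 X \<sigma> then 1 else 0),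
     zero = (\<lambda>p \<sigma>. 0),
     add = (\<lambda>\<phi> \<psi> p \<sigma>. \<phi> p \<sigma> + \<psi> p \<sigma>),
     module.smult = (\<lambda>c \<phi> p \<sigma>. c * \<phi> p \<sigma>),
     deg_part = (\<lambda>d. {\<phi> \<in> cochains X. coboundary X \<phi> = (\<lambda>p \<sigma>. 0) \<and>
                        (\<forall>p \<sigma>. p \<noteq> d \<longrightarrow> \<phi> p \<sigma> = 0)})\<rparr>"

definition cohomology_algebra ::
    "'a topology \<Rightarrow> ('k::field, ('a, 'k) cochain set) graded_algebra" where
  "cohomology_algebra X = quotient_algebra (cocycle_algebra X) (coboundary X ` cochains X)"

text \<open>The space \<open>Y\<^sub>n\<close>; its points are extensional functions on \<open>{1..n}\<close>.\<close>

definition Y_space :: "nat \<Rightarrow> (nat \<Rightarrow> real^3) topology" where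
  "Y_space n =
    subtopology (product_topology (\<lambda>_. euclidean) {1..n})
      {x. (\<forall>i\<in>{1..n}. x i \<noteq> 0) \<and>
          (\<forall>i j. 1 \<le> i \<and> i < j \<and> j \<le> n \<longrightarrow> x i \<noteq> x j \<and> x i \<noteq> - x j)}"


section \<open>The two presentations\<close>

datatype pm_var = Upm nat | Uplus nat nat | Uminus nat nat
datatype uvw_var = U nat | V nat nat | W nat nat

definition pm_vars :: "nat \<Rightarrow> pm_var set" where
  "pm_vars n = {Upm i | i. 1 \<le> i \<and> i \<le> n}
     \<union> {Uplus i j | i j. 1 \<le> i \<and> i < j \<and> j \<le> n}
     \<union> {Uminus i j | i j. 1 \<le> i \<and> i < j \<and> j \<le> n}"

definition uvw_vars :: "nat \<Rightarrow> uvw_var set" where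
  "uvw_vars n = {U i | i. 1 \<le> i \<and> i \<le> n}
     \<union> {V i j | i j. 1 \<le> i \<and> i < j \<and> j \<le> n}
     \<union> {W i j | i j. 1 \<le> i \<and> i < j \<and> j \<le> n}"

abbreviation u' :: "nat \<Rightarrow> (pm_var, 'k::field) mpoly" where "u' i \<equiv> pvar (Upm i)"
abbreviation up :: "nat \<Rightarrow> nat \<Rightarrow> (pm_var, 'k::field) mpoly" where "up i j \<equiv> pvar (Uplus i j)"
abbreviation um :: "nat \<Rightarrow> nat \<Rightarrow> (pm_var, 'k::field) mpoly" where "um i j \<equiv> pvar (Uminus i j)"

abbreviation u :: "nat \<Rightarrow> (uvw_var, 'k::field) mpoly" where "u i \<equiv> pvar (U i)"
abbreviation v :: "nat \<Rightarrow> nat \<Rightarrow> (uvw_var, 'k::field) mpoly" where "v i j \<equiv> pvar (V i j)"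
abbreviation w :: "nat \<Rightarrow> nat \<Rightarrow> (uvw_var, 'k::field) mpoly" where "w i j \<equiv> pvar (W i j)"

definition J_gens :: "nat \<Rightarrow> (pm_var, 'k::field) mpoly set" where
  "J_gens n =
     (\<Union>i\<in>{1..n}. {u' i ^ 2})
   \<union> (\<Union>(i, j)\<in>{(i, j). 1 \<le> i \<and> i < j \<and> j \<le> n}.
       {up i j ^ 2,
        um i j ^ 2,
        u' i * up i j - u' i * um i j - up i j * um i j,
        u' i * up i j - u' i * u' j - up i j * u' j,
        u' i * u' j - u' i * um i j - u' j * um i j})
   \<union> (\<Union>(i, j, k)\<in>{(i, j, k). 1 \<le> i \<and> i < j \<and> j < k \<and> k \<le> n}.
       {up i j * up j k - up i j * up i k - up i k * up j k,
        um i j * up j k - um i j * um i k - um i k * up j k,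
        - um i j * um j k + um i j * up i k - up i k * um j k,
        - up i j * um j k + up i j * um i k - um i k * um j k})"

definition G_gens :: "nat \<Rightarrow> (uvw_var, 'k::field) mpoly set" where
  "G_gens n =
     (\<Union>i\<in>{1..n}. {u i ^ 2})
   \<union> (\<Union>(i, j)\<in>{(i, j). 1 \<le> i \<and> i < j \<and> j \<le> n}.
       {v i j * w i j,
        u i * w i j - u j * v i j,
        - 2 * u i * w i j + v i j ^ 2,
        2 * u i * w i j + w i j ^ 2,
        u i * v i j - 2 * u i * u j - u j * w i j})
   \<union> (\<Union>(i, j, k)\<in>{(i, j, k). 1 \<le> i \<and> i < j \<and> j < k \<and> k \<le> n}.
       {v i j * w j k - w i j * w i k - v i k * v j k,
        w i j * w j k - v i j * w i k - w i k * w j k,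
        v i j * v j k - v i j * v i k - v i k * w j k,
        w i j * v j k - w i j * v i k - w i k * v j k})"

abbreviation pm_algebra :: "nat \<Rightarrow> ('k::field, (pm_var, 'k) mpoly) graded_algebra" where
  "pm_algebra n \<equiv> poly_algebra (pm_vars n)"

abbreviation uvw_algebra :: "nat \<Rightarrow> ('k::field, (uvw_var, 'k) mpoly) graded_algebra" where
  "uvw_algebra n \<equiv> poly_algebra (uvw_vars n)"

definition J_ideal :: "nat \<Rightarrow> (pm_var, 'k::field) mpoly set" where
  "J_ideal n = Idl\<^bsub>pm_algebra n\<^esub> (J_gens n)"

definition I_ideal :: "nat \<Rightarrow> (uvw_var, 'k::field) mpoly set" where
  "I_ideal n = Idl\<^bsub>uvw_algebra n\<^esub> (G_gens n)"

definition B_map :: "(uvw_var, 'k::field) mpoly \<Rightarrow> (pm_var, 'k) mpoly" where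
  "B_map = poly_subst (\<lambda>x. case x of
       U i \<Rightarrow> u' i
     | V i j \<Rightarrow> up i j + um i j
     | W i j \<Rightarrow> up i j - um i j)"

definition block :: "nat \<Rightarrow> uvw_var set" where
  "block k = {U k} \<union> {V i k | i. 1 \<le> i \<and> i < k} \<union> {W i k | i. 1 \<le> i \<and> i < k}"

text \<open>Monomial orders extending \<open>V\<^sub>1 \<prec> \<dots> \<prec> V\<^sub>n\<close>. The comparison of blocks is applied to variables
  (\<open>V\<^sub>a \<prec> V\<^sub>b\<close>) and to products of two variables (\<open>V\<^sub>a V\<^sub>b \<prec> V\<^sub>b V\<^sub>b\<close>). The second clause does not follow from
  the first one and cannot be dropped: the lexicographic order with
  \<open>w\<^sub>1\<^sub>2 \<succ> u\<^sub>2 \<succ> v\<^sub>1\<^sub>2 \<succ> u\<^sub>1\<close> satisfies the first clause, but there the initial term of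
  \<open>u\<^sub>1 w\<^sub>1\<^sub>2 - u\<^sub>2 v\<^sub>1\<^sub>2\<close> is \<open>u\<^sub>1 w\<^sub>1\<^sub>2\<close> and the generators are not a Groebner basis. Every
  degree reverse lexicographic order satisfying the first clause satisfies both.\<close>

definition extends_block_order :: "nat \<Rightarrow> (uvw_var mon \<Rightarrow> uvw_var mon \<Rightarrow> bool) \<Rightarrow> bool" where
  "extends_block_order n lt \<longleftrightarrow>
     (\<forall>a b. 1 \<le> a \<and> a < b \<and> b \<le> n \<longrightarrow>
        (\<forall>x\<in>block a. \<forall>y\<in>block b.
           lt (Poly_Mapping.single x 1) (Poly_Mapping.single y 1)) \<and>
        (\<forall>x\<in>block a. \<forall>y\<in>block b. \<forall>y'\<in>block b. \<forall>y''\<in>block b.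
           lt (Poly_Mapping.single x 1 + Poly_Mapping.single y 1)
                (Poly_Mapping.single y' 1 + Poly_Mapping.single y'' 1)))"

definition block_squarefree_monomials :: "nat \<Rightarrow> uvw_var mon set" where
  "block_squarefree_monomials n =
    {m \<in> monomials (uvw_vars n).
       (\<forall>x. Poly_Mapping.lookup m x \<le> 1) \<and>
       (\<forall>k\<in>{1..n}. card (Poly_Mapping.keys m \<inter> block k) \<le> 1)}"

end

theory Submission
  imports Defs
begin

text \<open>Every generator in \<open>\<G>\<close> has its leading monomial \<open>x y\<close> in one block \<open>V\<^sub>k\<close> and all other monomials in
  \<open>V\<^sub>a V\<^sub>k\<close> with \<open>a < k\<close>, and every product of two variables of one block occurs as \<open>x y\<close>; hence
  the block-squarefree monomials span the quotient. Their independence uses the Varchenko-Gelfand ring of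
  functions on the chambers of the type \<open>B\<close> arrangement: every generator is constant on the
  chambers when \<open>u\<^sub>i\<close>, \<open>u\<^sup>+\<^sub>i\<^sub>j\<close>, \<open>u\<^sup>-\<^sub>i\<^sub>j\<close> take the signs of \<open>x\<^sub>i\<close>,
  \<open>x\<^sub>j - x\<^sub>i\<close>, \<open>x\<^sub>j + x\<^sub>i\<close>, so a homogeneous element of \<open>\<I>\<close> agrees on the chambers
  with a polynomial of smaller degree. The block-squarefree monomials are independent functions on the
  chambers, as one sees by moving \<open>x\<^sub>n\<close> across the walls, and therefore no nonzero combination of
  them lies in \<open>\<I>\<close>.\<close>

section \<open>Polynomials and their evaluation\<close>

text \<open>Chamber values do not descend to the quotient by \<open>\<I>\<close>: the generators
  take constant values such as 1, -2, 4 or -4, not only 0. The functions on the chambers form a ring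
  filtered by degree whose associated graded ring is the quotient, so only statements about parts of
  highest degree carry over. This is why membership in \<open>\<I>\<close> is tested component by
  component modulo lower degree, and why rewriting into standard monomials must keep track of the
  degree. The counts fit: V_k has 2k - 1 variables, so there are 2 * 4 * ... * 2n = 2^n n! standard
  monomials, as many as chambers. Independence proved in this way concerns \<open>\<I>\<close> alone
  and involves no S-pairs; the Groebner property follows for all admissible orders at once, since an
  element of \<open>\<I>\<close> with standard leading monomial would reduce to a nonzero standard
  element of \<open>\<I>\<close>. Rewriting stays inside one degree, among finitely many monomials,
  so it terminates by finiteness. That 2 is nonzero serves to separate the signs 1 and -1, to cancel
  the factors 2 in the values of v and w, and to invert \<open>B_map\<close>.\<close>

lemma pm_expand: "p = (\<Sum>m\<in>Poly_Mapping.keys p. Poly_Mapping.single m (Poly_Mapping.lookup p m))"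
proof (rule poly_mapping_eqI)
  fix k
  show "Poly_Mapping.lookup p k =
      Poly_Mapping.lookup (\<Sum>m\<in>Poly_Mapping.keys p. Poly_Mapping.single m (Poly_Mapping.lookup p m)) k"
    by (cases "k \<in> Poly_Mapping.keys p")
      (auto simp: lookup_sum lookup_single when_def in_keys_iff sum.delta)
qed

text \<open>Linear statements reduce to single terms. The support bound on \<open>q\<close> is
  carried along so that facts about monomials of \<open>S\<close> stay available in the
  step.\<close>

lemma mpoly_induct [consumes 1, case_names zero add]:
  fixes p :: "('x, 'k::field) mpoly"
  assumes "Poly_Mapping.keys p \<subseteq> S" and "P 0"
    and step: "\<And>m c q. m \<in> S \<Longrightarrow> Poly_Mapping.keys q \<subseteq> S \<Longrightarrow> P q \<Longrightarrow> P (Poly_Mapping.single m c + q)"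
  shows "P p"
proof -
  let ?s = "\<lambda>F. \<Sum>m\<in>F. Poly_Mapping.single m (Poly_Mapping.lookup p m)"
  have "Poly_Mapping.keys (?s F) \<subseteq> S \<and> P (?s F)" if "finite F" "F \<subseteq> Poly_Mapping.keys p" for F
    using that
  proof (induction F rule: finite_induct)
    case (insert m F)
    have "Poly_Mapping.keys (Poly_Mapping.single m (Poly_Mapping.lookup p m) + ?s F) \<subseteq> S"
      using insert assms(1) keys_add[of "Poly_Mapping.single m (Poly_Mapping.lookup p m)" "?s F"]
      by (auto split: if_splits)
    then show ?case using insert assms(1) step by auto
  qed (use assms in auto)
  from this[of "Poly_Mapping.keys p"] show ?thesis using pm_expand[of p] by simp
qed

lemmas mpoly_induct_UNIV = mpoly_induct[OF subset_UNIV, case_names zero add]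

section \<open>Evaluation homomorphisms\<close>

definition mon_value :: "('x \<Rightarrow> 'r::comm_ring_1) \<Rightarrow> 'x mon \<Rightarrow> 'r" where
  "mon_value s m = (\<Prod>x\<in>Poly_Mapping.keys m. s x ^ Poly_Mapping.lookup m x)"

lemma mon_value_superset:
  assumes "finite F" "Poly_Mapping.keys m \<subseteq> F"
  shows "mon_value s m = (\<Prod>x\<in>F. s x ^ Poly_Mapping.lookup m x)"
  unfolding mon_value_def using assms
  by (intro prod.mono_neutral_left) (auto simp: in_keys_iff)

lemma mon_value_zero [simp]: "mon_value s 0 = 1"
  by (simp add: mon_value_def)

lemma mon_value_add: "mon_value s (m + m') = mon_value s m * mon_value s m'"
proof -
  let ?F = "Poly_Mapping.keys m \<union> Poly_Mapping.keys m'"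
  have "Poly_Mapping.keys (m + m') \<subseteq> ?F" by (rule keys_add)
  then show ?thesis
    by (simp add: mon_value_superset[of ?F] lookup_add power_add prod.distrib)
qed

lemma mon_value_single [simp]: "mon_value s (Poly_Mapping.single x (Suc 0)) = s x"
  by (simp add: mon_value_def)

lemma pterm_add: "pterm (m + m') = pterm m * pterm m'"
  by (simp add: pterm_def mult_single)

lemma single_eq_pconst_pterm: "Poly_Mapping.single m c = pconst c * pterm m"
  by (simp add: pterm_def pconst_def mult_single)

lemma mon_value_pvar: "mon_value pvar m = (pterm m :: ('x, 'k::field) mpoly)"
proof -
  have "pvar x ^ k = (pterm (Poly_Mapping.single x k) :: ('x, 'k) mpoly)" for x k
    by (induction k) (auto simp: pvar_def pterm_def mult_single simp flip: single_add)
  moreover have "(\<Prod>x\<in>F. pterm (f x)) = (pterm (sum f F) :: ('x, 'k) mpoly)" if "finite F" for f :: "'x \<Rightarrow> 'x mon" and F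
    using that by induction (auto simp: pterm_add, simp add: pterm_def)
  ultimately show ?thesis
    unfolding mon_value_def by (simp flip: pm_expand)
qed

lemma pconst_zero [simp]: "pconst 0 = 0"
  and pconst_one [simp]: "pconst 1 = 1"
  and pconst_add: "pconst (a + b) = pconst a + pconst b"
  and pconst_mult: "pconst (a * b) = pconst a * pconst b"
  and pconst_uminus: "pconst (- a) = - pconst a"
  by (simp_all add: pconst_def single_add mult_single single_uminus)

lemma pconst_numeral: "pconst (numeral k) = numeral k"
  by (simp add: pconst_def)

text \<open>One treatment of two evaluations: scalars embedded as constant polynomials give
  substitutions of variables, and the identity on scalars gives values at points of affine space,
  here the chambers.\<close>

locale scalar_hom =
  fixes h :: "'k::field \<Rightarrow> 'r::comm_ring_1"
  assumes h_zero: "h 0 = 0" and h_one: "h 1 = 1"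
    and h_add: "h (a + b) = h a + h b" and h_mult: "h (a * b) = h a * h b"
begin

definition peval :: "('x \<Rightarrow> 'r) \<Rightarrow> ('x, 'k) mpoly \<Rightarrow> 'r" where
  "peval s p = (\<Sum>m\<in>Poly_Mapping.keys p. h (Poly_Mapping.lookup p m) * mon_value s m)"

lemma peval_superset:
  assumes "finite F" "Poly_Mapping.keys p \<subseteq> F"
  shows "peval s p = (\<Sum>m\<in>F. h (Poly_Mapping.lookup p m) * mon_value s m)"
  unfolding peval_def using assms
  by (intro sum.mono_neutral_left) (auto simp: in_keys_iff h_zero)

lemma peval_zero [simp]: "peval s 0 = 0"
  by (simp add: peval_def)

lemma peval_add: "peval s (p + q) = peval s p + peval s q"
proof -
  let ?F = "Poly_Mapping.keys p \<union> Poly_Mapping.keys q"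
  have "Poly_Mapping.keys (p + q) \<subseteq> ?F" by (rule keys_add)
  then show ?thesis
    by (simp add: peval_superset[of ?F] lookup_add h_add distrib_right sum.distrib)
qed

lemma peval_uminus: "peval s (- p) = - peval s p"
  using peval_add[of s p "- p"] by (simp add: eq_neg_iff_add_eq_0 add.commute)

lemma peval_diff: "peval s (p - q) = peval s p - peval s q"
  using peval_add[of s p "- q"] by (simp add: peval_uminus)

lemma peval_single: "peval s (Poly_Mapping.single m c) = h c * mon_value s m"
  by (simp add: peval_def h_zero)

lemma peval_mult: "peval s (p * q) = peval s p * peval s q"
proof -
  have single: "peval s (Poly_Mapping.single m c * q) = peval s (Poly_Mapping.single m c) * peval s q"
    for m c q
    by (induction q rule: mpoly_induct_UNIV)
      (simp_all add: distrib_left peval_add mult_single peval_single mon_value_add h_mult mult_ac)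
  show ?thesis
    by (induction p rule: mpoly_induct_UNIV) (simp_all add: distrib_right peval_add single)
qed

lemma peval_one [simp]: "peval s 1 = 1"
  using peval_single[of s 0 1] by (simp add: h_one)

lemma peval_power: "peval s (p ^ k) = peval s p ^ k"
  by (induction k) (simp_all add: peval_mult)

lemma peval_pconst: "peval s (pconst c) = h c"
  by (simp add: pconst_def peval_single)

lemma peval_pterm: "peval s (pterm m) = mon_value s m"
  by (simp add: pterm_def peval_single h_one)

lemma peval_pvar: "peval s (pvar x) = s x"
  by (simp add: pvar_def peval_pterm)

lemma peval_prod: "peval s (prod f F) = (\<Prod>x\<in>F. peval s (f x))"
  by (induction F rule: infinite_finite_induct) (simp_all add: peval_mult)

lemma peval_mon_value: "peval s (mon_value t m) = mon_value (\<lambda>x. peval s (t x)) m"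
  by (simp add: mon_value_def peval_prod peval_power)

lemma peval_two: "peval s 2 = 2"
  using peval_add[of s 1 1] by simp

lemmas peval_simps = peval_add peval_uminus peval_diff peval_mult peval_power peval_pconst
  peval_pterm peval_pvar peval_two

end

text \<open>The rewriting identifies the evaluation with \<open>poly_subst\<close>, so all
  evaluation rules apply directly to \<open>B_map\<close>.\<close>

interpretation subst: scalar_hom "pconst :: 'k::field \<Rightarrow> ('y, 'k) mpoly"
  rewrites "scalar_hom.peval pconst = (poly_subst :: ('x \<Rightarrow> ('y, 'k) mpoly) \<Rightarrow> _)"
proof -
  show *: "scalar_hom (pconst :: 'k \<Rightarrow> ('y, 'k) mpoly)"
    by unfold_locales (simp_all add: pconst_add pconst_mult)
  show "scalar_hom.peval pconst = (poly_subst :: ('x \<Rightarrow> ('y, 'k) mpoly) \<Rightarrow> _)"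
    by (intro ext) (simp add: scalar_hom.peval_def[OF *] poly_subst_def mon_value_def)
qed

interpretation pt: scalar_hom "\<lambda>c::'k::field. c"
  by unfold_locales simp_all

lemma mon_value_cong: "(\<And>x. x \<in> Poly_Mapping.keys m \<Longrightarrow> s x = t x) \<Longrightarrow> mon_value s m = mon_value t m"
  by (simp add: mon_value_def)

text \<open>An algebra homomorphism is determined by its values on the variables, so the composite
  is the identity as soon as it fixes each of them.\<close>

lemma poly_subst_inverse:
  assumes "p \<in> polys X" "\<And>x. x \<in> X \<Longrightarrow> poly_subst t (s x) = pvar x"
  shows "poly_subst t (poly_subst s p) = p"
proof -
  have "Poly_Mapping.keys p \<subseteq> monomials X" using assms(1) by (simp add: polys_def)
  then show ?thesis
  proof (induction p rule: mpoly_induct)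
    case (add m c q)
    then have "mon_value (\<lambda>x. poly_subst t (s x)) m = pterm m"
      unfolding mon_value_pvar[symmetric]
      by (intro mon_value_cong assms(2)) (auto simp: monomials_def)
    with add show ?case
      by (simp add: subst.peval_add subst.peval_single subst.peval_mult subst.peval_mon_value
          subst.peval_pconst subst.peval_pterm single_eq_pconst_pterm)
  qed simp
qed

text \<open>The linear span of a set of monomials. Polynomials in given variables, homogeneous
  parts, filtration steps and combinations of standard monomials are all of this form.\<close>

definition supported :: "'x mon set \<Rightarrow> ('x, 'k::field) mpoly set" where
  "supported S = {p. Poly_Mapping.keys p \<subseteq> S}"

lemma supported_zero [simp]: "0 \<in> supported S"
  by (simp add: supported_def)

lemma supportedD: "p \<in> supported S \<Longrightarrow> Poly_Mapping.keys p \<subseteq> S"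
  by (simp add: supported_def)

lemma supportedI: "Poly_Mapping.keys p \<subseteq> S \<Longrightarrow> p \<in> supported S"
  by (simp add: supported_def)

lemma supported_add: "p \<in> supported S \<Longrightarrow> q \<in> supported S \<Longrightarrow> p + q \<in> supported S"
  by (rule supportedI, rule subset_trans[OF keys_add]) (simp add: supportedD)

lemma supported_uminus: "p \<in> supported S \<Longrightarrow> - p \<in> supported S"
  by (simp add: supported_def)

lemma supported_diff: "p \<in> supported S \<Longrightarrow> q \<in> supported S \<Longrightarrow> p - q \<in> supported S"
  by (rule supportedI, rule subset_trans[OF keys_diff]) (simp add: supportedD)

lemma supported_sum: "(\<And>x. x \<in> F \<Longrightarrow> f x \<in> supported S) \<Longrightarrow> sum f F \<in> supported S"
  by (induction F rule: infinite_finite_induct) (simp_all add: supported_add)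

lemma supported_single: "m \<in> S \<Longrightarrow> Poly_Mapping.single m c \<in> supported S"
  by (simp add: supported_def)

lemma supported_pterm: "m \<in> S \<Longrightarrow> pterm m \<in> supported S"
  by (simp add: pterm_def supported_single)

lemma supported_mult:
  assumes "p \<in> supported S" "q \<in> supported T"
    and "\<And>m m'. m \<in> S \<Longrightarrow> m' \<in> T \<Longrightarrow> m + m' \<in> R"
  shows "p * q \<in> supported R"
  unfolding supported_def
proof (intro CollectI subsetI)
  fix k assume "k \<in> Poly_Mapping.keys (p * q)"
  then obtain a b where k: "k = a + b" and ab: "a \<in> Poly_Mapping.keys p" "b \<in> Poly_Mapping.keys q"
    using keys_mult[of p q] by blast
  from ab assms(1,2) have "a \<in> S" "b \<in> T" by (auto simp: supported_def)
  then show "k \<in> R" unfolding k by (rule assms(3))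
qed

lemma supported_pconst_mult: "p \<in> supported S \<Longrightarrow> pconst c * p \<in> supported S"
  by (rule supported_mult[of "pconst c" "{0}" p S]) (simp_all add: pconst_def supported_def)

lemma supported_mono: "p \<in> supported S \<Longrightarrow> S \<subseteq> T \<Longrightarrow> p \<in> supported T"
  by (simp add: supported_def)

lemmas supported_intros = supported_add supported_uminus supported_diff supported_pconst_mult
  supported_pterm supported_single

lemma lookup_pconst_mult: "Poly_Mapping.lookup (pconst c * p) m = c * Poly_Mapping.lookup p m"
proof -
  have "Poly_Mapping.lookup (pconst c * p) m = Poly_Mapping.lookup (Poly_Mapping.map ((*) c) p) m"
    by (simp add: pconst_def mult_map_scale_conv_mult)
  also have "\<dots> = c * Poly_Mapping.lookup p m"
    by (simp add: Poly_Mapping.map.rep_eq when_def)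
  finally show ?thesis .
qed

lemma polys_eq_supported: "polys X = supported (monomials X)"
  by (simp add: polys_def supported_def)

lemma monomials_zero [simp]: "0 \<in> monomials X"
  by (simp add: monomials_def)

lemma monomials_add: "m \<in> monomials X \<Longrightarrow> m' \<in> monomials X \<Longrightarrow> m + m' \<in> monomials X"
  unfolding monomials_def
  by (rule CollectI, rule subset_trans[OF keys_add]) simp

lemma polys_zero [simp]: "0 \<in> polys X"
  and polys_add: "p \<in> polys X \<Longrightarrow> q \<in> polys X \<Longrightarrow> p + q \<in> polys X"
  and polys_uminus: "p \<in> polys X \<Longrightarrow> - p \<in> polys X"
  and polys_diff: "p \<in> polys X \<Longrightarrow> q \<in> polys X \<Longrightarrow> p - q \<in> polys X"
  by (simp_all add: polys_eq_supported supported_intros)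

lemma polys_mult: "p \<in> polys X \<Longrightarrow> q \<in> polys X \<Longrightarrow> p * q \<in> polys X"
  unfolding polys_eq_supported by (rule supported_mult) (auto intro: monomials_add)

lemma polys_pconst [simp]: "pconst c \<in> polys X"
  unfolding polys_eq_supported pconst_def by (rule supported_single) simp

lemma polys_one [simp]: "1 \<in> polys X"
  using polys_pconst[of 1] by simp

lemma polys_pvar: "x \<in> X \<Longrightarrow> pvar x \<in> polys X"
  unfolding polys_eq_supported pvar_def by (rule supported_pterm) (simp add: monomials_def)

lemma polys_power: "p \<in> polys X \<Longrightarrow> p ^ k \<in> polys X"
  by (induction k) (simp_all add: polys_mult)

lemma polys_sum: "(\<And>x. x \<in> F \<Longrightarrow> f x \<in> polys X) \<Longrightarrow> sum f F \<in> polys X"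
  by (simp add: polys_eq_supported supported_sum)

lemmas polys_intros = polys_add polys_uminus polys_diff polys_mult polys_power polys_pvar

section \<open>Total degree and homogeneous components\<close>

lemma total_degree_superset:
  assumes "finite F" "Poly_Mapping.keys m \<subseteq> F"
  shows "total_degree m = (\<Sum>x\<in>F. Poly_Mapping.lookup m x)"
  unfolding total_degree_def using assms
  by (intro sum.mono_neutral_left) (auto simp: in_keys_iff)

lemma total_degree_zero [simp]: "total_degree 0 = 0"
  by (simp add: total_degree_def)

lemma total_degree_single [simp]: "total_degree (Poly_Mapping.single x k) = k"
  by (simp add: total_degree_def)

lemma total_degree_add [simp]: "total_degree (m + m') = total_degree m + total_degree m'"
proof -
  let ?F = "Poly_Mapping.keys m \<union> Poly_Mapping.keys m'"
  have "Poly_Mapping.keys (m + m') \<subseteq> ?F" by (rule keys_add)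
  then show ?thesis
    by (simp add: total_degree_superset[of ?F] lookup_add sum.distrib)
qed

lemma lookup_le_total_degree: "Poly_Mapping.lookup m x \<le> total_degree m"
  unfolding total_degree_def
  by (cases "x \<in> Poly_Mapping.keys m") (auto intro: member_le_sum simp: in_keys_iff)

text \<open>The source of termination: reduction preserves the degree and therefore moves inside a
  finite set of monomials.\<close>

lemma finite_monomials_degree:
  assumes "finite X"
  shows "finite {m \<in> monomials X. total_degree m = d}"
proof (rule finite_imageD)
  show "inj_on Poly_Mapping.lookup {m \<in> monomials X. total_degree m = d}"
    by (rule inj_onI) (simp only: poly_mapping_eq_iff)
  have "Poly_Mapping.lookup ` {m \<in> monomials X. total_degree m = d} \<subseteq>
      {f. \<forall>x. (x \<in> X \<longrightarrow> f x \<in> {..d}) \<and> (x \<notin> X \<longrightarrow> f x = 0)}"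
  proof (rule image_subsetI, intro CollectI allI conjI impI)
    fix m x assume m: "m \<in> {m \<in> monomials X. total_degree m = d}"
    show "Poly_Mapping.lookup m x \<in> {..d}" using m lookup_le_total_degree[of m x] by simp
    show "Poly_Mapping.lookup m x = 0" if "x \<notin> X"
    proof -
      have "x \<notin> Poly_Mapping.keys m" using m that by (simp add: monomials_def) blast
      then show ?thesis by (simp only: in_keys_iff not_not)
    qed
  qed
  then show "finite (Poly_Mapping.lookup ` {m \<in> monomials X. total_degree m = d})"
    by (rule finite_subset) (rule finite_set_of_finite_funs[OF assms finite_atMost])
qed

lemma deg_part_poly_algebra:
  "deg_part (poly_algebra X) d = supported {m \<in> monomials X. total_degree m = d}"
  by (auto simp: poly_algebra_def polys_def supported_def)

definition hcomp :: "nat \<Rightarrow> ('x, 'k::field) mpoly \<Rightarrow> ('x, 'k) mpoly" where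
  "hcomp d p = (\<Sum>m\<in>{m \<in> Poly_Mapping.keys p. total_degree m = d}.
     Poly_Mapping.single m (Poly_Mapping.lookup p m))"

lemma lookup_hcomp:
  "Poly_Mapping.lookup (hcomp d p) m = (if total_degree m = d then Poly_Mapping.lookup p m else 0)"
  by (auto simp: hcomp_def lookup_sum lookup_single when_def in_keys_iff)

lemma hcomp_zero [simp]: "hcomp d 0 = 0"
  by (simp add: hcomp_def)

lemma hcomp_add: "hcomp d (p + q) = hcomp d p + hcomp d q"
  by (rule poly_mapping_eqI) (simp add: lookup_hcomp lookup_add)

lemma hcomp_single:
  "hcomp d (Poly_Mapping.single m c) = (if total_degree m = d then Poly_Mapping.single m c else 0)"
  by (rule poly_mapping_eqI) (auto simp: lookup_hcomp lookup_single when_def)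

lemma hcomp_single_mult:
  "hcomp d (Poly_Mapping.single m c * p) =
    (if total_degree m \<le> d then Poly_Mapping.single m c * hcomp (d - total_degree m) p else 0)"
  by (induction p rule: mpoly_induct_UNIV)
    (auto simp: distrib_left hcomp_add mult_single hcomp_single)

lemma hcomp_supported:
  "p \<in> supported S \<Longrightarrow> hcomp d p \<in> supported {m \<in> S. total_degree m = d}"
  by (auto simp: supported_def in_keys_iff lookup_hcomp split: if_splits)

lemma hcomp_homogeneous:
  assumes "p \<in> supported {m \<in> S. total_degree m = e}"
  shows "hcomp d p = (if d = e then p else 0)"
  using assms by (intro poly_mapping_eqI) (auto simp: lookup_hcomp supported_def in_keys_iff)

section \<open>Ideals and quotients\<close>

lemma poly_algebra_simps [simp]:
  "carrier (poly_algebra X) = polys X" "monoid.mult (poly_algebra X) = (*)"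
  "one (poly_algebra X) = 1" "zero (poly_algebra X) = 0" "add (poly_algebra X) = (+)"
  "module.smult (poly_algebra X) = (\<lambda>c p. pconst c * p)"
  by (simp_all add: poly_algebra_def)

lemma cring_poly_algebra: "cring (poly_algebra X :: ('k::field, ('x, 'k) mpoly) graded_algebra)"
proof (rule cringI)
  show "abelian_group (poly_algebra X :: ('k, ('x, 'k) mpoly) graded_algebra)"
  proof (rule abelian_groupI)
    fix p :: "('x, 'k) mpoly" assume "p \<in> carrier (poly_algebra X)"
    then show "\<exists>q\<in>carrier (poly_algebra X). q \<oplus>\<^bsub>poly_algebra X\<^esub> p = \<zero>\<^bsub>poly_algebra X\<^esub>"
      by (intro bexI[of _ "- p"]) (simp_all add: polys_uminus)
  qed (simp_all add: add_ac polys_add)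
  show "Group.comm_monoid (poly_algebra X :: ('k, ('x, 'k) mpoly) graded_algebra)"
    by (rule comm_monoidI) (simp_all add: mult_ac polys_mult)
qed (simp add: distrib_right)

lemma ring_poly_algebra: "ring (poly_algebra X)"
  using cring_poly_algebra cring.axioms(1) by blast

lemma a_inv_poly_algebra:
  assumes "p \<in> polys X" shows "\<ominus>\<^bsub>poly_algebra X\<^esub> p = - p"
proof -
  interpret cring "poly_algebra X" by (rule cring_poly_algebra)
  show ?thesis
    by (rule minus_equality) (use assms in \<open>auto simp: polys_uminus\<close>)
qed

lemma poly_idealI:
  assumes "K \<subseteq> polys X" "0 \<in> K" "\<And>a b. a \<in> K \<Longrightarrow> b \<in> K \<Longrightarrow> a + b \<in> K"
    and mult: "\<And>a r. a \<in> K \<Longrightarrow> r \<in> polys X \<Longrightarrow> r * a \<in> K"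
  shows "ideal K (poly_algebra X)"
proof (rule idealI)
  interpret cring "poly_algebra X" by (rule cring_poly_algebra)
  show "subgroup K (add_monoid (poly_algebra X))"
  proof (rule add.subgroupI)
    fix a assume "a \<in> K"
    then show "\<ominus>\<^bsub>poly_algebra X\<^esub> a \<in> K"
      using assms(1) mult[of a "-1"] by (auto simp: a_inv_poly_algebra polys_uminus)
  qed (use assms in auto)
qed (use assms in \<open>auto simp: mult.commute ring_poly_algebra\<close>)

text \<open>Every multiplier is a sum of terms. Sets defined through \<open>hcomp\<close> are
  handled this way, since multiplication by one term merely shifts homogeneous components.\<close>

lemma poly_idealI_single:
  assumes "K \<subseteq> polys X" "0 \<in> K" and add: "\<And>a b. a \<in> K \<Longrightarrow> b \<in> K \<Longrightarrow> a + b \<in> K"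
    and mult: "\<And>a m c. a \<in> K \<Longrightarrow> m \<in> monomials X \<Longrightarrow> Poly_Mapping.single m c * a \<in> K"
  shows "ideal K (poly_algebra X)"
proof (rule poly_idealI)
  fix a r :: "('a, 'b) mpoly" assume "a \<in> K" "r \<in> polys X"
  from this(2) have "Poly_Mapping.keys r \<subseteq> monomials X" by (simp add: polys_def)
  then show "r * a \<in> K"
    by (induction r rule: mpoly_induct) (use \<open>a \<in> K\<close> assms in \<open>auto simp: distrib_right\<close>)
qed (use assms in auto)

lemma
  assumes "ideal K (poly_algebra X)"
  shows poly_ideal_subset: "K \<subseteq> polys X"
    and poly_ideal_zero: "0 \<in> K"
    and poly_ideal_add: "a \<in> K \<Longrightarrow> b \<in> K \<Longrightarrow> a + b \<in> K"
    and poly_ideal_mult: "a \<in> K \<Longrightarrow> r \<in> polys X \<Longrightarrow> r * a \<in> K"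
    and poly_ideal_uminus: "a \<in> K \<Longrightarrow> - a \<in> K"
    and poly_ideal_diff: "a \<in> K \<Longrightarrow> b \<in> K \<Longrightarrow> a - b \<in> K"
proof -
  interpret ideal K "poly_algebra X" by (rule assms)
  show "K \<subseteq> polys X" using Icarr by auto
  show "0 \<in> K" using additive_subgroup.zero_closed[OF additive_subgroup_axioms] by simp
  show add: "a + b \<in> K" if "a \<in> K" "b \<in> K" for a b using additive_subgroup.a_closed[OF additive_subgroup_axioms that] by simp
  show mult: "r * a \<in> K" if "a \<in> K" "r \<in> polys X" for a r using I_l_closed[of a r] that by simp
  show minus: "- a \<in> K" if "a \<in> K" for a using mult[OF that, of "-1"] by (simp add: polys_uminus)
  show "a - b \<in> K" if "a \<in> K" "b \<in> K" for a b using add[OF that(1) minus[OF that(2)]] by simp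
qed

lemma
  assumes "S \<subseteq> polys X"
  shows poly_genideal_ideal: "ideal (Idl\<^bsub>poly_algebra X\<^esub> S) (poly_algebra X)"
    and poly_genideal_self: "S \<subseteq> Idl\<^bsub>poly_algebra X\<^esub> S"
  using ring.genideal_ideal[OF ring_poly_algebra, of S] ring.genideal_self[OF ring_poly_algebra, of S] assms
  by simp_all

lemma poly_genideal_minimal:
  "ideal K (poly_algebra X) \<Longrightarrow> S \<subseteq> K \<Longrightarrow> Idl\<^bsub>poly_algebra X\<^esub> S \<subseteq> K"
  by (rule ring.genideal_minimal[OF ring_poly_algebra])

section \<open>The generators and their leading monomials\<close>

definition mon2 :: "'x \<Rightarrow> 'x \<Rightarrow> 'x mon" where
  "mon2 x y = Poly_Mapping.single x 1 + Poly_Mapping.single y 1"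

lemma mon2_commute: "mon2 x y = mon2 y x"
  by (simp add: mon2_def add.commute)

lemma total_degree_mon2 [simp]: "total_degree (mon2 x y) = 2"
  by (simp add: mon2_def)

lemma mon2_in_monomials: "x \<in> X \<Longrightarrow> y \<in> X \<Longrightarrow> mon2 x y \<in> monomials X"
  unfolding mon2_def by (intro monomials_add) (simp_all add: monomials_def)

lemma pvar_mult: "pvar x * pvar y = pterm (mon2 x y)"
  by (simp add: pvar_def mon2_def pterm_add)

lemma pvar_square: "pvar x ^ 2 = pterm (mon2 x x)"
  by (simp add: power2_eq_square pvar_mult)

lemma two_pvar_mult:
  "2 * pvar x * pvar y = pconst 2 * pterm (mon2 x y)"
  "- 2 * pvar x * pvar y = pconst (- 2) * pterm (mon2 x y)"
  by (simp_all add: pconst_uminus pconst_numeral mult.assoc pvar_mult)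

lemma block_intros [simp]:
  "U k \<in> block k" "1 \<le> i \<Longrightarrow> i < k \<Longrightarrow> V i k \<in> block k" "1 \<le> i \<Longrightarrow> i < k \<Longrightarrow> W i k \<in> block k"
  by (simp_all add: block_def)

lemma uvw_vars_eq: "uvw_vars n = (\<Union>k\<in>{1..n}. block k)"
  unfolding uvw_vars_def block_def by (auto intro: order_less_imp_le order_le_less_trans)

lemma finite_block: "finite (block k)"
proof -
  have "block k = {U k} \<union> (\<lambda>i. V i k) ` {1..<k} \<union> (\<lambda>i. W i k) ` {1..<k}"
    by (auto simp: block_def)
  then show ?thesis by simp
qed

lemma finite_uvw_vars: "finite (uvw_vars n)"
  by (simp add: uvw_vars_eq finite_block)

lemma block_disjoint: "x \<in> block k \<Longrightarrow> x \<in> block l \<Longrightarrow> k = l"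
  by (auto simp: block_def)

definition lower_mons :: "nat \<Rightarrow> uvw_var mon set" where
  "lower_mons k = {mon2 x y | x y a. 1 \<le> a \<and> a < k \<and> x \<in> block a \<and> y \<in> block k}"

lemma lower_monsI:
  "1 \<le> a \<Longrightarrow> a < k \<Longrightarrow> x \<in> block a \<Longrightarrow> y \<in> block k \<Longrightarrow> mon2 x y \<in> lower_mons k"
  by (auto simp: lower_mons_def)

text \<open>The leading monomial expressed without an order: all other monomials lie in V_a V_k with
  a < k, which every admissible order puts below V_k V_k. The coefficient is only required to be
  nonzero (it is 1 or -1 for the generators), matching initial terms taken without
  coefficients.\<close>

definition lead_form :: "nat \<Rightarrow> uvw_var \<Rightarrow> uvw_var \<Rightarrow> (uvw_var, 'k::field) mpoly \<Rightarrow> bool" where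
  "lead_form k x y g \<longleftrightarrow> x \<in> block k \<and> y \<in> block k \<and>
     (\<exists>c r. c \<noteq> 0 \<and> r \<in> supported (lower_mons k) \<and> g = pconst c * pterm (mon2 x y) + r)"

lemma lead_formI:
  "x \<in> block k \<Longrightarrow> y \<in> block k \<Longrightarrow> c \<noteq> 0 \<Longrightarrow> r \<in> supported (lower_mons k) \<Longrightarrow>
    g = pconst c * pterm (mon2 x y) + r \<Longrightarrow> lead_form k x y g"
  by (auto simp: lead_form_def)

lemma lead_form_commute: "lead_form k x y g \<longleftrightarrow> lead_form k y x g"
  by (auto simp: lead_form_def mon2_commute[of x y])

lemma lead_form_uu: "lead_form i (U i) (U i) (u i ^ 2)"
  by (rule lead_formI[where c = 1 and r = 0]) (simp_all add: pvar_square)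

context
  fixes i j :: nat
  assumes ij: "1 \<le> i" "i < j"
begin

lemma lead_form_vw: "lead_form j (V i j) (W i j) (v i j * w i j)"
  by (rule lead_formI[where c = 1 and r = 0]) (use ij in \<open>simp_all add: pvar_mult\<close>)

lemma lead_form_uv: "lead_form j (U j) (V i j) (u i * w i j - u j * v i j)"
  by (rule lead_formI[where c = "-1" and r = "pterm (mon2 (U i) (W i j))"])
    (use ij in \<open>auto simp: pvar_mult pconst_uminus intro!: supported_intros lower_monsI[of i]\<close>)

lemma lead_form_vv: "lead_form j (V i j) (V i j) (- 2 * u i * w i j + v i j ^ 2)"
  by (rule lead_formI[where c = 1 and r = "pconst (-2) * pterm (mon2 (U i) (W i j))"])
    (use ij in \<open>auto simp: pvar_square two_pvar_mult pconst_uminus intro!: supported_intros lower_monsI[of i]\<close>)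

lemma lead_form_ww: "lead_form j (W i j) (W i j) (2 * u i * w i j + w i j ^ 2)"
  by (rule lead_formI[where c = 1 and r = "pconst 2 * pterm (mon2 (U i) (W i j))"])
    (use ij in \<open>auto simp: pvar_square two_pvar_mult pconst_uminus intro!: supported_intros lower_monsI[of i]\<close>)

lemma lead_form_uw: "lead_form j (U j) (W i j) (u i * v i j - 2 * u i * u j - u j * w i j)"
  by (rule lead_formI[where c = "-1" and
        r = "pterm (mon2 (U i) (V i j)) - pconst 2 * pterm (mon2 (U i) (U j))"])
    (use ij in \<open>auto simp: pvar_mult two_pvar_mult pconst_uminus intro!: supported_intros lower_monsI[of i]\<close>)

end

context
  fixes i j k :: nat
  assumes ijk: "1 \<le> i" "i < j" "j < k"
begin

text \<open>In the three-index relations each non-leading monomial is a variable with indices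
  \<open>i j\<close>, hence in V_j, times a variable of V_k.\<close>

lemma in_lower_mons3:
  "x \<in> block j \<Longrightarrow> y \<in> block k \<Longrightarrow> mon2 x y \<in> lower_mons k"
  using ijk by (intro lower_monsI[of j]) auto

lemma lead_form_vvk:
  "lead_form k (V i k) (V j k) (v i j * w j k - w i j * w i k - v i k * v j k)"
  by (rule lead_formI[where c = "-1" and
        r = "pterm (mon2 (V i j) (W j k)) - pterm (mon2 (W i j) (W i k))"])
    (use ijk in \<open>auto simp: pvar_mult pconst_uminus intro!: supported_intros in_lower_mons3\<close>)

lemma lead_form_wwk:
  "lead_form k (W i k) (W j k) (w i j * w j k - v i j * w i k - w i k * w j k)"
  by (rule lead_formI[where c = "-1" and
        r = "pterm (mon2 (W i j) (W j k)) - pterm (mon2 (V i j) (W i k))"])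
    (use ijk in \<open>auto simp: pvar_mult pconst_uminus intro!: supported_intros in_lower_mons3\<close>)

lemma lead_form_vwk:
  "lead_form k (V i k) (W j k) (v i j * v j k - v i j * v i k - v i k * w j k)"
  by (rule lead_formI[where c = "-1" and
        r = "pterm (mon2 (V i j) (V j k)) - pterm (mon2 (V i j) (V i k))"])
    (use ijk in \<open>auto simp: pvar_mult pconst_uminus intro!: supported_intros in_lower_mons3\<close>)

lemma lead_form_wvk:
  "lead_form k (W i k) (V j k) (w i j * v j k - w i j * v i k - w i k * v j k)"
  by (rule lead_formI[where c = "-1" and
        r = "pterm (mon2 (W i j) (V j k)) - pterm (mon2 (W i j) (V i k))"])
    (use ijk in \<open>auto simp: pvar_mult pconst_uminus intro!: supported_intros in_lower_mons3\<close>)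

end

lemma
  shows G_gensI1: "1 \<le> i \<Longrightarrow> i \<le> n \<Longrightarrow> u i ^ 2 \<in> G_gens n"
    and G_gensI2: "1 \<le> i \<Longrightarrow> i < j \<Longrightarrow> j \<le> n \<Longrightarrow>
      {v i j * w i j, u i * w i j - u j * v i j, - 2 * u i * w i j + v i j ^ 2,
       2 * u i * w i j + w i j ^ 2, u i * v i j - 2 * u i * u j - u j * w i j} \<subseteq> G_gens n"
    and G_gensI3: "1 \<le> i \<Longrightarrow> i < j \<Longrightarrow> j < k \<Longrightarrow> k \<le> n \<Longrightarrow>
      {v i j * w j k - w i j * w i k - v i k * v j k,
        w i j * w j k - v i j * w i k - w i k * w j k,
        v i j * v j k - v i j * v i k - v i k * w j k,
        w i j * v j k - w i j * v i k - w i k * v j k} \<subseteq> G_gens n"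
  unfolding G_gens_def by fastforce+

lemma G_gens_cases [consumes 1, case_names one two three]:
  assumes "g \<in> G_gens n"
  obtains i where "1 \<le> i" "i \<le> n" "g = u i ^ 2"
  | i j where "1 \<le> i" "i < j" "j \<le> n"
      "g \<in> {v i j * w i j, u i * w i j - u j * v i j, - 2 * u i * w i j + v i j ^ 2,
       2 * u i * w i j + w i j ^ 2, u i * v i j - 2 * u i * u j - u j * w i j}"
  | i j k where "1 \<le> i" "i < j" "j < k" "k \<le> n"
      "g \<in> {v i j * w j k - w i j * w i k - v i k * v j k,
        w i j * w j k - v i j * w i k - w i k * w j k,
        v i j * v j k - v i j * v i k - v i k * w j k,
        w i j * v j k - w i j * v i k - w i k * v j k}"
  using assms unfolding G_gens_def by (elim UnE UN_E) (fastforce split: prod.splits)+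

lemma G_gens_lead_form:
  assumes "g \<in> G_gens n"
  shows "\<exists>k\<in>{1..n}. \<exists>x y. lead_form k x y g"
  using assms
proof (cases rule: G_gens_cases)
  case (one i)
  then show ?thesis using lead_form_uu[of i] by (intro bexI[of _ i]) auto
next
  case (two i j)
  then have "j \<in> {1..n}" by simp
  moreover have "\<exists>x y. lead_form j x y g"
    using two lead_form_vw lead_form_uv lead_form_vv lead_form_ww lead_form_uw
    by (elim insertE emptyE) blast+
  ultimately show ?thesis by blast
next
  case (three i j k)
  then have "k \<in> {1..n}" by simp
  moreover have "\<exists>x y. lead_form k x y g"
    using three lead_form_vvk lead_form_wwk lead_form_vwk lead_form_wvk
    by (elim insertE emptyE) blast+
  ultimately show ?thesis by blast
qed

text \<open>The generators match the pairs: V_k has k(2k - 1) unordered pairs of variables,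
  repetition allowed, and the relations with largest index k number 1 + 5(k - 1) + 4 binom(k - 1,
  2), which is the same. The proof goes through the kinds of pairs; \<open>lead_form_commute\<close>
  settles the order of the two factors.\<close>

lemma exists_lead_form:
  assumes k: "k \<in> {1..n}" and "x \<in> block k" "y \<in> block k"
  shows "\<exists>g\<in>G_gens n. lead_form k x y (g :: (uvw_var, 'k::field) mpoly)"
proof -
  let ?P = "\<lambda>x y. \<exists>g\<in>G_gens n. lead_form k x y (g :: (uvw_var, 'k) mpoly)"
  have sym: "?P y x \<Longrightarrow> ?P x y" for x y by (subst lead_form_commute)
  have UU: "?P (U k) (U k)" using k lead_form_uu G_gensI1[of k n] by auto
  have two: "?P (V i k) (W i k)" "?P (U k) (V i k)" "?P (V i k) (V i k)" "?P (W i k) (W i k)"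
    "?P (U k) (W i k)" if "1 \<le> i" "i < k" for i
    using lead_form_vw[OF that] lead_form_uv[OF that] lead_form_vv[OF that] lead_form_ww[OF that]
      lead_form_uw[OF that] G_gensI2[of i k n] that k
    by (simp_all only: insert_subset atLeastAtMost_iff) blast+
  have three: "?P (V i k) (V j k)" "?P (W i k) (W j k)" "?P (V i k) (W j k)" "?P (W i k) (V j k)"
    if "1 \<le> i" "i < j" "j < k" for i j
    using lead_form_vvk[OF that] lead_form_wwk[OF that] lead_form_vwk[OF that] lead_form_wvk[OF that]
      G_gensI3[of i j k n] that k
    by (simp_all only: insert_subset atLeastAtMost_iff) blast+
  have VV: "?P (V i k) (V j k)" if "1 \<le> i" "i < k" "1 \<le> j" "j < k" for i j
    using two(3)[of i] three(1)[of i j] sym[OF three(1)[of j i]] that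
    by (cases i j rule: linorder_cases) blast+
  have WW: "?P (W i k) (W j k)" if "1 \<le> i" "i < k" "1 \<le> j" "j < k" for i j
    using two(4)[of i] three(2)[of i j] sym[OF three(2)[of j i]] that
    by (cases i j rule: linorder_cases) blast+
  \<comment> \<open>The two mixed three-index relations share the work: V_ik W_jk comes from one if
    i < j and from the other, with indices exchanged, if j < i. For i = j it is the leading monomial
    of v w.\<close>
  have VW: "?P (V i k) (W j k)" if "1 \<le> i" "i < k" "1 \<le> j" "j < k" for i j
    using two(1)[of i] three(3)[of i j] sym[OF three(4)[of j i]] that
    by (cases i j rule: linorder_cases) blast+
  have cases: "z = U k \<or> (\<exists>i. 1 \<le> i \<and> i < k \<and> z = V i k) \<or> (\<exists>i. 1 \<le> i \<and> i < k \<and> z = W i k)"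
    if "z \<in> block k" for z
    using that by (auto simp: block_def)
  from cases[OF assms(2)] cases[OF assms(3)] show ?thesis
    using UU two(2,5) sym[OF two(2)] sym[OF two(5)] VV WW VW sym[OF VW]
    by (elim disjE exE conjE) (simp_all only:)
qed

section \<open>Standard monomials span\<close>

text \<open>A square and a product of two different variables of one block are treated alike, as
  \<open>mon2 x y\<close> with \<open>x = y\<close> allowed. Being nonstandard thus becomes
  divisibility by the leading monomial of a generator.\<close>

lemma block_squarefree_iff:
  assumes "m \<in> monomials (uvw_vars n)"
  shows "m \<in> block_squarefree_monomials n \<longleftrightarrow>
    \<not> (\<exists>k\<in>{1..n}. \<exists>x\<in>block k. \<exists>y\<in>block k. \<exists>t\<in>monomials (uvw_vars n). m = mon2 x y + t)"
    (is "_ \<longleftrightarrow> \<not> ?R")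
proof
  assume m: "m \<in> block_squarefree_monomials n"
  show "\<not> ?R"
  proof
    assume ?R
    then obtain k x y t where k: "k \<in> {1..n}" "x \<in> block k" "y \<in> block k" and eq: "m = mon2 x y + t"
      by blast
    have l: "Poly_Mapping.lookup m z = (if z = x then 1 else 0) + (if z = y then 1 else 0) + Poly_Mapping.lookup t z"
      for z
      unfolding eq mon2_def by (simp add: lookup_add lookup_single when_def)
    have le: "Poly_Mapping.lookup m x \<le> 1" and card: "card (Poly_Mapping.keys m \<inter> block k) \<le> 1"
      using m k(1) by (auto simp: block_squarefree_monomials_def)
    from le l[of x] have "x \<noteq> y" by (auto split: if_splits)
    moreover have "{x, y} \<subseteq> Poly_Mapping.keys m \<inter> block k"
      using k l[of x] l[of y] by (simp add: in_keys_iff)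
    then have "card {x, y} \<le> card (Poly_Mapping.keys m \<inter> block k)"
      by (intro card_mono) auto
    ultimately show False using card by simp
  qed
next
  assume R: "\<not> ?R"
  have split: ?R if "k \<in> {1..n}" "x \<in> block k" "y \<in> block k"
    and le: "\<And>z. Poly_Mapping.lookup (mon2 x y) z \<le> Poly_Mapping.lookup m z" for k x y
  proof -
    \<comment> \<open>Subtraction of exponents is truncated at 0; \<open>le\<close> makes it
      exact.\<close>
    have eq: "m = mon2 x y + (m - mon2 x y)"
      by (rule poly_mapping_eqI) (use le in \<open>simp add: lookup_add lookup_minus\<close>)
    have "Poly_Mapping.keys (m - mon2 x y) \<subseteq> Poly_Mapping.keys m"
      by (rule subsetI) (simp add: in_keys_iff lookup_minus)
    then have "m - mon2 x y \<in> monomials (uvw_vars n)"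
      using assms by (simp add: monomials_def)
    with that eq show ?R by blast
  qed
  have "Poly_Mapping.lookup m x \<le> 1" for x
  proof (rule ccontr)
    assume gt: "\<not> Poly_Mapping.lookup m x \<le> 1"
    then have "x \<in> Poly_Mapping.keys m" by (simp add: in_keys_iff)
    then obtain k where k: "k \<in> {1..n}" "x \<in> block k"
      using assms by (auto simp: monomials_def uvw_vars_eq)
    have "?R"
      by (rule split[of k x x]) (use k gt in \<open>auto simp: mon2_def lookup_add lookup_single when_def\<close>)
    with R show False ..
  qed
  moreover have "card (Poly_Mapping.keys m \<inter> block k) \<le> 1" if k: "k \<in> {1..n}" for k
  proof (rule ccontr)
    assume "\<not> ?thesis"
    then have "\<not> is_singleton (Poly_Mapping.keys m \<inter> block k)" "Poly_Mapping.keys m \<inter> block k \<noteq> {}"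
      by (auto simp: is_singleton_altdef)
    then obtain x y where xy: "x \<in> Poly_Mapping.keys m" "y \<in> Poly_Mapping.keys m" "x \<in> block k"
      "y \<in> block k" "x \<noteq> y"
      unfolding is_singleton_def by blast
    have "?R"
    proof (rule split[of k x y])
      fix z
      show "Poly_Mapping.lookup (mon2 x y) z \<le> Poly_Mapping.lookup m z"
        using xy by (auto simp: mon2_def lookup_add lookup_single when_def in_keys_iff)
    qed (use k xy in auto)
    with R show False ..
  qed
  ultimately show "m \<in> block_squarefree_monomials n"
    using assms by (simp add: block_squarefree_monomials_def)
qed

lemma
  shows ideal_I: "ideal (I_ideal n :: (uvw_var, 'k::field) mpoly set) (uvw_algebra n)"
    and G_subset_I: "(G_gens n :: (uvw_var, 'k) mpoly set) \<subseteq> I_ideal n"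
    and G_homogeneous: "(G_gens n :: (uvw_var, 'k) mpoly set) \<subseteq>
      supported {m \<in> monomials (uvw_vars n). total_degree m = 2}"
proof -
  show G: "(G_gens n :: (uvw_var, 'k) mpoly set) \<subseteq>
      supported {m \<in> monomials (uvw_vars n). total_degree m = 2}"
  proof
    fix g :: "(uvw_var, 'k) mpoly" assume "g \<in> G_gens n"
    then obtain k x y where k: "k \<in> {1..n}" and "lead_form k x y g" using G_gens_lead_form by blast
    then obtain c r where xy: "x \<in> block k" "y \<in> block k" and r: "r \<in> supported (lower_mons k)"
      and g: "g = pconst c * pterm (mon2 x y) + r" by (auto simp: lead_form_def)
    have "lower_mons k \<subseteq> {m \<in> monomials (uvw_vars n). total_degree m = 2}"
      using k by (fastforce simp: lower_mons_def uvw_vars_eq intro!: mon2_in_monomials)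
    moreover have "mon2 x y \<in> {m \<in> monomials (uvw_vars n). total_degree m = 2}"
      using k xy by (auto simp: uvw_vars_eq intro!: mon2_in_monomials)
    ultimately show "g \<in> supported {m \<in> monomials (uvw_vars n). total_degree m = 2}"
      unfolding g using r by (intro supported_intros) (auto intro: supported_mono)
  qed
  have "supported {m \<in> monomials (uvw_vars n). total_degree m = 2} \<subseteq> (polys (uvw_vars n) :: (uvw_var, 'k) mpoly set)"
    by (auto simp: polys_eq_supported intro: supported_mono)
  then have "(G_gens n :: (uvw_var, 'k) mpoly set) \<subseteq> polys (uvw_vars n)" using G by blast
  then show "ideal (I_ideal n :: (uvw_var, 'k) mpoly set) (uvw_algebra n)"
    "(G_gens n :: (uvw_var, 'k) mpoly set) \<subseteq> I_ideal n"
    unfolding I_ideal_def by (rule poly_genideal_ideal, rule poly_genideal_self)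
qed

text \<open>Besides the monomial orders of the theorem, the weight order in which every variable of the
  block \<open>V\<^sub>k\<close> has weight \<open>k\<close> is an instance; it is used where no monomial order is given.\<close>

locale block_order =
  fixes n :: nat and lt :: "uvw_var mon \<Rightarrow> uvw_var mon \<Rightarrow> bool"
  assumes lt_irrefl: "m \<in> monomials (uvw_vars n) \<Longrightarrow> \<not> lt m m"
    and lt_trans: "lt m1 m2 \<Longrightarrow> lt m2 m3 \<Longrightarrow> m1 \<in> monomials (uvw_vars n) \<Longrightarrow>
      m2 \<in> monomials (uvw_vars n) \<Longrightarrow> m3 \<in> monomials (uvw_vars n) \<Longrightarrow> lt m1 m3"
    and lt_add: "lt m m' \<Longrightarrow> m \<in> monomials (uvw_vars n) \<Longrightarrow> m' \<in> monomials (uvw_vars n) \<Longrightarrow>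
      t \<in> monomials (uvw_vars n) \<Longrightarrow> lt (m + t) (m' + t)"
    and lt_lower: "k \<in> {1..n} \<Longrightarrow> m \<in> lower_mons k \<Longrightarrow> x \<in> block k \<Longrightarrow> y \<in> block k \<Longrightarrow> lt m (mon2 x y)"
begin

text \<open>Both conditions on \<open>t\<close> have a use: equality of degrees feeds the filtration
  argument on the chambers, and the comparison with \<open>m\<close> feeds the statements on leading
  monomials. The case \<open>t = m\<close> arises when \<open>m\<close> is itself standard.\<close>

definition std_below :: "uvw_var mon \<Rightarrow> uvw_var mon set" where
  "std_below m = {t \<in> block_squarefree_monomials n.
     total_degree t = total_degree m \<and> (t = m \<or> lt t m)}"

text \<open>One step of division: \<open>m\<close> is a cofactor \<open>t\<close> times the leading
  monomial of some generator \<open>g\<close>. Multiplying \<open>g\<close> by \<open>t\<close> and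
  dividing by its leading coefficient shows that \<open>m\<close> is congruent to \<open>q\<close>,
  whose monomials are lower monomials of \<open>g\<close> times \<open>t\<close>.\<close>

lemma reduction_step:
  assumes m: "m \<in> monomials (uvw_vars n)" and ns: "m \<notin> block_squarefree_monomials n"
  shows "\<exists>q \<in> supported {t \<in> monomials (uvw_vars n). total_degree t = total_degree m \<and> lt t m}.
    pterm m - q \<in> (I_ideal n :: (uvw_var, 'k::field) mpoly set)"
proof -
  obtain k x y t where k: "k \<in> {1..n}" and xy: "x \<in> block k" "y \<in> block k"
    and t: "t \<in> monomials (uvw_vars n)" and eq: "m = mon2 x y + t"
    using block_squarefree_iff[OF m] ns by blast
  obtain g c r where g: "(g :: (uvw_var, 'k) mpoly) \<in> G_gens n" and c: "c \<noteq> 0"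
    and r: "r \<in> supported (lower_mons k)" and geq: "g = pconst c * pterm (mon2 x y) + r"
    using exists_lead_form[OF k xy] unfolding lead_form_def by blast
  define q where "q = - (pconst (inverse c) * (r * pterm t))"
  have low: "l + t \<in> {t \<in> monomials (uvw_vars n). total_degree t = total_degree m \<and> lt t m}"
    if l: "l \<in> lower_mons k" for l
  proof -
    have "l \<in> monomials (uvw_vars n)" and d: "total_degree l = 2"
      using l k by (fastforce simp: lower_mons_def uvw_vars_eq intro!: mon2_in_monomials)+
    moreover have "mon2 x y \<in> monomials (uvw_vars n)"
      using k xy by (auto simp: uvw_vars_eq intro!: mon2_in_monomials)
    ultimately show ?thesis
      using t lt_add[OF lt_lower[OF k l xy]] by (simp add: eq monomials_add)
  qed
  have "q \<in> supported {t \<in> monomials (uvw_vars n). total_degree t = total_degree m \<and> lt t m}"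
    unfolding q_def
  proof (intro supported_uminus supported_pconst_mult, rule supported_mult[OF r])
    show "pterm t \<in> supported {t}" by (simp add: supported_pterm)
  qed (use low in blast)
  moreover have "pterm m - q = (pconst (inverse c) * pterm t) * g"
  proof -
    have "pconst (inverse c) * pconst c = (1 :: (uvw_var, 'k) mpoly)"
      using c by (simp flip: pconst_mult)
    moreover have "pconst (inverse c) * pterm t * (pconst c * pterm (mon2 x y)) =
        (pconst (inverse c) * pconst c) * (pterm (mon2 x y) * pterm t :: (uvw_var, 'k) mpoly)"
      by (simp only: mult_ac)
    ultimately have "pconst (inverse c) * pterm t * (pconst c * pterm (mon2 x y)) = (pterm m :: (uvw_var, 'k) mpoly)"
      by (simp add: eq pterm_add)
    then show ?thesis
      by (simp add: geq q_def distrib_left mult_ac)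
  qed
  moreover have "pconst (inverse c) * pterm t * g \<in> I_ideal n"
    using g G_subset_I t
    by (intro poly_ideal_mult[OF ideal_I] polys_mult polys_pconst)
      (auto simp: polys_eq_supported supported_pterm)
  ultimately show ?thesis by (intro bexI[of _ q]) simp_all
qed

text \<open>Induction on the number of monomials of the same degree below \<open>m\<close>. By
  transitivity and irreflexivity this number drops strictly when \<open>m\<close> is replaced by a
  monomial \<open>t\<close> of its reduction, because \<open>t\<close> is below \<open>m\<close> but
  not below itself.\<close>

lemma standard_rep_pterm:
  assumes "m \<in> monomials (uvw_vars n)"
  shows "\<exists>q \<in> supported (std_below m). pterm m - q \<in> (I_ideal n :: (uvw_var, 'k::field) mpoly set)"
  using assms
proof (induction "card {t \<in> monomials (uvw_vars n). total_degree t = total_degree m \<and> lt t m}"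
    arbitrary: m rule: less_induct)
  case less
  let ?L = "\<lambda>m. {t \<in> monomials (uvw_vars n). total_degree t = total_degree m \<and> lt t m}"
  show ?case
  proof (cases "m \<in> block_squarefree_monomials n")
    case True
    then have "pterm m \<in> supported (std_below m)" by (intro supported_pterm) (simp add: std_below_def)
    then show ?thesis by (intro bexI[of _ "pterm m"]) (simp_all add: poly_ideal_zero[OF ideal_I])
  next
    case False
    obtain q where q: "q \<in> supported (?L m)" and qI: "pterm m - q \<in> (I_ideal n :: (uvw_var, 'k) mpoly set)"
      using reduction_step[OF less.prems False] by blast
    have fin: "finite (?L m)"
      by (rule finite_subset[OF _ finite_monomials_degree[OF finite_uvw_vars[of n], of "total_degree m"]]) auto
    from supportedD[OF q]
    have "\<exists>q' \<in> supported (std_below m). q - q' \<in> (I_ideal n :: (uvw_var, 'k) mpoly set)"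
    proof (induction q rule: mpoly_induct)
      case zero
      then show ?case by (intro bexI[of _ 0]) (simp_all add: poly_ideal_zero[OF ideal_I])
    next
      case (add t c q)
      from add(1) have t: "t \<in> monomials (uvw_vars n)" "total_degree t = total_degree m" "lt t m" by auto
      have "?L t \<subseteq> ?L m"
        using t lt_trans[OF _ t(3) _ t(1) less.prems] by auto
      moreover have "t \<in> ?L m" "t \<notin> ?L t" using t lt_irrefl by auto
      ultimately have "?L t \<subset> ?L m" by blast
      then have "card (?L t) < card (?L m)" using fin by (rule psubset_card_mono[rotated])
      from less.hyps[OF this t(1)] obtain q1
        where q1: "q1 \<in> supported (std_below t)" "pterm t - q1 \<in> (I_ideal n :: (uvw_var, 'k) mpoly set)" by blast
      have "std_below t \<subseteq> std_below m"
        using t lt_trans[OF _ t(3) _ t(1) less.prems]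
        by (auto simp: std_below_def block_squarefree_monomials_def)
      with q1(1) have q1': "q1 \<in> supported (std_below m)" by (rule supported_mono)
      from add(3) obtain q2 where q2: "q2 \<in> supported (std_below m)" "q - q2 \<in> (I_ideal n :: (uvw_var, 'k) mpoly set)" by blast
      have "Poly_Mapping.single t c + q - (pconst c * q1 + q2) = pconst c * (pterm t - q1) + (q - q2)"
        by (simp add: single_eq_pconst_pterm algebra_simps)
      also have "\<dots> \<in> I_ideal n"
        by (intro poly_ideal_add[OF ideal_I] poly_ideal_mult[OF ideal_I] q1 q2) simp
      finally have "Poly_Mapping.single t c + q - (pconst c * q1 + q2) \<in> I_ideal n" .
      moreover have "pconst c * q1 + q2 \<in> supported (std_below m)"
        by (intro supported_intros q1' q2)
      ultimately show ?case by blast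
    qed
    then obtain q' where "q' \<in> supported (std_below m)" "q - q' \<in> (I_ideal n :: (uvw_var, 'k) mpoly set)" by blast
    moreover from poly_ideal_add[OF ideal_I qI this(2)] have "pterm m - q' \<in> I_ideal n" by simp
    ultimately show ?thesis by blast
  qed
qed

end

text \<open>A product of two variables of V_k weighs 2k, a monomial of \<open>lower_mons k\<close>
  only a + k with a < k. Monomials of equal weight remain incomparable, which
  \<open>block_order\<close> permits.\<close>

lemma exists_block_order: "\<exists>lt. block_order n lt"
proof -
  define b where "b z = (case z of U k \<Rightarrow> k | V i k \<Rightarrow> k | W i k \<Rightarrow> k)" for z
  define wt where "wt m = (\<Sum>z\<in>uvw_vars n. Poly_Mapping.lookup m z * b z)" for m
  have add: "wt (m + m') = wt m + wt m'" for m m'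
    by (simp add: wt_def lookup_add distrib_right sum.distrib)
  have b: "b x = k" if "x \<in> block k" for x k
    using that by (auto simp: block_def b_def)
  have single: "wt (Poly_Mapping.single x 1) = k" if "x \<in> block k" "k \<in> {1..n}" for x k
  proof -
    have "x \<in> uvw_vars n" using that by (auto simp: uvw_vars_eq)
    have "wt (Poly_Mapping.single x 1) = (\<Sum>z\<in>uvw_vars n. if x = z then b z else 0)"
      unfolding wt_def by (rule sum.cong) (auto simp: lookup_single when_def)
    then show ?thesis using \<open>x \<in> uvw_vars n\<close> b[OF that(1)] by (simp add: finite_uvw_vars)
  qed
  have "block_order n (\<lambda>m m'. wt m < wt m')"
  proof
    fix k m x y assume "k \<in> {1..n}" "m \<in> lower_mons k" "x \<in> block k" "y \<in> block k"
    then show "wt m < wt (mon2 x y)"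
      by (auto simp: lower_mons_def mon2_def add single[simplified])
  qed (auto simp: add)
  then show "\<exists>lt. block_order n lt" by (intro exI[where x = "\<lambda>m m'. wt m < wt m'"])
qed

section \<open>Standard monomials are independent\<close>

text \<open>The polynomials with the asserted property form an ideal \<open>K\<close>: witnesses
  \<open>q\<close> add up, and multiplication by a monomial shifts the component and the degree
  bound by the same amount. It remains to see that \<open>K\<close> contains the generators.\<close>

lemma top_forms:
  fixes G :: "('x, 'k::field) mpoly set"
  assumes G: "G \<subseteq> supported {m \<in> monomials X. total_degree m = e}" and e: "0 < e"
    and const: "\<And>g. g \<in> G \<Longrightarrow> \<exists>c. \<forall>s\<in>P. pt.peval s g = c"
    and p: "p \<in> Idl\<^bsub>poly_algebra X\<^esub> G"
  shows "\<exists>q\<in>supported {m \<in> monomials X. total_degree m < d}. \<forall>s\<in>P. pt.peval s (hcomp d p + q) = 0"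
proof -
  let ?L = "\<lambda>d. {m \<in> monomials X. total_degree m < d}"
  \<comment> \<open>All degrees \<open>d\<close> are required at once: multiplying by
    \<open>m\<close> turns the condition for \<open>d - total_degree m\<close> into the one for
    \<open>d\<close>, so the condition for a single \<open>d\<close> would not define an
    ideal.\<close>
  define K where "K = {p \<in> polys X. \<forall>d. \<exists>q\<in>supported (?L d). \<forall>s\<in>P. pt.peval s (hcomp d p + q) = 0}"
  have "ideal K (poly_algebra X)"
  proof (rule poly_idealI_single)
    show "K \<subseteq> polys X" by (auto simp: K_def)
    show "0 \<in> K"
      unfolding K_def by (intro CollectI conjI allI bexI[of _ 0] ballI) simp_all
    show "a + b \<in> K" if ab: "a \<in> K" "b \<in> K" for a b
    proof -
      have "\<exists>q\<in>supported (?L d). \<forall>s\<in>P. pt.peval s (hcomp d (a + b) + q) = 0" for d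
      proof -
        obtain q1 where q1: "q1 \<in> supported (?L d)" "\<And>s. s \<in> P \<Longrightarrow> pt.peval s (hcomp d a + q1) = 0"
          using ab(1) unfolding K_def by blast
        obtain q2 where q2: "q2 \<in> supported (?L d)" "\<And>s. s \<in> P \<Longrightarrow> pt.peval s (hcomp d b + q2) = 0"
          using ab(2) unfolding K_def by blast
        have "pt.peval s (hcomp d (a + b) + (q1 + q2)) = 0" if "s \<in> P" for s
        proof -
          have "hcomp d (a + b) + (q1 + q2) = (hcomp d a + q1) + (hcomp d b + q2)"
            by (simp only: hcomp_add add_ac)
          then show ?thesis by (simp only: pt.peval_add[of s "hcomp d a + q1"] q1(2)[OF that] q2(2)[OF that] add_0)
        qed
        then show ?thesis using supported_add[OF q1(1) q2(1)] by blast
      qed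
      then show ?thesis using ab by (simp add: K_def polys_add)
    qed
    show "Poly_Mapping.single m c * a \<in> K" if a: "a \<in> K" and m: "m \<in> monomials X" for a m c
    proof -
      let ?m = "Poly_Mapping.single m c"
      have "\<exists>q\<in>supported (?L d). \<forall>s\<in>P. pt.peval s (hcomp d (?m * a) + q) = 0" for d
      proof (cases "total_degree m \<le> d")
        case True
        obtain q where q: "q \<in> supported (?L (d - total_degree m))"
          "\<And>s. s \<in> P \<Longrightarrow> pt.peval s (hcomp (d - total_degree m) a + q) = 0"
          using a unfolding K_def by blast
        have "?m * q \<in> supported (?L d)"
          by (rule supported_mult[of _ "{m}", OF supported_single q(1)])
            (use m in \<open>auto intro: monomials_add\<close>)
        moreover have "pt.peval s (hcomp d (?m * a) + ?m * q) = 0" if "s \<in> P" for s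
        proof -
          have "hcomp d (?m * a) + ?m * q = ?m * (hcomp (d - total_degree m) a + q)"
            using True by (simp add: hcomp_single_mult distrib_left)
          then show ?thesis by (simp only: pt.peval_mult q(2)[OF that] mult_zero_right)
        qed
        ultimately show ?thesis by blast
      next
        case False
        then show ?thesis by (intro bexI[of _ 0]) (simp_all add: hcomp_single_mult)
      qed
      moreover have "?m * a \<in> polys X"
      proof (rule polys_mult)
        show "?m \<in> polys X" unfolding polys_eq_supported using m by (rule supported_single)
        show "a \<in> polys X" using a by (simp add: K_def)
      qed
      ultimately show ?thesis by (simp add: K_def)
    qed
  qed
  moreover have "G \<subseteq> K"
  proof
    fix g assume g: "g \<in> G"
    from const[OF g] obtain c where "\<forall>s\<in>P. pt.peval s g = c" ..
    then have c: "\<And>s. s \<in> P \<Longrightarrow> pt.peval s g = c" by (rule bspec)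
    have hg: "g \<in> supported {m \<in> monomials X. total_degree m = e}" using g G by blast
    have "\<exists>q\<in>supported (?L d). \<forall>s\<in>P. pt.peval s (hcomp d g + q) = 0" for d
    proof (cases "d = e")
      case True
      \<comment> \<open>The constant value of \<open>g\<close> is cancelled by a constant
        polynomial; its degree 0 is below \<open>e\<close>, which is where positivity of
        \<open>e\<close> enters.\<close>
      have "pconst (- c) \<in> supported (?L d)"
        unfolding pconst_def using e True by (intro supported_single) simp
      moreover have "pt.peval s (hcomp d g + pconst (- c)) = 0" if "s \<in> P" for s
        using c[OF that] True by (simp add: hcomp_homogeneous[OF hg] pt.peval_add pt.peval_pconst)
      ultimately show ?thesis by blast
    next
      case False
      then show ?thesis by (intro bexI[of _ 0]) (simp_all add: hcomp_homogeneous[OF hg])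
    qed
    moreover have "g \<in> polys X" unfolding polys_eq_supported by (rule supported_mono[OF hg]) blast
    ultimately show "g \<in> K" by (simp add: K_def)
  qed
  ultimately have "Idl\<^bsub>poly_algebra X\<^esub> G \<subseteq> K" by (rule poly_genideal_minimal)
  then have "p \<in> K" using p by blast
  then show ?thesis unfolding K_def by blast
qed

section \<open>The chambers as points of evaluation\<close>

text \<open>The chamber of the type \<open>B\<close> arrangement on which \<open>x\<^sub>i\<close> has sign \<open>s i\<close> and the absolute values
  \<open>\<bar>x\<^sub>i\<bar>\<close> are ordered as the \<open>r i\<close>; \<open>u\<^sub>i\<close>, \<open>u\<^sup>+\<^sub>i\<^sub>j\<close>, \<open>u\<^sup>-\<^sub>i\<^sub>j\<close> take the signs of
  \<open>x\<^sub>i\<close>, \<open>x\<^sub>j - x\<^sub>i\<close>, \<open>x\<^sub>j + x\<^sub>i\<close>.\<close>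

definition chamber :: "(nat \<Rightarrow> real) \<Rightarrow> (nat \<Rightarrow> 'k::field) \<Rightarrow> uvw_var \<Rightarrow> 'k" where
  "chamber r s x = (case x of U i \<Rightarrow> s i
     | V i j \<Rightarrow> if r i < r j then 2 * s j else 0
     | W i j \<Rightarrow> if r i < r j then 0 else - 2 * s i)"

lemma chamber_simps [simp]:
  "chamber r s (U i) = s i"
  "chamber r s (V i j) = (if r i < r j then 2 * s j else 0)"
  "chamber r s (W i j) = (if r i < r j then 0 else - 2 * s i)"
  by (simp_all add: chamber_def)

definition chambers :: "nat \<Rightarrow> (uvw_var \<Rightarrow> 'k::field) set" where
  "chambers n = {chamber r s | r s. inj_on r {1..n} \<and> (\<forall>i. s i = 1 \<or> s i = - 1)}"

text \<open>On each side of the wall between the absolute values of x_i and x_j one of v_ij, w_ij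
  vanishes and the other is plus or minus twice a sign, so each case reduces to comparing
  \<open>r i\<close>, \<open>r j\<close>, \<open>r k\<close>. The constants -2, 4 and -4 are what is
  left of products of equal signs.\<close>

lemma G_gens_constant_on_chambers:
  assumes "g \<in> G_gens n"
  shows "\<exists>c. \<forall>p\<in>chambers n. pt.peval p (g :: (uvw_var, 'k::field) mpoly) = c"
proof -
  \<comment> \<open>Signs enter through their squares only; in this form products of equal signs
    cancel by rewriting, with no case split on the signs.\<close>
  have "\<exists>c. \<forall>r s. (\<forall>i. s i ^ 2 = 1) \<longrightarrow> pt.peval (chamber r s) g = c"
    using assms
  proof (cases rule: G_gens_cases)
    case (one i)
    then show ?thesis by (simp add: pt.peval_simps)
  next
    case (two i j)
    from two(4) show ?thesis
    proof (elim insertE emptyE)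
      assume g: "g = v i j * w i j"
      show ?thesis by (rule exI[of _ 0]) (simp add: g pt.peval_simps)
    next
      assume g: "g = u i * w i j - u j * v i j"
      show ?thesis by (rule exI[of _ "- 2"]) (auto simp: g pt.peval_simps power2_eq_square)
    next
      assume g: "g = - 2 * u i * w i j + v i j ^ 2"
      show ?thesis by (rule exI[of _ 4]) (auto simp: g pt.peval_simps power_mult_distrib power2_eq_square)
    next
      assume g: "g = 2 * u i * w i j + w i j ^ 2"
      show ?thesis by (rule exI[of _ 0]) (auto simp: g pt.peval_simps power_mult_distrib power2_eq_square)
    next
      assume g: "g = u i * v i j - 2 * u i * u j - u j * w i j"
      show ?thesis by (rule exI[of _ 0]) (auto simp: g pt.peval_simps)
    qed
  next
    case (three i j k)
    from three(5) show ?thesis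
    proof (elim insertE emptyE)
      assume g: "g = v i j * w j k - w i j * w i k - v i k * v j k"
      show ?thesis by (rule exI[of _ "- 4"]) (auto simp: g pt.peval_simps power2_eq_square)
    next
      assume g: "g = w i j * w j k - v i j * w i k - w i k * w j k"
      show ?thesis by (rule exI[of _ 0]) (auto simp: g pt.peval_simps power2_eq_square)
    next
      assume g: "g = v i j * v j k - v i j * v i k - v i k * w j k"
      show ?thesis by (rule exI[of _ 0]) (auto simp: g pt.peval_simps power2_eq_square)
    next
      assume g: "g = w i j * v j k - w i j * v i k - w i k * v j k"
      show ?thesis by (rule exI[of _ 0]) (auto simp: g pt.peval_simps power2_eq_square)
    qed
  qed
  then obtain c where "\<forall>r s. (\<forall>i. s i ^ 2 = 1) \<longrightarrow> pt.peval (chamber r s) g = c" ..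
  moreover have "\<forall>i. s i ^ 2 = 1" if "\<forall>i. s i = 1 \<or> s i = - 1" for s :: "nat \<Rightarrow> 'k"
    using that by (auto simp: power2_eq_1_iff)
  ultimately show ?thesis by (auto simp: chambers_def)
qed

text \<open>As \<open>t\<close> crosses \<open>r i\<close> only the summand \<open>b i\<close> is
  switched on, so the difference of the two equations is \<open>b i = 0\<close>. With all jumps
  gone, \<open>a\<close> alone remains.\<close>

lemma step_functions_independent:
  fixes b :: "nat \<Rightarrow> 'k::field" and r :: "nat \<Rightarrow> real"
  assumes inj: "inj_on r S" and fin: "finite S"
    and eq: "\<And>t. t \<notin> r ` S \<Longrightarrow> a + (\<Sum>i\<in>S. if r i < t then b i else 0) = 0"
  shows "\<forall>i\<in>S. b i = 0" "a = 0"
proof -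
  show b: "\<forall>i\<in>S. b i = 0"
  proof
    fix i assume i: "i \<in> S"
    \<comment> \<open>A gap around \<open>r i\<close> free of other thresholds: the points
      \<open>r i - d / 2\<close> and \<open>r i + d / 2\<close> are separated by \<open>r i\<close>
      alone, and neither is a threshold.\<close>
    obtain d where d: "0 < d" "\<And>x. x \<in> r ` S \<Longrightarrow> x \<noteq> r i \<Longrightarrow> d \<le> dist (r i) x"
      using finite_set_avoid[of "r ` S" "r i"] fin by blast
    let ?t = "r i - d / 2" and ?t' = "r i + d / 2"
    have far: "r j < ?t \<longleftrightarrow> r j < ?t'" if "j \<in> S" "j \<noteq> i" for j
    proof -
      have "r j \<noteq> r i" using inj i that by (auto dest: inj_onD)
      then show ?thesis using d(2)[of "r j"] d(1) that by (auto simp: dist_real_def abs_if split: if_splits)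
    qed
    have "?t \<notin> r ` S" "?t' \<notin> r ` S"
      using d(1) d(2)[of ?t] d(2)[of ?t'] by (auto simp: dist_real_def)
    then have "(\<Sum>j\<in>S. if r j < ?t' then b j else 0) - (\<Sum>j\<in>S. if r j < ?t then b j else 0) = 0"
      using eq[of ?t] eq[of ?t'] by (simp add: add_eq_0_iff)
    moreover have "(\<Sum>j\<in>S. if r j < ?t' then b j else 0) - (\<Sum>j\<in>S. if r j < ?t then b j else 0)
        = (\<Sum>j\<in>S. if j = i then b j else 0)"
      unfolding sum_subtractf[symmetric] using far d(1) by (intro sum.cong) auto
    ultimately show "b i = 0" using i fin by simp
  qed
  obtain t where "t \<notin> r ` S" using ex_new_if_finite[OF infinite_UNIV_char_0] fin by blast
  from eq[OF this] b show "a = 0" by (simp add: sum.neutral)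
qed

section \<open>Recursion of the standard monomials in the last block\<close>

abbreviation add_var :: "'x \<Rightarrow> 'x mon \<Rightarrow> 'x mon" where
  "add_var x m \<equiv> m + Poly_Mapping.single x (Suc 0)"

lemma lookup_add_var: "Poly_Mapping.lookup (add_var x m) z = Poly_Mapping.lookup m z + (if z = x then 1 else 0)"
  by (simp add: lookup_add lookup_single when_def)

lemma keys_add_var: "Poly_Mapping.keys (add_var x m) = insert x (Poly_Mapping.keys m)"
  by (rule Set.set_eqI) (simp add: in_keys_iff lookup_add_var)

lemma uvw_vars_Suc: "uvw_vars (Suc n) = uvw_vars n \<union> block (Suc n)"
  by (auto simp: uvw_vars_eq atLeastAtMostSuc_conv)

lemma uvw_vars_block_disjoint: "x \<in> uvw_vars n \<Longrightarrow> x \<notin> block (Suc n)"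
  by (auto simp: uvw_vars_eq dest: block_disjoint)

lemma block_squarefree_monomials_Suc:
  "block_squarefree_monomials (Suc n) = block_squarefree_monomials n \<union>
    (\<Union>y\<in>block (Suc n). add_var y ` block_squarefree_monomials n)" (is "?S' = ?S \<union> ?T")
proof (intro equalityI subsetI)
  fix m assume m: "m \<in> ?S'"
  then have keys: "Poly_Mapping.keys m \<subseteq> uvw_vars n \<union> block (Suc n)"
    and le: "\<And>x. Poly_Mapping.lookup m x \<le> 1"
    and card: "\<And>k. k \<in> {1..Suc n} \<Longrightarrow> card (Poly_Mapping.keys m \<inter> block k) \<le> 1"
    by (auto simp: block_squarefree_monomials_def monomials_def uvw_vars_Suc)
  show "m \<in> ?S \<union> ?T"
  proof (cases "Poly_Mapping.keys m \<inter> block (Suc n) = {}")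
    case True
    then have "m \<in> ?S"
      using keys le card by (auto simp: block_squarefree_monomials_def monomials_def)
    then show ?thesis by blast
  next
    case False
    then obtain y where y: "y \<in> Poly_Mapping.keys m" "y \<in> block (Suc n)" by blast
    have single: "z = y" if "z \<in> Poly_Mapping.keys m" "z \<in> block (Suc n)" for z
      using card[of "Suc n"] y that card_le_Suc0_iff_eq[of "Poly_Mapping.keys m \<inter> block (Suc n)"] by auto
    define m' where "m' = m - Poly_Mapping.single y 1"
    have "Poly_Mapping.lookup m y = 1" using y(1) le[of y] by (simp add: in_keys_iff)
    then have l: "Poly_Mapping.lookup m' z = (if z = y then 0 else Poly_Mapping.lookup m z)" for z
      by (simp add: m'_def lookup_minus lookup_single when_def)
    have "m = add_var y m'"
      by (rule poly_mapping_eqI) (simp only: lookup_add_var l, use \<open>Poly_Mapping.lookup m y = 1\<close> in simp)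
    moreover have "m' \<in> ?S"
    proof -
      have k': "Poly_Mapping.keys m' = Poly_Mapping.keys m - {y}"
        by (rule Set.set_eqI) (simp add: in_keys_iff l)
      then have "Poly_Mapping.keys m' \<subseteq> uvw_vars n" using keys single by auto
      moreover have "Poly_Mapping.lookup m' x \<le> 1" for x using le[of x] by (simp add: l)
      moreover have "card (Poly_Mapping.keys m' \<inter> block k) \<le> 1" if "k \<in> {1..n}" for k
      proof -
        have "card (Poly_Mapping.keys m' \<inter> block k) \<le> card (Poly_Mapping.keys m \<inter> block k)"
          unfolding k' by (intro card_mono) auto
        then show ?thesis using card[of k] that by auto
      qed
      ultimately show ?thesis by (simp add: block_squarefree_monomials_def monomials_def)
    qed
    ultimately show ?thesis using y(2) by blast
  qed
next
  fix m assume "m \<in> ?S \<union> ?T"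
  then show "m \<in> ?S'"
  proof
    assume m: "m \<in> ?S"
    then have "Poly_Mapping.keys m \<inter> block (Suc n) = {}"
      using uvw_vars_block_disjoint by (auto simp: block_squarefree_monomials_def monomials_def)
    then show ?thesis using m
      by (auto simp: block_squarefree_monomials_def monomials_def uvw_vars_Suc atLeastAtMostSuc_conv)
  next
    assume "m \<in> ?T"
    then obtain y m' where y: "y \<in> block (Suc n)" and m': "m' \<in> ?S" and m: "m = add_var y m'" by blast
    have keys: "Poly_Mapping.keys m' \<subseteq> uvw_vars n" using m' by (simp add: block_squarefree_monomials_def monomials_def)
    have "y \<notin> Poly_Mapping.keys m'" using keys y uvw_vars_block_disjoint by blast
    then have "Poly_Mapping.lookup m' y = 0" by (simp add: in_keys_iff)
    then have "Poly_Mapping.lookup m x \<le> 1" for x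
      using m' unfolding m lookup_add_var by (simp add: block_squarefree_monomials_def)
    moreover have "Poly_Mapping.keys m \<inter> block (Suc n) = {y}"
      unfolding m keys_add_var using y keys uvw_vars_block_disjoint by blast
    moreover have "Poly_Mapping.keys m \<inter> block k = Poly_Mapping.keys m' \<inter> block k" if "k \<in> {1..n}" for k
      unfolding m keys_add_var using y that block_disjoint[of y k "Suc n"] by auto
    moreover have "Poly_Mapping.keys m \<subseteq> uvw_vars (Suc n)"
      unfolding m keys_add_var uvw_vars_Suc using y keys by blast
    ultimately show ?thesis
      using m' unfolding block_squarefree_monomials_def monomials_def
      by (simp add: atLeastAtMostSuc_conv)
  qed
qed

lemma block_squarefree_monomials_0: "block_squarefree_monomials 0 = {0}"
  by (auto simp: block_squarefree_monomials_def monomials_def uvw_vars_eq)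

lemma finite_block_squarefree: "finite (block_squarefree_monomials n)"
  by (induction n)
    (simp_all add: block_squarefree_monomials_0 block_squarefree_monomials_Suc finite_block)

text \<open>The pieces are disjoint because the variables of a standard monomial that lie in the
  last block determine its piece: none, or exactly \<open>y\<close>.\<close>

lemma sum_block_squarefree_Suc:
  fixes f :: "uvw_var mon \<Rightarrow> 'r::comm_monoid_add"
  shows "(\<Sum>m\<in>block_squarefree_monomials (Suc n). f m) = (\<Sum>m\<in>block_squarefree_monomials n. f m) +
    (\<Sum>y\<in>block (Suc n). \<Sum>m\<in>block_squarefree_monomials n. f (add_var y m))"
proof -
  let ?S = "block_squarefree_monomials n"
  have keys: "Poly_Mapping.keys m \<inter> block (Suc n) = {}" if "m \<in> ?S" for m
    using that uvw_vars_block_disjoint by (auto simp: block_squarefree_monomials_def monomials_def)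
  have keys': "Poly_Mapping.keys (add_var y m) \<inter> block (Suc n) = {y}" if "m \<in> ?S" "y \<in> block (Suc n)" for y m
    unfolding keys_add_var using keys[OF that(1)] that(2) by blast
  have "(\<Sum>m\<in>block_squarefree_monomials (Suc n). f m) = (\<Sum>m\<in>?S. f m) +
      (\<Sum>m\<in>(\<Union>y\<in>block (Suc n). add_var y ` ?S). f m)"
    unfolding block_squarefree_monomials_Suc
  proof (rule sum.union_disjoint)
    show "?S \<inter> (\<Union>y\<in>block (Suc n). add_var y ` ?S) = {}"
    proof (rule equals0I, elim IntE UN_E imageE)
      fix m y m' assume "m \<in> ?S" "y \<in> block (Suc n)" "m' \<in> ?S" "m = add_var y m'"
      then show False using keys[of m] keys'[of m' y] by simp
    qed
  qed (simp_all add: finite_block_squarefree finite_block)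
  also have "(\<Sum>m\<in>(\<Union>y\<in>block (Suc n). add_var y ` ?S). f m) = (\<Sum>y\<in>block (Suc n). \<Sum>m\<in>add_var y ` ?S. f m)"
  proof (rule sum.UNION_disjoint)
    show "\<forall>y\<in>block (Suc n). \<forall>z\<in>block (Suc n). y \<noteq> z \<longrightarrow> add_var y ` ?S \<inter> add_var z ` ?S = {}"
    proof (intro ballI impI equals0I, elim IntE imageE)
      fix y z m m1 m2
      assume "y \<in> block (Suc n)" "z \<in> block (Suc n)" "y \<noteq> z"
        "m1 \<in> ?S" "m2 \<in> ?S" "m = add_var y m1" "m = add_var z m2"
      then show False using keys'[of m1 y] keys'[of m2 z] by simp
    qed
  qed (simp_all add: finite_block_squarefree finite_block)
  also have "\<dots> = (\<Sum>y\<in>block (Suc n). \<Sum>m\<in>?S. f (add_var y m))"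
    by (rule sum.cong[OF refl], subst sum.reindex) (simp_all add: inj_on_def)
  finally show ?thesis .
qed

lemma sum_block:
  fixes f :: "uvw_var \<Rightarrow> 'r::comm_monoid_add"
  shows "sum f (block (Suc n)) = f (U (Suc n)) + ((\<Sum>i\<in>{1..n}. f (V i (Suc n))) + (\<Sum>i\<in>{1..n}. f (W i (Suc n))))"
proof -
  let ?A = "(\<lambda>i. V i (Suc n)) ` {1..n}" and ?B = "(\<lambda>i. W i (Suc n)) ` {1..n}"
  have "block (Suc n) = insert (U (Suc n)) (?A \<union> ?B)"
    by (auto simp: block_def)
  moreover have "sum f (?A \<union> ?B) = sum f ?A + sum f ?B"
    by (rule sum.union_disjoint) auto
  moreover have "sum f ?A = (\<Sum>i\<in>{1..n}. f (V i (Suc n)))" "sum f ?B = (\<Sum>i\<in>{1..n}. f (W i (Suc n)))"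
    by (simp_all add: sum.reindex inj_on_def)
  moreover have "U (Suc n) \<notin> ?A \<union> ?B" by auto
  ultimately show ?thesis by simp
qed

text \<open>A fixed chamber \<open>p\<close> of the first \<open>n\<close> coordinates is extended
  by a coordinate of sign \<open>\<sigma>\<close> and absolute value \<open>t\<close>. The sum then
  has a part even in \<open>\<sigma>\<close>, from the old monomials and the W, and an odd part,
  from U and the V. Since 2 is nonzero both vanish, and each of them is a step function of
  \<open>t\<close>. Hence the coefficients in the last block, as functions of \<open>p\<close>,
  vanish on all chambers, and the induction hypothesis applies to them.\<close>

lemma standard_independent:
  fixes c :: "uvw_var mon \<Rightarrow> 'k::field"
  assumes two: "(2::'k) \<noteq> 0"
    and "\<And>p. p \<in> chambers n \<Longrightarrow> (\<Sum>m\<in>block_squarefree_monomials n. c m * mon_value p m) = 0"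
    and "m \<in> block_squarefree_monomials n"
  shows "c m = 0"
  using assms(2,3)
proof (induction n arbitrary: c m)
  case 0
  \<comment> \<open>Some point is needed to evaluate at: without coordinates the only standard
    monomial is 1, and every choice of ranks and signs does.\<close>
  have "chamber real (\<lambda>_. 1) \<in> (chambers 0 :: (uvw_var \<Rightarrow> 'k) set)" by (auto simp: chambers_def)
  from 0(1)[OF this] 0(2) show ?case by (simp add: block_squarefree_monomials_0)
next
  case (Suc n)
  let ?S = "block_squarefree_monomials n"
  define A where "A p = (\<Sum>m\<in>?S. c m * mon_value p m)" for p
  define B where "B y p = (\<Sum>m\<in>?S. c (add_var y m) * mon_value p m)" for y p
  have AB: "A p = 0 \<and> (\<forall>y\<in>block (Suc n). B y p = 0)" if p: "p \<in> chambers n" for p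
  proof -
    obtain r s where pr: "p = chamber r s" and inj: "inj_on r {1..n}" and s': "\<forall>i. s i = 1 \<or> s i = - 1"
      using p unfolding chambers_def by blast
    note s = s'[rule_format]
    let ?N = "Suc n"
    \<comment> \<open>Twice the odd and twice the even part in \<open>\<sigma>\<close>. Here
      \<open>a\<close> stands for the old monomials, and \<open>b\<close>, \<open>x\<close>,
      \<open>z\<close> for the contributions of U, V, W at \<open>\<sigma> = 1\<close>; changing
      \<open>\<sigma>\<close> negates \<open>b\<close> and \<open>x\<close>.\<close>
    have alg: "2 * (b + x) = (a + (b + (x + z))) - (a + (- b + (- x + z)))"
      "2 * (a + z) = (a + (b + (x + z))) + (a + (- b + (- x + z)))" for a b x z :: 'k
      unfolding mult_2 by (simp_all add: algebra_simps)
    have eq: "A p + (B (U ?N) p * \<sigma> + ((\<Sum>i\<in>{1..n}. B (V i ?N) p * (if r i < t then 2 * \<sigma> else 0)) +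
        (\<Sum>i\<in>{1..n}. B (W i ?N) p * (if r i < t then 0 else - 2 * s i)))) = 0"
      if \<sigma>: "\<sigma> = 1 \<or> \<sigma> = - 1" and t: "t \<notin> r ` {1..n}" for \<sigma> t
    proof -
      define p' where "p' = chamber (r(?N := t)) (s(?N := \<sigma>))"
      have "(r(?N := t)) ` {1..n} = r ` {1..n}" by (rule image_cong) simp_all
      then have inj': "inj_on (r(?N := t)) {1..?N}"
        using inj_on_fun_updI[OF inj t] t by (simp add: atLeastAtMostSuc_conv)
      have sgn': "\<forall>i. (s(?N := \<sigma>)) i = 1 \<or> (s(?N := \<sigma>)) i = - 1"
      proof
        fix i show "(s(?N := \<sigma>)) i = 1 \<or> (s(?N := \<sigma>)) i = - 1"
          using \<sigma> s[of i] by (cases "i = ?N") simp_all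
      qed
      have p': "p' \<in> chambers ?N"
        unfolding p'_def chambers_def by (rule CollectI) (rule exI, rule exI, rule conjI[OF refl conjI[OF inj' sgn']])
      \<comment> \<open>Variables of the earlier blocks do not involve the new coordinate.\<close>
      have val: "p' z = p z" if "z \<in> uvw_vars n" for z
        using that by (auto simp: p'_def pr uvw_vars_def)
      have mv: "mon_value p' m = mon_value p m" if "m \<in> ?S" for m
        by (rule mon_value_cong, rule val) (use that in \<open>auto simp: block_squarefree_monomials_def monomials_def\<close>)
      have "0 = (\<Sum>m\<in>?S. c m * mon_value p' m) +
          (\<Sum>y\<in>block ?N. \<Sum>m\<in>?S. c (add_var y m) * mon_value p' (add_var y m))"
        using Suc.prems(1)[OF p'] unfolding sum_block_squarefree_Suc by (rule sym)
      also have "(\<Sum>m\<in>?S. c m * mon_value p' m) = A p"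
        unfolding A_def by (rule sum.cong) (simp_all add: mv)
      also have "(\<Sum>y\<in>block ?N. \<Sum>m\<in>?S. c (add_var y m) * mon_value p' (add_var y m)) =
          (\<Sum>y\<in>block ?N. B y p * p' y)"
        unfolding B_def sum_distrib_right
        by (intro sum.cong refl) (simp add: mon_value_add mv)
      also have "\<dots> = B (U ?N) p * \<sigma> + ((\<Sum>i\<in>{1..n}. B (V i ?N) p * (if r i < t then 2 * \<sigma> else 0)) +
        (\<Sum>i\<in>{1..n}. B (W i ?N) p * (if r i < t then 0 else - 2 * s i)))"
        unfolding sum_block by (intro arg_cong2[where f = "(+)"] sum.cong refl) (auto simp: p'_def)
      finally show ?thesis by simp
    qed
    have UV: "B (U ?N) p + (\<Sum>i\<in>{1..n}. if r i < t then 2 * B (V i ?N) p else 0) = 0"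
      and W: "(A p - (\<Sum>i\<in>{1..n}. 2 * (B (W i ?N) p * s i))) +
          (\<Sum>i\<in>{1..n}. if r i < t then 2 * (B (W i ?N) p * s i) else 0) = 0"
      if t: "t \<notin> r ` {1..n}" for t
    proof -
      define X where "X = (\<Sum>i\<in>{1..n}. if r i < t then 2 * B (V i ?N) p else 0)"
      define Z where "Z = (\<Sum>i\<in>{1..n}. B (W i ?N) p * (if r i < t then 0 else - 2 * s i))"
      have X1: "(\<Sum>i\<in>{1..n}. B (V i ?N) p * (if r i < t then 2 * 1 else 0)) = X"
        unfolding X_def by (rule sum.cong) auto
      have X2: "(\<Sum>i\<in>{1..n}. B (V i ?N) p * (if r i < t then 2 * (- 1) else 0)) = - X"
        unfolding X_def sum_negf[symmetric] by (rule sum.cong) auto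
      have e1: "A p + (B (U ?N) p + (X + Z)) = 0" using eq[of 1 t] t X1 by (simp add: Z_def)
      have e2: "A p + (- B (U ?N) p + (- X + Z)) = 0"
        using eq[of "- 1" t] t unfolding X2 by (simp add: Z_def)
      have "2 * (B (U ?N) p + X) = (A p + (B (U ?N) p + (X + Z))) - (A p + (- B (U ?N) p + (- X + Z)))"
        by (rule alg(1))
      then have "B (U ?N) p + X = 0" using e1 e2 two by (simp only: mult_eq_0_iff diff_self simp_thms)
      then show "B (U ?N) p + (\<Sum>i\<in>{1..n}. if r i < t then 2 * B (V i ?N) p else 0) = 0"
        by (simp only: X_def)
      have "2 * (A p + Z) = (A p + (B (U ?N) p + (X + Z))) + (A p + (- B (U ?N) p + (- X + Z)))"
        by (rule alg(2))
      then have AZ: "A p + Z = 0" using e1 e2 two by (simp only: mult_eq_0_iff add_0 simp_thms)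
      \<comment> \<open>A value of W is switched on for \<open>t \<le> r i\<close>, opposite to the
        form needed for \<open>step_functions_independent\<close>. It is rewritten as a constant
        plus a step switched on for \<open>r i < t\<close>; the constant joins
        \<open>A p\<close>.\<close>
      have Z: "Z = - (\<Sum>i\<in>{1..n}. 2 * (B (W i ?N) p * s i)) +
          (\<Sum>i\<in>{1..n}. if r i < t then 2 * (B (W i ?N) p * s i) else 0)"
        unfolding Z_def sum_negf[symmetric] sum.distrib[symmetric] by (rule sum.cong) auto
      show "(A p - (\<Sum>i\<in>{1..n}. 2 * (B (W i ?N) p * s i))) +
          (\<Sum>i\<in>{1..n}. if r i < t then 2 * (B (W i ?N) p * s i) else 0) = 0"
        using AZ unfolding Z by (simp only: diff_conv_add_uminus add.assoc)
    qed
    note UV0 = step_functions_independent[OF inj finite_atLeastAtMost UV]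
      and W0 = step_functions_independent[OF inj finite_atLeastAtMost W]
    have "B (V i ?N) p = 0" if "i \<in> {1..n}" for i
    proof -
      have "2 * B (V i ?N) p = 0" using UV0(1) that by (rule bspec)
      then show ?thesis using two by simp
    qed
    moreover have "B (U ?N) p = 0" by (rule UV0(2))
    moreover have BW: "B (W i ?N) p = 0" if "i \<in> {1..n}" for i
    proof -
      have "2 * (B (W i ?N) p * s i) = 0" using W0(1) that by (rule bspec)
      moreover have "s i \<noteq> 0" using s[of i] by (elim disjE) simp_all
      ultimately show ?thesis using two by simp
    qed
    moreover have "A p = 0"
    proof -
      have "(\<Sum>i\<in>{1..n}. 2 * (B (W i ?N) p * s i)) = 0"
        by (rule sum.neutral) (simp add: BW)
      then show ?thesis using W0(2) by simp
    qed
    ultimately show ?thesis by (auto simp: block_def)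
  qed
  \<comment> \<open>The induction hypothesis is applied to \<open>c\<close> itself and to each
    shifted family \<open>c (add_var y m)\<close>, whose sums over the standard monomials are
    \<open>A\<close> and \<open>B y\<close>.\<close>
  have "c m = 0" if "m \<in> ?S" for m
    by (rule Suc.IH[OF _ that]) (use AB in \<open>simp add: A_def\<close>)
  moreover have "c (add_var y m) = 0" if "y \<in> block (Suc n)" "m \<in> ?S" for y m
    by (rule Suc.IH[of "\<lambda>m. c (add_var y m)", OF _ that(2)]) (use AB that(1) in \<open>simp add: B_def\<close>)
  ultimately show ?case
    using Suc.prems(2) unfolding block_squarefree_monomials_Suc by blast
qed

section \<open>From independence on the chambers to independence modulo the ideal\<close>

lemma standard_vanishing:
  assumes two: "(2::'k::field) \<noteq> 0" and q: "q \<in> supported (block_squarefree_monomials n)"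
    and van: "\<And>p. p \<in> chambers n \<Longrightarrow> pt.peval p (q :: (uvw_var, 'k) mpoly) = 0"
  shows "q = 0"
proof (rule poly_mapping_eqI)
  fix m
  show "Poly_Mapping.lookup q m = Poly_Mapping.lookup 0 m"
  proof (cases "m \<in> block_squarefree_monomials n")
    case True
    have "Poly_Mapping.lookup q m = 0"
      by (rule standard_independent[OF two _ True])
        (use van in \<open>simp add: pt.peval_superset[OF finite_block_squarefree supportedD[OF q], symmetric]\<close>)
    then show ?thesis by simp
  next
    case False
    then have "m \<notin> Poly_Mapping.keys q" using supportedD[OF q] by blast
    then show ?thesis by (simp add: in_keys_iff)
  qed
qed

lemma I_ideal_top_forms:
  assumes "p \<in> (I_ideal n :: (uvw_var, 'k::field) mpoly set)"
  shows "\<exists>q\<in>supported {m \<in> monomials (uvw_vars n). total_degree m < d}.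
    \<forall>s\<in>chambers n. pt.peval s (hcomp d p + q) = 0"
  using assms unfolding I_ideal_def
  by (intro top_forms[OF G_homogeneous _ G_gens_constant_on_chambers]) simp_all

text \<open>Standard monomials span the functions on the chambers compatibly with degree. Reducing
  \<open>m\<close> modulo \<open>\<I>\<close> to standard monomials of the same degree is correct on
  the chambers only up to terms of lower degree; these are treated by induction on the
  degree.\<close>

lemma filtered_rep:
  assumes "q \<in> supported {m \<in> monomials (uvw_vars n). total_degree m < d}"
  shows "\<exists>q'\<in>supported {m \<in> block_squarefree_monomials n. total_degree m < d}.
    \<forall>s\<in>chambers n. pt.peval s q = pt.peval s (q' :: (uvw_var, 'k::field) mpoly)"
  using assms
proof (induction d arbitrary: q rule: less_induct)
  case (less d)
  obtain lt where "block_order n lt" using exists_block_order by blast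
  then interpret block_order n lt .
  let ?B = "\<lambda>d. supported {m \<in> block_squarefree_monomials n. total_degree m < d} :: (uvw_var, 'k) mpoly set"
  from supportedD[OF less.prems] show ?case
  proof (induction q rule: mpoly_induct)
    case zero
    show ?case by (intro bexI[of _ 0]) simp_all
  next
    case (add m c q)
    from add(1) have m: "m \<in> monomials (uvw_vars n)" "total_degree m < d" by auto
    obtain q1 where q1: "q1 \<in> supported (std_below m)"
      and I: "pterm m - q1 \<in> (I_ideal n :: (uvw_var, 'k) mpoly set)" using standard_rep_pterm[OF m(1)] by blast
    have std: "std_below m \<subseteq> {t \<in> monomials (uvw_vars n). total_degree t = total_degree m}"
      by (auto simp: std_below_def block_squarefree_monomials_def)
    have "pterm m - q1 \<in> supported {t \<in> monomials (uvw_vars n). total_degree t = total_degree m}"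
      using supported_mono[OF q1 std] m(1) by (intro supported_intros) simp_all
    \<comment> \<open>The difference is homogeneous, hence equal to its own component in degree
      \<open>total_degree m\<close>.\<close>
    note hc = hcomp_homogeneous[OF this, of "total_degree m", simplified]
    obtain q2 where q2: "q2 \<in> supported {t \<in> monomials (uvw_vars n). total_degree t < total_degree m}"
      and van: "\<forall>s\<in>chambers n. pt.peval s (pterm m - q1 + q2) = 0"
      using I_ideal_top_forms[OF I, of "total_degree m"] unfolding hc by blast
    obtain q3 where q3: "q3 \<in> ?B (total_degree m)"
      and eq3: "\<forall>s\<in>chambers n. pt.peval s q2 = pt.peval s q3"
      using less.IH[OF m(2) q2] by blast
    obtain q4 where q4: "q4 \<in> ?B d" and eq4: "\<forall>s\<in>chambers n. pt.peval s q = pt.peval s q4"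
      using add(3) by blast
    \<comment> \<open>On the chambers \<open>m\<close> equals \<open>q1 - q2\<close>, and
      \<open>q2\<close> equals the standard polynomial \<open>q3\<close>.\<close>
    have "pconst c * (q1 - q3) + q4 \<in> ?B d"
    proof (intro supported_intros q4)
      show "q1 \<in> ?B d" by (rule supported_mono[OF q1]) (use m(2) in \<open>auto simp: std_below_def\<close>)
      show "q3 \<in> ?B d" by (rule supported_mono[OF q3]) (use m(2) in auto)
    qed
    moreover have "pt.peval s (Poly_Mapping.single m c + q) = pt.peval s (pconst c * (q1 - q3) + q4)"
      if "s \<in> chambers n" for s
    proof -
      have "pt.peval s (pterm m) = pt.peval s q1 - pt.peval s q3"
      proof -
        have "pt.peval s (pterm m) - pt.peval s q1 + pt.peval s q2 = 0"
          using van that by (simp only: pt.peval_add pt.peval_diff)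
        then have "pt.peval s (pterm m) = pt.peval s q1 - pt.peval s q2"
          by (simp add: diff_add_eq eq_iff_diff_eq_0[of "pt.peval s (pterm m)"] diff_diff_eq2)
        then show ?thesis using eq3 that by simp
      qed
      then show ?thesis
        using eq4 that by (simp add: single_eq_pconst_pterm pt.peval_add pt.peval_mult pt.peval_diff)
    qed
    ultimately show ?case by blast
  qed
qed

text \<open>One degree is treated at a time. The component of \<open>p\<close> in degree
  \<open>total_degree m\<close> is corrected by a polynomial of lower degree to vanish on the
  chambers, and \<open>filtered_rep\<close> makes this correction standard. The sum is then zero by
  independence; the correction does not reach degree \<open>total_degree m\<close>, so the
  coefficient of \<open>p\<close> at \<open>m\<close> is zero.\<close>

lemma standard_in_I_ideal:
  assumes two: "(2::'k::field) \<noteq> 0" and I: "p \<in> (I_ideal n :: (uvw_var, 'k) mpoly set)"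
    and std: "p \<in> supported (block_squarefree_monomials n)"
  shows "p = 0"
proof (rule poly_mapping_eqI)
  fix m :: "uvw_var mon"
  let ?d = "total_degree m"
  obtain q where q: "q \<in> supported {m \<in> monomials (uvw_vars n). total_degree m < ?d}"
    and van: "\<forall>s\<in>chambers n. pt.peval s (hcomp ?d p + q) = 0"
    using I_ideal_top_forms[OF I] by blast
  obtain q' where q': "q' \<in> supported {m \<in> block_squarefree_monomials n. total_degree m < ?d}"
    and eq: "\<forall>s\<in>chambers n. pt.peval s q = pt.peval s q'"
    using filtered_rep[OF q] by blast
  have "hcomp ?d p + q' = 0"
  proof (rule standard_vanishing[OF two])
    show "hcomp ?d p + q' \<in> supported (block_squarefree_monomials n)"
    proof (rule supported_add)
      show "hcomp ?d p \<in> supported (block_squarefree_monomials n)"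
        by (rule supported_mono[OF hcomp_supported[OF std]]) blast
      show "q' \<in> supported (block_squarefree_monomials n)"
        by (rule supported_mono[OF q']) blast
    qed
    show "pt.peval s (hcomp ?d p + q') = 0" if "s \<in> chambers n" for s
      using van eq that by (simp add: pt.peval_add)
  qed
  then have "Poly_Mapping.lookup (hcomp ?d p) m + Poly_Mapping.lookup q' m = 0"
    by (simp flip: lookup_add)
  moreover have "m \<notin> Poly_Mapping.keys q'" using supportedD[OF q'] by blast
  then have "Poly_Mapping.lookup q' m = 0" by (simp add: in_keys_iff)
  ultimately show "Poly_Mapping.lookup p m = Poly_Mapping.lookup 0 m" by (simp add: lookup_hcomp)
qed

section \<open>The Groebner basis\<close>

text \<open>The clause of \<open>extends_block_order\<close> on products of two variables is what
  yields \<open>lt_lower\<close>.\<close>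

lemma block_order_if_monomial_order:
  assumes "monomial_order (uvw_vars n) lt" "extends_block_order n lt"
  shows "block_order n lt"
proof
  fix m assume "m \<in> monomials (uvw_vars n)"
  then show "\<not> lt m m" using assms(1) unfolding monomial_order_def by (meson irreflp_onD)
next
  fix m1 m2 m3
  assume "lt m1 m2" "lt m2 m3" "m1 \<in> monomials (uvw_vars n)" "m2 \<in> monomials (uvw_vars n)"
    "m3 \<in> monomials (uvw_vars n)"
  then show "lt m1 m3" using assms(1) unfolding monomial_order_def by (meson transp_onD)
next
  fix m m' t
  assume "lt m m'" "m \<in> monomials (uvw_vars n)" "m' \<in> monomials (uvw_vars n)" "t \<in> monomials (uvw_vars n)"
  then show "lt (m + t) (m' + t)" using assms(1) unfolding monomial_order_def by blast
next
  fix k m x y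
  assume k: "k \<in> {1..n}" and m: "m \<in> lower_mons k" and xy: "x \<in> block k" "y \<in> block k"
  from m obtain x' y' a where a: "1 \<le> a" "a < k" and m': "x' \<in> block a" "y' \<in> block k" "m = mon2 x' y'"
    unfolding lower_mons_def by blast
  have "1 \<le> a \<and> a < k \<and> k \<le> n" using a k by simp
  with assms(2) m' xy show "lt m (mon2 x y)"
    unfolding extends_block_order_def mon2_def by blast
qed

context block_order
begin

lemma lead_mon_eqI:
  assumes "Poly_Mapping.keys p \<subseteq> monomials (uvw_vars n)" "m \<in> Poly_Mapping.keys p"
    and "\<And>m'. m' \<in> Poly_Mapping.keys p \<Longrightarrow> m' \<noteq> m \<Longrightarrow> lt m' m"
  shows "lead_mon lt p = m"
  unfolding lead_mon_def
proof (rule the_equality)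
  show "m \<in> Poly_Mapping.keys p \<and> (\<forall>m'\<in>Poly_Mapping.keys p. m' \<noteq> m \<longrightarrow> lt m' m)"
    using assms by blast
next
  fix m' assume m': "m' \<in> Poly_Mapping.keys p \<and> (\<forall>m''\<in>Poly_Mapping.keys p. m'' \<noteq> m' \<longrightarrow> lt m'' m')"
  have M: "m \<in> monomials (uvw_vars n)" "m' \<in> monomials (uvw_vars n)" using assms m' by blast+
  show "m' = m"
  proof (rule ccontr)
    assume ne: "m' \<noteq> m"
    have "lt m' m" "lt m m'" using assms(3)[of m'] m' ne assms(2) by auto
    from lt_trans[OF this(2,1) M(1) M(2) M(1)] lt_irrefl[OF M(1)] show False by blast
  qed
qed

lemma lead_mon_lead_form:
  assumes k: "k \<in> {1..n}" and g: "lead_form k x y g"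
  shows "lead_mon lt g = mon2 x y" and "g \<noteq> 0"
proof -
  obtain c r where xy: "x \<in> block k" "y \<in> block k" and c: "c \<noteq> 0" and r: "r \<in> supported (lower_mons k)"
    and geq: "g = pconst c * pterm (mon2 x y) + r" using g unfolding lead_form_def by blast
  have M: "mon2 x y \<in> monomials (uvw_vars n)"
    using k xy by (auto simp: uvw_vars_eq intro!: mon2_in_monomials)
  have low: "lower_mons k \<subseteq> monomials (uvw_vars n)"
    using k by (fastforce simp: lower_mons_def uvw_vars_eq intro!: mon2_in_monomials)
  have "mon2 x y \<notin> lower_mons k"
    using lt_lower[OF k _ xy] lt_irrefl[OF M] by blast
  then have "mon2 x y \<notin> Poly_Mapping.keys r" using supportedD[OF r] by blast
  then have "Poly_Mapping.lookup g (mon2 x y) = c"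
    by (simp add: geq lookup_add lookup_pconst_mult pterm_def in_keys_iff)
  then have key: "mon2 x y \<in> Poly_Mapping.keys g" using c by (simp add: in_keys_iff)
  then show "g \<noteq> 0" by auto
  have "g \<in> supported (insert (mon2 x y) (lower_mons k))"
    unfolding geq using supported_mono[OF r] by (intro supported_intros) blast+
  note keys = supportedD[OF this]
  show "lead_mon lt g = mon2 x y"
  proof (rule lead_mon_eqI[OF _ key])
    show "Poly_Mapping.keys g \<subseteq> monomials (uvw_vars n)" using keys M low by blast
    fix m' assume "m' \<in> Poly_Mapping.keys g" "m' \<noteq> mon2 x y"
    then have "m' \<in> lower_mons k" using keys by blast
    then show "lt m' (mon2 x y)" by (rule lt_lower[OF k _ xy])
  qed
qed

lemma initial_term_lead_form:
  "k \<in> {1..n} \<Longrightarrow> lead_form k x y g \<Longrightarrow> initial_term lt g = pterm (mon2 x y)"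
  by (simp add: initial_term_def lead_mon_lead_form(1))

text \<open>The target \<open>T\<close> is left open: it is the set of all standard monomials for
  the basis statement, and the set of those below a given monomial for leading monomials.\<close>

lemma standard_rep:
  assumes "f \<in> supported S" "S \<subseteq> monomials (uvw_vars n)" "\<And>m. m \<in> S \<Longrightarrow> std_below m \<subseteq> T"
  shows "\<exists>q\<in>supported T. f - q \<in> (I_ideal n :: (uvw_var, 'k::field) mpoly set)"
  using supportedD[OF assms(1)]
proof (induction f rule: mpoly_induct)
  case zero
  show ?case by (intro bexI[of _ 0]) (simp_all add: poly_ideal_zero[OF ideal_I])
next
  case (add t c q)
  obtain q1 where q1: "q1 \<in> supported (std_below t)" "pterm t - q1 \<in> (I_ideal n :: (uvw_var, 'k) mpoly set)"
    using standard_rep_pterm[of t] add(1) assms(2) by blast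
  obtain q2 where q2: "q2 \<in> supported T" "q - q2 \<in> (I_ideal n :: (uvw_var, 'k) mpoly set)"
    using add(3) by blast
  have "Poly_Mapping.single t c + q - (pconst c * q1 + q2) = pconst c * (pterm t - q1) + (q - q2)"
    by (simp add: single_eq_pconst_pterm algebra_simps)
  also have "\<dots> \<in> I_ideal n"
    by (intro poly_ideal_add[OF ideal_I] poly_ideal_mult[OF ideal_I] q1 q2) simp
  finally have "Poly_Mapping.single t c + q - (pconst c * q1 + q2) \<in> I_ideal n" .
  moreover have "pconst c * q1 + q2 \<in> supported T"
    by (intro supported_intros supported_mono[OF q1(1) assms(3)] add(1) q2)
  ultimately show ?case by blast
qed

text \<open>If the leading monomial \<open>m\<close> were standard, reducing the other terms would
  create only monomials below \<open>m\<close>. The result would be a standard element of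
  \<open>\<I>\<close> with the unchanged nonzero coefficient at \<open>m\<close>, against
  \<open>standard_in_I_ideal\<close>.\<close>

lemma lead_mon_I_ideal_nonstandard:
  assumes two: "(2::'k::field) \<noteq> 0" and f: "f \<in> (I_ideal n :: (uvw_var, 'k) mpoly set)"
    and m: "m \<in> Poly_Mapping.keys f" and lt: "\<And>m'. m' \<in> Poly_Mapping.keys f \<Longrightarrow> m' \<noteq> m \<Longrightarrow> lt m' m"
  shows "m \<notin> block_squarefree_monomials n"
proof
  assume std: "m \<in> block_squarefree_monomials n"
  have "Poly_Mapping.keys f \<subseteq> monomials (uvw_vars n)"
    using poly_ideal_subset[OF ideal_I] f by (auto simp: polys_def)
  then have M: "\<And>m'. m' \<in> Poly_Mapping.keys f \<Longrightarrow> m' \<in> monomials (uvw_vars n)" by blast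
  let ?a = "Poly_Mapping.lookup f m"
  define h where "h = f - Poly_Mapping.single m ?a"
  have lh: "Poly_Mapping.lookup h t = (if t = m then 0 else Poly_Mapping.lookup f t)" for t
    by (simp add: h_def lookup_minus lookup_single when_def)
  let ?S = "{t \<in> monomials (uvw_vars n). lt t m}"
  let ?T = "{t \<in> block_squarefree_monomials n. lt t m}"
  have "h \<in> supported ?S"
  proof (rule supportedI, rule subsetI)
    fix t assume "t \<in> Poly_Mapping.keys h"
    then have "t \<noteq> m" "t \<in> Poly_Mapping.keys f" by (simp_all add: in_keys_iff lh split: if_splits)
    then show "t \<in> ?S" using lt M by simp
  qed
  moreover have "std_below t \<subseteq> ?T" if "t \<in> ?S" for t
    using that lt_trans[OF _ _ _ _ M[OF m]]
    by (auto simp: std_below_def block_squarefree_monomials_def)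
  ultimately obtain q where q: "q \<in> supported ?T" "h - q \<in> (I_ideal n :: (uvw_var, 'k) mpoly set)"
    using standard_rep[of h ?S ?T] by blast
  have "Poly_Mapping.single m ?a + q = f - (h - q)" by (simp add: h_def)
  also have "\<dots> \<in> I_ideal n" by (rule poly_ideal_diff[OF ideal_I f q(2)])
  finally have "Poly_Mapping.single m ?a + q \<in> I_ideal n" .
  moreover have "Poly_Mapping.single m ?a + q \<in> supported (block_squarefree_monomials n)"
    by (intro supported_intros std supported_mono[OF q(1)]) blast
  ultimately have "Poly_Mapping.single m ?a + q = 0" by (rule standard_in_I_ideal[OF two])
  then have "?a + Poly_Mapping.lookup q m = 0" by (metis lookup_add lookup_single_eq lookup_zero)
  moreover have "m \<notin> Poly_Mapping.keys q"
    using supportedD[OF q(1)] lt_irrefl[OF M[OF m]] by blast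
  ultimately show False using m by (simp add: in_keys_iff)
qed

end

text \<open>A finite nonempty set has a maximum in a strict total order; totality of the monomial
  order is used here.\<close>

lemma exists_lead_mon:
  assumes mo: "monomial_order X lt" and p: "p \<in> polys X" "p \<noteq> 0"
  shows "\<exists>m\<in>Poly_Mapping.keys p. \<forall>m'\<in>Poly_Mapping.keys p. m' \<noteq> m \<longrightarrow> lt m' m"
proof -
  have total: "lt a b \<or> lt b a" if "a \<in> monomials X" "b \<in> monomials X" "a \<noteq> b" for a b
    using mo that unfolding monomial_order_def totalp_on_def by blast
  have trans: "lt a c" if "lt a b" "lt b c" "a \<in> monomials X" "b \<in> monomials X" "c \<in> monomials X" for a b c
    using mo that unfolding monomial_order_def by (meson transp_onD)
  have "\<exists>m\<in>F. \<forall>m'\<in>F. m' \<noteq> m \<longrightarrow> lt m' m" if "finite F" "F \<noteq> {}" "F \<subseteq> monomials X" for F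
    using that
  proof (induction rule: finite_ne_induct)
    case (insert x F)
    then obtain m where m: "m \<in> F" "\<And>m'. m' \<in> F \<Longrightarrow> m' \<noteq> m \<Longrightarrow> lt m' m" by auto
    have M: "x \<in> monomials X" "m \<in> monomials X" "x \<noteq> m" using insert m by auto
    show ?case
    proof (cases "lt x m")
      case True
      then show ?thesis using m by (intro bexI[of _ m]) auto
    next
      case False
      then have "lt m x" using total[OF M] by blast
      then have "lt m' x" if "m' \<in> F" for m'
        using m(2)[OF that] that trans[of m' m x] insert.prems M by (cases "m' = m") auto
      then show ?thesis by (intro bexI[of _ x]) auto
    qed
  qed simp
  moreover have "Poly_Mapping.keys p \<subseteq> monomials X" using p(1) by (simp add: polys_def)
  ultimately show ?thesis using p(2) by simp
qed

lemma finite_G_gens: "finite (G_gens n :: (uvw_var, 'k::field) mpoly set)"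
proof -
  have "finite {(i, j). 1 \<le> i \<and> i < j \<and> j \<le> n}"
    by (rule finite_subset[of _ "{..n} \<times> {..n}"]) auto
  moreover have "finite {(i, j, k). 1 \<le> i \<and> i < j \<and> j < k \<and> k \<le> n}"
    by (rule finite_subset[of _ "{..n} \<times> {..n} \<times> {..n}"]) auto
  ultimately show ?thesis
    unfolding G_gens_def by (intro finite_UnI finite_UN_I) (simp_all split: prod.splits)
qed

text \<open>A circle of inclusions through \<open>M\<close>, the span of the nonstandard monomials.
  The ideal of the initial terms of the generators lies in the initial ideal because
  \<open>\<G>\<close> lies in \<open>\<I>\<close>. The initial ideal lies in \<open>M\<close> by
  \<open>lead_mon_I_ideal_nonstandard\<close>. Finally \<open>M\<close> lies in the ideal of the
  initial terms, since each nonstandard monomial is a multiple of one of them.\<close>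

lemma initial_ideal_I:
  fixes n :: nat
  assumes two: "(2::'k::field) \<noteq> 0" and mo: "monomial_order (uvw_vars n) lt" and bo: "extends_block_order n lt"
  defines "M \<equiv> {p \<in> polys (uvw_vars n). Poly_Mapping.keys p \<inter> block_squarefree_monomials n = {}}"
  shows "initial_ideal (uvw_vars n) lt (I_ideal n :: (uvw_var, 'k) mpoly set) = M"
    and "Idl\<^bsub>uvw_algebra n\<^esub> (initial_term lt ` (G_gens n :: (uvw_var, 'k) mpoly set)) = M"
    and "(G_gens n :: (uvw_var, 'k) mpoly set) \<subseteq> I_ideal n - {0}"
proof -
  interpret block_order n lt by (rule block_order_if_monomial_order[OF mo bo])
  let ?I = "I_ideal n :: (uvw_var, 'k) mpoly set" and ?G = "G_gens n :: (uvw_var, 'k) mpoly set"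
  have GI: "?G \<subseteq> ?I - {0}"
  proof
    fix g :: "(uvw_var, 'k) mpoly" assume g: "g \<in> ?G"
    then obtain k x y where "k \<in> {1..n}" "lead_form k x y g" using G_gens_lead_form by blast
    from lead_mon_lead_form(2)[OF this] g G_subset_I show "g \<in> ?I - {0}" by blast
  qed
  have nonstd: "m + t \<notin> block_squarefree_monomials n"
    if m: "m \<in> monomials (uvw_vars n)" "m \<notin> block_squarefree_monomials n" and t: "t \<in> monomials (uvw_vars n)" for m t
  proof -
    obtain k x y t' where k: "k \<in> {1..n}" "x \<in> block k" "y \<in> block k" and t': "t' \<in> monomials (uvw_vars n)"
      and eq: "m = mon2 x y + t'"
      using block_squarefree_iff[OF m(1)] m(2) by blast
    have "m + t = mon2 x y + (t' + t)" by (simp add: eq add.assoc)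
    with k monomials_add[OF t' t] show ?thesis
      unfolding block_squarefree_iff[OF monomials_add[OF m(1) t]] by blast
  qed
  have ideal_M: "ideal M (uvw_algebra n)"
  proof (rule poly_idealI_single)
    show "M \<subseteq> polys (uvw_vars n)" "0 \<in> M" by (auto simp: M_def)
    show "a + b \<in> M" if "a \<in> M" "b \<in> M" for a b
      using that keys_add[of a b] unfolding M_def by (auto intro: polys_add)
    show "Poly_Mapping.single t c * a \<in> M" if a: "a \<in> M" and t: "t \<in> monomials (uvw_vars n)" for a t c
    proof -
      let ?N = "monomials (uvw_vars n) - block_squarefree_monomials n"
      have a': "a \<in> supported ?N" using a by (auto simp: M_def polys_def supported_def)
      have "Poly_Mapping.single t c * a \<in> supported ?N"
      proof (rule supported_mult[where S = "{t}" and T = ?N])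
        fix m m' assume "m \<in> {t}" "m' \<in> ?N"
        then show "m + m' \<in> ?N"
          using nonstd[of m' t] t monomials_add[of t _ m'] by (simp add: add.commute[of t])
      qed (simp_all add: a' supported_single)
      then show ?thesis by (auto simp: M_def polys_def supported_def)
    qed
  qed
  have inI: "initial_term lt ` (?I - {0}) \<subseteq> M"
  proof (rule image_subsetI)
    fix f assume f: "f \<in> ?I - {0}"
    have fp: "f \<in> polys (uvw_vars n)" using f poly_ideal_subset[OF ideal_I] by blast
    then obtain m where m: "m \<in> Poly_Mapping.keys f"
      "\<And>m'. m' \<in> Poly_Mapping.keys f \<Longrightarrow> m' \<noteq> m \<Longrightarrow> lt m' m"
      using exists_lead_mon[OF mo fp] f by blast
    have keys: "Poly_Mapping.keys f \<subseteq> monomials (uvw_vars n)" using fp by (simp add: polys_def)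
    have "lead_mon lt f = m" by (rule lead_mon_eqI[OF keys m])
    moreover have "m \<notin> block_squarefree_monomials n"
      using lead_mon_I_ideal_nonstandard[OF two _ m] f by blast
    moreover have "m \<in> monomials (uvw_vars n)" using keys m(1) by blast
    ultimately show "initial_term lt f \<in> M"
      by (simp add: initial_term_def M_def pterm_def polys_def)
  qed
  have M_polys: "M \<subseteq> polys (uvw_vars n)" by (rule poly_ideal_subset[OF ideal_M])
  have inG: "initial_term lt ` ?G \<subseteq> initial_term lt ` (?I - {0})" using GI by blast
  have polysG: "initial_term lt ` ?G \<subseteq> polys (uvw_vars n)"
    using inG inI M_polys by (rule subset_trans[OF subset_trans])
  have polysI: "initial_term lt ` (?I - {0}) \<subseteq> polys (uvw_vars n)"
    using inI M_polys by (rule subset_trans)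
  let ?IG = "Idl\<^bsub>uvw_algebra n\<^esub> (initial_term lt ` ?G)"
  note ideal_IG = poly_genideal_ideal[OF polysG]
  have 1: "?IG \<subseteq> initial_ideal (uvw_vars n) lt ?I"
    unfolding initial_ideal_def
    by (rule poly_genideal_minimal[OF poly_genideal_ideal[OF polysI]])
      (rule subset_trans[OF inG poly_genideal_self[OF polysI]])
  have 2: "initial_ideal (uvw_vars n) lt ?I \<subseteq> M"
    unfolding initial_ideal_def by (rule poly_genideal_minimal[OF ideal_M inI])
  have 3: "M \<subseteq> ?IG"
  proof
    fix p assume p: "p \<in> M"
    then have "Poly_Mapping.keys p \<subseteq> monomials (uvw_vars n) - block_squarefree_monomials n"
      unfolding M_def polys_def by blast
    then show "p \<in> ?IG"
    proof (induction p rule: mpoly_induct)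
      case zero
      show ?case by (rule poly_ideal_zero[OF ideal_IG])
    next
      case (add m c q)
      obtain k x y t where k: "k \<in> {1..n}" and xy: "x \<in> block k" "y \<in> block k" and t: "t \<in> monomials (uvw_vars n)"
        and eq: "m = mon2 x y + t"
        using block_squarefree_iff[of m n] add(1) by blast
      obtain g where g: "g \<in> ?G" "lead_form k x y g" using exists_lead_form[OF k xy] by blast
      have "initial_term lt g \<in> ?IG" using poly_genideal_self[OF polysG] g(1) by blast
      moreover have "Poly_Mapping.single t c \<in> polys (uvw_vars n)"
        unfolding polys_eq_supported using t by (rule supported_single)
      ultimately have "Poly_Mapping.single t c * initial_term lt g \<in> ?IG"
        by (rule poly_ideal_mult[OF ideal_IG])
      moreover have "Poly_Mapping.single t c * initial_term lt g = Poly_Mapping.single m c"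
        by (simp add: initial_term_lead_form[OF k g(2)] pterm_def mult_single eq add.commute)
      ultimately show ?case using poly_ideal_add[OF ideal_IG _ add(3)] by simp
    qed
  qed
  show "initial_ideal (uvw_vars n) lt ?I = M" using 1 2 3 by blast
  show "?IG = M" using 1 2 3 by blast
  show "?G \<subseteq> ?I - {0}" by (rule GI)
qed

section \<open>Quotients of polynomial algebras\<close>

lemma poly_coset: "K +>\<^bsub>poly_algebra X\<^esub> p = (\<lambda>k. k + p) ` K"
  by (auto simp: a_r_coset_def')

context
  fixes X :: "'x set" and K :: "('x, 'k::field) mpoly set"
  assumes K: "ideal K (poly_algebra X)"
begin

lemma poly_coset_eq_iff: "K +>\<^bsub>poly_algebra X\<^esub> p = K +>\<^bsub>poly_algebra X\<^esub> q \<longleftrightarrow> p - q \<in> K"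
proof
  assume "K +>\<^bsub>poly_algebra X\<^esub> p = K +>\<^bsub>poly_algebra X\<^esub> q"
  moreover have "p \<in> K +>\<^bsub>poly_algebra X\<^esub> p"
    unfolding poly_coset by (rule image_eqI[of _ _ 0]) (simp_all add: poly_ideal_zero[OF K])
  ultimately obtain k where "k \<in> K" "p = k + q" unfolding poly_coset by blast
  then show "p - q \<in> K" by simp
next
  assume pq: "p - q \<in> K"
  show "K +>\<^bsub>poly_algebra X\<^esub> p = K +>\<^bsub>poly_algebra X\<^esub> q"
    unfolding poly_coset
  proof (intro equalityI image_subsetI)
    fix k assume k: "k \<in> K"
    show "k + p \<in> (\<lambda>k. k + q) ` K"
      by (rule image_eqI[of _ _ "k + (p - q)"]) (simp_all add: poly_ideal_add[OF K k pq])
    show "k + q \<in> (\<lambda>k. k + p) ` K"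
      by (rule image_eqI[of _ _ "k - (p - q)"]) (simp_all add: poly_ideal_diff[OF K k pq])
  qed
qed

private abbreviation (input) "Q \<equiv> quotient_algebra (poly_algebra X) K"
private abbreviation (input) "cls \<equiv> (\<lambda>p. K +>\<^bsub>poly_algebra X\<^esub> p)"

lemma quotient_simps:
  "carrier Q = carrier (poly_algebra X Quot K)" "monoid.mult Q = monoid.mult (poly_algebra X Quot K)"
  "one Q = one (poly_algebra X Quot K)" "zero Q = zero (poly_algebra X Quot K)"
  "add Q = add (poly_algebra X Quot K)"
  by (simp_all add: quotient_algebra_def)

lemma quotient_carrier: "carrier Q = cls ` polys X"
  unfolding quotient_simps by (auto simp: FactRing_def A_RCOSETS_def' )

lemma quotient_mult: "p \<in> polys X \<Longrightarrow> q \<in> polys X \<Longrightarrow> cls p \<otimes>\<^bsub>Q\<^esub> cls q = cls (p * q)"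
  using ring_hom_mult[OF ideal.rcos_ring_hom[OF K], of p q] by (simp add: quotient_simps)

lemma quotient_add: "p \<in> polys X \<Longrightarrow> q \<in> polys X \<Longrightarrow> cls p \<oplus>\<^bsub>Q\<^esub> cls q = cls (p + q)"
  using ring_hom_add[OF ideal.rcos_ring_hom[OF K], of p q] by (simp add: quotient_simps)

lemma quotient_one: "\<one>\<^bsub>Q\<^esub> = cls 1"
  using ring_hom_one[OF ideal.rcos_ring_hom[OF K]] by (simp add: quotient_simps)

lemma quotient_zero: "\<zero>\<^bsub>Q\<^esub> = cls 0"
  by (simp add: quotient_simps FactRing_def poly_coset)

lemma quotient_deg_part: "deg_part Q d = cls ` deg_part (poly_algebra X) d"
  by (simp add: quotient_algebra_def)

lemma quotient_smult:
  assumes "p \<in> polys X" shows "c \<odot>\<^bsub>Q\<^esub> cls p = cls (pconst c * p)"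
proof -
  have "cls (pconst c * (k + p)) = cls (pconst c * p)" if "k \<in> K" for k
    unfolding poly_coset_eq_iff using poly_ideal_mult[OF K that polys_pconst[of c]]
    by (simp add: distrib_left)
  \<comment> \<open>The scalar multiple is a union over all representatives of the coset. They all
    contribute the same set, and there is at least one of them.\<close>
  moreover have "K \<noteq> {}" using poly_ideal_zero[OF K] by blast
  ultimately show ?thesis
    by (simp add: quotient_algebra_def poly_coset[where p = p])
qed

text \<open>The record of the quotient copies the operations of the factor ring, so its laws
  transfer field by field.\<close>

lemma abelian_monoid_quotient: "abelian_monoid Q"
proof -
  interpret M: ring "poly_algebra X Quot K" by (rule ideal.quotient_is_ring[OF K])
  show ?thesis
    by (rule abelian_monoidI; unfold quotient_simps)
      (rule M.a_closed M.zero_closed M.a_assoc M.l_zero M.a_comm; assumption)+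
qed

lemma quotient_finsum:
  assumes "finite F" "\<And>s. s \<in> F \<Longrightarrow> f s \<in> polys X"
  shows "(\<Oplus>\<^bsub>Q\<^esub>s\<in>F. cls (f s)) = cls (\<Sum>s\<in>F. f s)"
proof -
  interpret abelian_monoid Q by (rule abelian_monoid_quotient)
  show ?thesis
    using assms
  proof (induction F rule: finite_induct)
    case empty
    show ?case by (simp only: finsum_empty sum.empty quotient_zero)
  next
    case (insert x F)
    have "(\<Oplus>\<^bsub>Q\<^esub>s\<in>insert x F. cls (f s)) = cls (f x) \<oplus>\<^bsub>Q\<^esub> (\<Oplus>\<^bsub>Q\<^esub>s\<in>F. cls (f s))"
      using insert by (intro finsum_insert) (auto simp: quotient_carrier)
    also have "(\<Oplus>\<^bsub>Q\<^esub>s\<in>F. cls (f s)) = cls (\<Sum>s\<in>F. f s)" using insert by simp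
    also have "cls (f x) \<oplus>\<^bsub>Q\<^esub> cls (\<Sum>s\<in>F. f s) = cls (f x + (\<Sum>s\<in>F. f s))"
      using insert.prems by (intro quotient_add polys_sum) auto
    finally show ?case using insert.hyps by simp
  qed
qed

text \<open>The coefficients of a class are those of a representative supported on \<open>S\<close>.
  Two such representatives differ by an element of \<open>K\<close> supported on \<open>S\<close>,
  which is zero.\<close>

lemma quotient_is_basisI:
  assumes S: "S \<subseteq> monomials X"
    and span: "\<And>p. p \<in> polys X \<Longrightarrow> \<exists>q\<in>supported S. p - q \<in> K"
    and indep: "\<And>q. q \<in> supported S \<Longrightarrow> q \<in> K \<Longrightarrow> q = 0"
  shows "is_basis Q (\<lambda>m. cls (pterm m)) S"
  unfolding is_basis_def
proof (intro conjI ballI)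
  have pt: "pterm m \<in> (polys X :: ('x, 'k) mpoly set)" if "m \<in> S" for m
    unfolding polys_eq_supported using that S by (intro supported_pterm) blast
  show "(\<lambda>m. cls (pterm m)) ` S \<subseteq> carrier Q"
    using pt by (auto simp: quotient_carrier)
  have comb: "(\<Oplus>\<^bsub>Q\<^esub>s\<in>{s. c s \<noteq> 0}. c s \<odot>\<^bsub>Q\<^esub> cls (pterm s)) =
      cls (\<Sum>s\<in>{s. c s \<noteq> 0}. Poly_Mapping.single s (c s))"
    if "{s. c s \<noteq> 0} \<subseteq> S" "finite {s. c s \<noteq> 0}" for c
  proof -
    have single: "c s \<odot>\<^bsub>Q\<^esub> cls (pterm s) = cls (Poly_Mapping.single s (c s))"
      and car: "Poly_Mapping.single s (c s) \<in> polys X" if "s \<in> {s. c s \<noteq> 0}" for s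
    proof -
      have "s \<in> S" using that \<open>{s. c s \<noteq> 0} \<subseteq> S\<close> by blast
      then show "c s \<odot>\<^bsub>Q\<^esub> cls (pterm s) = cls (Poly_Mapping.single s (c s))"
        by (simp only: quotient_smult[OF pt] single_eq_pconst_pterm)
      show "Poly_Mapping.single s (c s) \<in> polys X"
        unfolding polys_eq_supported using \<open>s \<in> S\<close> S by (intro supported_single) blast
    qed
    interpret abelian_monoid Q by (rule abelian_monoid_quotient)
    have "(\<Oplus>\<^bsub>Q\<^esub>s\<in>{s. c s \<noteq> 0}. c s \<odot>\<^bsub>Q\<^esub> cls (pterm s)) =
        (\<Oplus>\<^bsub>Q\<^esub>s\<in>{s. c s \<noteq> 0}. cls (Poly_Mapping.single s (c s)))"
      by (rule finsum_cong') (use single car in \<open>auto simp: quotient_carrier\<close>)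
    also have "\<dots> = cls (\<Sum>s\<in>{s. c s \<noteq> 0}. Poly_Mapping.single s (c s))"
      by (rule quotient_finsum[OF that(2) car])
    finally show ?thesis .
  qed
  fix x assume "x \<in> carrier Q"
  then obtain p where p: "p \<in> polys X" and x: "x = cls p" unfolding quotient_carrier by blast
  obtain q where q: "q \<in> supported S" "p - q \<in> K" using span[OF p] by blast
  have keys: "{s. Poly_Mapping.lookup q s \<noteq> 0} = Poly_Mapping.keys q"
    by (simp add: keys.rep_eq)
  show "\<exists>!c. {s. c s \<noteq> 0} \<subseteq> S \<and> finite {s. c s \<noteq> 0} \<and>
      x = (\<Oplus>\<^bsub>Q\<^esub>s\<in>{s. c s \<noteq> 0}. c s \<odot>\<^bsub>Q\<^esub> cls (pterm s))"
  proof (rule ex1I[of _ "Poly_Mapping.lookup q"])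
    have S': "{s. Poly_Mapping.lookup q s \<noteq> 0} \<subseteq> S" "finite {s. Poly_Mapping.lookup q s \<noteq> 0}"
      using supportedD[OF q(1)] by (simp_all add: keys)
    moreover have "x = (\<Oplus>\<^bsub>Q\<^esub>s\<in>{s. Poly_Mapping.lookup q s \<noteq> 0}. Poly_Mapping.lookup q s \<odot>\<^bsub>Q\<^esub> cls (pterm s))"
    proof -
      have "(\<Sum>s\<in>{s. Poly_Mapping.lookup q s \<noteq> 0}. Poly_Mapping.single s (Poly_Mapping.lookup q s)) = q"
        unfolding keys by (rule pm_expand[symmetric])
      moreover have "x = cls q" using q(2) by (simp only: x poly_coset_eq_iff)
      ultimately show ?thesis using comb[OF S'] by simp
    qed
    ultimately show "{s. Poly_Mapping.lookup q s \<noteq> 0} \<subseteq> S \<and> finite {s. Poly_Mapping.lookup q s \<noteq> 0} \<and>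
      x = (\<Oplus>\<^bsub>Q\<^esub>s\<in>{s. Poly_Mapping.lookup q s \<noteq> 0}. Poly_Mapping.lookup q s \<odot>\<^bsub>Q\<^esub> cls (pterm s))"
      by blast
  next
    fix c
    assume c: "{s. c s \<noteq> 0} \<subseteq> S \<and> finite {s. c s \<noteq> 0} \<and>
      x = (\<Oplus>\<^bsub>Q\<^esub>s\<in>{s. c s \<noteq> 0}. c s \<odot>\<^bsub>Q\<^esub> cls (pterm s))"
    define q' where "q' = (\<Sum>s\<in>{s. c s \<noteq> 0}. Poly_Mapping.single s (c s))"
    have "cls p = cls q'" using c comb[of c] unfolding q'_def x by simp
    then have pq': "p - q' \<in> K" by (simp only: poly_coset_eq_iff)
    have q': "q' \<in> supported S"
      unfolding q'_def using c by (intro supported_sum supported_single) blast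
    have "q - q' = (p - q') - (p - q)" by simp
    also have "\<dots> \<in> K" by (rule poly_ideal_diff[OF K pq' q(2)])
    finally have "q - q' = 0" by (intro indep supported_diff q(1) q')
    moreover have "Poly_Mapping.lookup q' s = c s" for s
      using c by (auto simp: q'_def lookup_sum lookup_single when_def)
    ultimately show "c = Poly_Mapping.lookup q" by (intro ext) simp
  qed
qed

end

section \<open>Linear changes of variables\<close>

definition linear_forms :: "'x set \<Rightarrow> ('x, 'k::field) mpoly set" where
  "linear_forms X = supported {m \<in> monomials X. total_degree m = 1}"

lemma linear_forms_add: "p \<in> linear_forms X \<Longrightarrow> q \<in> linear_forms X \<Longrightarrow> p + q \<in> linear_forms X"
  and linear_forms_diff: "p \<in> linear_forms X \<Longrightarrow> q \<in> linear_forms X \<Longrightarrow> p - q \<in> linear_forms X"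
  and linear_forms_pconst_mult: "p \<in> linear_forms X \<Longrightarrow> pconst c * p \<in> linear_forms X"
  by (simp_all add: linear_forms_def supported_intros)

lemma linear_forms_pvar: "x \<in> X \<Longrightarrow> pvar x \<in> linear_forms X"
  unfolding linear_forms_def pvar_def by (intro supported_pterm) (simp add: monomials_def)

lemma mon_value_linear_forms:
  assumes "\<And>x. x \<in> X \<Longrightarrow> s x \<in> linear_forms Y" and m: "m \<in> monomials X"
  shows "mon_value s m \<in> supported {t \<in> monomials Y. total_degree t = total_degree m}"
proof -
  let ?H = "\<lambda>d. supported {t \<in> monomials Y. total_degree t = d}"
  have mult: "p * q \<in> ?H (a + b)" if "p \<in> ?H a" "q \<in> ?H b" for p q a b
    by (rule supported_mult[OF that]) (simp add: monomials_add)
  have one: "1 \<in> ?H 0"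
    using supported_pterm[of 0 "{t \<in> monomials Y. total_degree t = 0}"] by (simp add: pterm_def)
  have power: "s x ^ k \<in> ?H k" if "x \<in> X" for x k
  proof (induction k)
    case (Suc k)
    then show ?case using mult[of "s x" 1 "s x ^ k" k] assms(1)[OF that] by (simp add: linear_forms_def)
  qed (simp add: one)
  have "(\<Prod>x\<in>F. s x ^ Poly_Mapping.lookup m x) \<in> ?H (\<Sum>x\<in>F. Poly_Mapping.lookup m x)"
    if "finite F" "F \<subseteq> X" for F
    using that by (induction F rule: finite_induct) (simp_all add: one mult power)
  then show ?thesis
    unfolding mon_value_def total_degree_def[of m] using m by (simp add: monomials_def)
qed

lemma poly_subst_homogeneous:
  assumes s: "\<And>x. x \<in> X \<Longrightarrow> s x \<in> linear_forms Y"
    and p: "p \<in> supported {m \<in> monomials X. total_degree m = d}"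
  shows "poly_subst s p \<in> supported {m \<in> monomials Y. total_degree m = d}"
  using supportedD[OF p]
proof (induction p rule: mpoly_induct)
  case (add m c q)
  then have "mon_value s m \<in> supported {t \<in> monomials Y. total_degree t = d}"
    using mon_value_linear_forms[where s = s and m = m, OF s] by simp
  with add(3) show ?case
    unfolding subst.peval_add subst.peval_single by (intro supported_intros)
qed simp

lemma poly_subst_polys:
  assumes s: "\<And>x. x \<in> X \<Longrightarrow> s x \<in> linear_forms Y" and p: "p \<in> polys X"
  shows "poly_subst s p \<in> polys Y"
proof -
  from p have "Poly_Mapping.keys p \<subseteq> monomials X" by (simp add: polys_def)
  then show ?thesis
  proof (induction p rule: mpoly_induct)
    case (add m c q)
    have "mon_value s m \<in> polys Y"
      unfolding polys_eq_supported
      by (rule supported_mono[OF mon_value_linear_forms[where s = s and m = m, OF s add(1)]]) blast+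
    with add(3) show ?case
      unfolding subst.peval_add subst.peval_single by (intro polys_intros) simp_all
  qed simp
qed

text \<open>The substitution \<open>t\<close> provides the inverse. As it too consists of linear
  forms, each degree part is mapped onto the corresponding one and not merely into it.\<close>

lemma poly_subst_algebra_iso:
  fixes s :: "'x \<Rightarrow> ('y, 'k::field) mpoly"
  assumes s: "\<And>x. x \<in> X \<Longrightarrow> s x \<in> linear_forms Y" and t: "\<And>y. y \<in> Y \<Longrightarrow> t y \<in> linear_forms X"
    and ts: "\<And>x. x \<in> X \<Longrightarrow> poly_subst t (s x) = pvar x"
    and st: "\<And>y. y \<in> Y \<Longrightarrow> poly_subst s (t y) = pvar y"
  shows "poly_subst s \<in> graded_algebra_iso 1 (poly_algebra X) (poly_algebra Y)"
proof -
  have inv: "poly_subst t (poly_subst s p) = p" if "p \<in> polys X" for p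
    by (rule poly_subst_inverse[OF that ts])
  have inv': "poly_subst s (poly_subst t p) = p" if "p \<in> polys Y" for p
    by (rule poly_subst_inverse[OF that st])
  have bij: "bij_betw (poly_subst s) (polys X) (polys Y)"
    by (rule bij_betw_byWitness[where f' = "poly_subst t"])
      (use inv inv' poly_subst_polys[of X s Y] poly_subst_polys[of Y t X] s t in blast)+
  have "poly_subst s ` deg_part (poly_algebra X) d = deg_part (poly_algebra Y) (1 * d)" for d
    unfolding deg_part_poly_algebra mult_1
  proof (intro equalityI image_subsetI)
    fix p :: "('x, 'k) mpoly" assume "p \<in> supported {m \<in> monomials X. total_degree m = d}"
    then show "poly_subst s p \<in> supported {m \<in> monomials Y. total_degree m = d}"
      by (rule poly_subst_homogeneous[of X s Y, rotated]) (rule s)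
  next
    show "supported {m \<in> monomials Y. total_degree m = d} \<subseteq>
        poly_subst s ` supported {m \<in> monomials X. total_degree m = d}"
    proof
      fix q :: "('y, 'k) mpoly" assume q: "q \<in> supported {m \<in> monomials Y. total_degree m = d}"
      have "q \<in> polys Y" unfolding polys_eq_supported by (rule supported_mono[OF q]) blast
      from inv'[OF this] poly_subst_homogeneous[where s = t, OF t q]
      show "q \<in> poly_subst s ` supported {m \<in> monomials X. total_degree m = d}"
        by (intro image_eqI[of _ _ "poly_subst t q"]) simp_all
    qed
  qed
  then show ?thesis
    unfolding graded_algebra_iso_def ring_iso_def
    using bij poly_subst_polys[where s = s, OF s]
    by (auto simp: ring_hom_def subst.peval_mult subst.peval_add subst.peval_pconst)
qed

lemma graded_algebra_iso_comp:
  assumes f: "f \<in> graded_algebra_iso a A B" and g: "g \<in> graded_algebra_iso b B C"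
  shows "g \<circ> f \<in> graded_algebra_iso (b * a) A C"
proof -
  have fr: "f \<in> ring_iso A B" and gr: "g \<in> ring_iso B C" using f g by (simp_all add: graded_algebra_iso_def)
  have "g \<circ> f \<in> ring_iso A C" by (rule ring_iso_set_trans[OF fr gr])
  moreover have "f x \<in> carrier B" if "x \<in> carrier A" for x
    using ring_iso_memE(1)[OF fr that] .
  moreover have "(g \<circ> f) ` deg_part A d = deg_part C (b * a * d)" for d
  proof -
    have "g ` f ` deg_part A d = deg_part C (b * (a * d))" using f g by (simp add: graded_algebra_iso_def)
    then show ?thesis by (simp only: image_comp mult.assoc)
  qed
  ultimately show ?thesis
    using f g by (simp add: graded_algebra_iso_def)
qed

section \<open>The two ideals correspond\<close>

definition B_subst :: "uvw_var \<Rightarrow> (pm_var, 'k::field) mpoly" where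
  "B_subst x = (case x of U i \<Rightarrow> u' i | V i j \<Rightarrow> up i j + um i j | W i j \<Rightarrow> up i j - um i j)"

text \<open>The solution of v = u^+ + u^-, w = u^+ - u^-, meaningful when 2 is invertible.\<close>

definition B_inv_subst :: "pm_var \<Rightarrow> (uvw_var, 'k::field) mpoly" where
  "B_inv_subst y = (case y of Upm i \<Rightarrow> u i | Uplus i j \<Rightarrow> pconst (1 / 2) * (v i j + w i j)
     | Uminus i j \<Rightarrow> pconst (1 / 2) * (v i j - w i j))"

lemma B_map_eq: "B_map = poly_subst B_subst"
  by (simp add: B_map_def B_subst_def[abs_def])

lemmas B_map_simps = B_map_eq subst.peval_simps B_subst_def

lemma B_map_iso:
  assumes two: "(2::'k::field) \<noteq> 0"
  shows "(B_map :: (uvw_var, 'k) mpoly \<Rightarrow> _) \<in> graded_algebra_iso 1 (uvw_algebra n) (pm_algebra n)"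
  unfolding B_map_eq
proof (rule poly_subst_algebra_iso[where t = B_inv_subst])
  have h: "pconst (1 / 2) + pconst (1 / 2) = (1 :: ('y, 'k) mpoly)"
    using two by (simp flip: pconst_add)
  have half: "pconst (1 / 2) * (a + b) + pconst (1 / 2) * (a - b) = a"
    "pconst (1 / 2) * (a + b) - pconst (1 / 2) * (a - b) = b"
    "pconst (1 / 2) * (2 * a) = a" for a b :: "('y, 'k) mpoly"
  proof -
    have "pconst (1 / 2) * (a + b) + pconst (1 / 2) * (a - b) = (pconst (1 / 2) + pconst (1 / 2)) * a"
      by (simp add: distrib_left distrib_right right_diff_distrib)
    then show "pconst (1 / 2) * (a + b) + pconst (1 / 2) * (a - b) = a" by (simp only: h mult_1)
    have "pconst (1 / 2) * (a + b) - pconst (1 / 2) * (a - b) = (pconst (1 / 2) + pconst (1 / 2)) * b"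
      by (simp add: distrib_left distrib_right right_diff_distrib)
    then show "pconst (1 / 2) * (a + b) - pconst (1 / 2) * (a - b) = b" by (simp only: h mult_1)
    have "pconst (1 / 2) * (2 * a) = (pconst (1 / 2) + pconst (1 / 2)) * a"
      by (simp only: mult_2 distrib_left distrib_right)
    then show "pconst (1 / 2) * (2 * a) = a" by (simp only: h mult_1)
  qed
  show "B_subst x \<in> linear_forms (pm_vars n)" if "x \<in> uvw_vars n" for x
    using that unfolding uvw_vars_def
    by (auto simp: B_subst_def pm_vars_def intro!: linear_forms_add linear_forms_diff linear_forms_pvar)
  show "B_inv_subst y \<in> linear_forms (uvw_vars n)" if "y \<in> pm_vars n" for y
    using that unfolding pm_vars_def
    by (auto simp: B_inv_subst_def uvw_vars_def
        intro!: linear_forms_pconst_mult linear_forms_add linear_forms_diff linear_forms_pvar)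
  show "poly_subst B_inv_subst (B_subst x) = (pvar x :: (uvw_var, 'k) mpoly)" for x
    by (cases x) (simp_all add: B_subst_def subst.peval_simps B_inv_subst_def half)
  show "poly_subst B_subst (B_inv_subst y) = (pvar y :: (pm_var, 'k) mpoly)" for y
    by (cases y) (simp_all add: B_subst_def subst.peval_simps B_inv_subst_def half)
qed

lemma poly_ideal_preimage:
  fixes s :: "'x \<Rightarrow> ('y, 'k::field) mpoly"
  assumes L: "ideal L (poly_algebra Y)" and s: "\<And>x. x \<in> X \<Longrightarrow> s x \<in> linear_forms Y"
  shows "ideal {p \<in> polys X. poly_subst s p \<in> L} (poly_algebra X)"
proof (rule poly_idealI)
  show "r * a \<in> {p \<in> polys X. poly_subst s p \<in> L}"
    if a: "a \<in> {p \<in> polys X. poly_subst s p \<in> L}" and r: "r \<in> polys X" for a r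
    using a r poly_ideal_mult[OF L _ poly_subst_polys[of X s Y r]] s
    by (simp add: polys_mult subst.peval_mult)
qed (auto simp: polys_add subst.peval_add poly_ideal_zero[OF L] poly_ideal_add[OF L])

text \<open>Surjectivity of \<open>f\<close> is what supplies a preimage of each multiplier.\<close>

lemma poly_ideal_image:
  fixes f :: "('x, 'k::field) mpoly \<Rightarrow> ('y, 'k) mpoly"
  assumes K: "ideal K (poly_algebra X)" and f: "f \<in> graded_algebra_iso 1 (poly_algebra X) (poly_algebra Y)"
  shows "ideal (f ` K) (poly_algebra Y)"
proof (rule poly_idealI)
  have fr: "f \<in> ring_iso (poly_algebra X) (poly_algebra Y)" using f by (simp add: graded_algebra_iso_def)
  note hom = ring_iso_memE[OF fr, simplified]
  have sub: "K \<subseteq> polys X" by (rule poly_ideal_subset[OF K])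
  show "f ` K \<subseteq> polys Y" using sub hom(1) by blast
  have "f 0 + f 0 = f 0" using hom(3)[of 0 0] by simp
  then have "f 0 = 0" by simp
  with poly_ideal_zero[OF K] show "0 \<in> f ` K" by (metis image_eqI)
  show "a + b \<in> f ` K" if ab: "a \<in> f ` K" "b \<in> f ` K" for a b
  proof -
    obtain p q where pq: "p \<in> K" "q \<in> K" "a = f p" "b = f q" using ab by blast
    then have "a + b = f (p + q)" using hom(3)[of p q] subsetD[OF sub] by simp
    then show ?thesis using poly_ideal_add[OF K pq(1,2)] by blast
  qed
  show "r * a \<in> f ` K" if a: "a \<in> f ` K" and r: "r \<in> polys Y" for a r
  proof -
    obtain p where p: "p \<in> K" "a = f p" using a by blast
    obtain q where q: "q \<in> polys X" "r = f q" using hom(5) r unfolding bij_betw_def by blast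
    have "r * a = f (q * p)" using hom(2)[of q p] p q sub by auto
    then show ?thesis using poly_ideal_mult[OF K p(1) q(1)] by blast
  qed
qed

text \<open>The induced map takes a coset to its image as a set, so no representatives are chosen
  and well-definedness costs nothing.\<close>

lemma quotient_algebra_iso:
  fixes f :: "('x, 'k::field) mpoly \<Rightarrow> ('y, 'k) mpoly"
  assumes K: "ideal K (poly_algebra X)" and f: "f \<in> graded_algebra_iso 1 (poly_algebra X) (poly_algebra Y)"
  defines "F \<equiv> (\<lambda>C. f ` C)"
  shows "F \<in> graded_algebra_iso 1 (quotient_algebra (poly_algebra X) K) (quotient_algebra (poly_algebra Y) (f ` K))"
    and "p \<in> polys X \<Longrightarrow> F (K +>\<^bsub>poly_algebra X\<^esub> p) = f ` K +>\<^bsub>poly_algebra Y\<^esub> f p"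
proof -
  have fr: "f \<in> ring_iso (poly_algebra X) (poly_algebra Y)" using f by (simp add: graded_algebra_iso_def)
  note hom = ring_iso_memE[OF fr, simplified]
  have L: "ideal (f ` K) (poly_algebra Y)" by (rule poly_ideal_image[OF K f])
  have sub: "K \<subseteq> polys X" by (rule poly_ideal_subset[OF K])
  have inj: "inj_on f (polys X)" and surj: "f ` polys X = polys Y" using hom(5) by (simp_all add: bij_betw_def)
  let ?A = "quotient_algebra (poly_algebra X) K" and ?B = "quotient_algebra (poly_algebra Y) (f ` K)"
  let ?a = "\<lambda>p. K +>\<^bsub>poly_algebra X\<^esub> p" and ?b = "\<lambda>p. f ` K +>\<^bsub>poly_algebra Y\<^esub> p"
  have F: "F (?a p) = ?b (f p)" if "p \<in> polys X" for p
  proof -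
    have "f (k + p) = f k + f p" if "k \<in> K" for k using hom(3)[of k p] sub that \<open>p \<in> polys X\<close> by blast
    then show ?thesis unfolding F_def poly_coset image_image by (rule image_cong[OF refl])
  qed
  then show "p \<in> polys X \<Longrightarrow> F (?a p) = ?b (f p)" .
  have smult: "f (pconst c * p) = pconst c * f p" if "p \<in> polys X" for c p
    using f that by (simp add: graded_algebra_iso_def)
  have deg: "f ` deg_part (poly_algebra X) d = deg_part (poly_algebra Y) d" for d
    using f by (simp add: graded_algebra_iso_def)
  have deg_sub: "deg_part (poly_algebra X) d \<subseteq> polys X" for d
    by (auto simp: poly_algebra_def)
  have car: "carrier ?A = ?a ` polys X" "carrier ?B = ?b ` polys Y"
    by (rule quotient_carrier[OF K], rule quotient_carrier[OF L])
  have inj_iff: "f p - f q \<in> f ` K \<longleftrightarrow> p - q \<in> K" if "p \<in> polys X" "q \<in> polys X" for p q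
  proof -
    have "f (p - q) + f q = f p" using hom(3)[of "p - q" q] that by (simp add: polys_diff)
    then have "f p - f q = f (p - q)" by (simp add: eq_diff_eq[symmetric])
    then show ?thesis using inj_on_image_mem_iff[OF inj _ sub, of "p - q"] that by (simp add: polys_diff)
  qed
  have "F \<in> ring_iso ?A ?B"
  proof (rule ring_iso_memI)
    show "F C \<in> carrier ?B" if "C \<in> carrier ?A" for C
      using that hom(1) F unfolding car by auto
    show "F (C \<otimes>\<^bsub>?A\<^esub> D) = F C \<otimes>\<^bsub>?B\<^esub> F D" if CD: "C \<in> carrier ?A" "D \<in> carrier ?A" for C D
    proof -
      obtain p q where pq: "p \<in> polys X" "q \<in> polys X" "C = ?a p" "D = ?a q" using CD unfolding car by blast
      then show ?thesis
        by (simp only: quotient_mult[OF K pq(1,2)] F polys_mult quotient_mult[OF L] hom)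
    qed
    show "F (C \<oplus>\<^bsub>?A\<^esub> D) = F C \<oplus>\<^bsub>?B\<^esub> F D" if CD: "C \<in> carrier ?A" "D \<in> carrier ?A" for C D
    proof -
      obtain p q where pq: "p \<in> polys X" "q \<in> polys X" "C = ?a p" "D = ?a q" using CD unfolding car by blast
      then show ?thesis
        by (simp only: quotient_add[OF K pq(1,2)] F polys_add quotient_add[OF L] hom)
    qed
    show "F \<one>\<^bsub>?A\<^esub> = \<one>\<^bsub>?B\<^esub>"
      by (simp only: quotient_one[OF K] quotient_one[OF L] F polys_one hom)
    show "bij_betw F (carrier ?A) (carrier ?B)"
      unfolding bij_betw_def
    proof
      show "inj_on F (carrier ?A)"
      proof (rule inj_onI)
        fix C D assume CD: "C \<in> carrier ?A" "D \<in> carrier ?A" and eq: "F C = F D"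
        obtain p q where pq: "p \<in> polys X" "q \<in> polys X" "C = ?a p" "D = ?a q" using CD unfolding car by blast
        with eq show "C = D"
          by (simp only: F poly_coset_eq_iff[OF L] inj_iff[OF pq(1,2)] poly_coset_eq_iff[OF K])
      qed
      have "F ` carrier ?A = ?b ` f ` polys X"
        unfolding car image_image by (rule image_cong[OF refl F])
      then show "F ` carrier ?A = carrier ?B" by (simp only: car surj)
    qed
  qed
  moreover have "F (c \<odot>\<^bsub>?A\<^esub> C) = c \<odot>\<^bsub>?B\<^esub> F C" if C: "C \<in> carrier ?A" for c C
  proof -
    obtain p where p: "p \<in> polys X" "C = ?a p" using C unfolding car by blast
    then show ?thesis
      by (simp only: quotient_smult[OF K] quotient_smult[OF L] F polys_mult polys_pconst smult hom(1))
  qed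
  moreover have "F ` deg_part ?A d = deg_part ?B (1 * d)" for d
  proof -
    have "F ` deg_part ?A d = ?b ` f ` deg_part (poly_algebra X) d"
      unfolding quotient_deg_part[OF K] image_image by (rule image_cong[OF refl F]) (use deg_sub in blast)
    then show ?thesis by (simp only: deg quotient_deg_part[OF L] mult_1)
  qed
  ultimately show "F \<in> graded_algebra_iso 1 ?A ?B"
    unfolding graded_algebra_iso_def by blast
qed

section \<open>The generators of \<open>\<J>\<close> and the images of the generators of
  \<open>\<I>\<close>\<close>

lemma
  shows J_gensI1: "1 \<le> i \<Longrightarrow> i \<le> n \<Longrightarrow> u' i ^ 2 \<in> J_gens n"
    and J_gensI2: "1 \<le> i \<Longrightarrow> i < j \<Longrightarrow> j \<le> n \<Longrightarrow>
      {up i j ^ 2, um i j ^ 2, u' i * up i j - u' i * um i j - up i j * um i j,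
        u' i * up i j - u' i * u' j - up i j * u' j,
        u' i * u' j - u' i * um i j - u' j * um i j} \<subseteq> J_gens n"
    and J_gensI3: "1 \<le> i \<Longrightarrow> i < j \<Longrightarrow> j < k \<Longrightarrow> k \<le> n \<Longrightarrow>
      {up i j * up j k - up i j * up i k - up i k * up j k,
        um i j * up j k - um i j * um i k - um i k * up j k,
        - um i j * um j k + um i j * up i k - up i k * um j k,
        - up i j * um j k + up i j * um i k - um i k * um j k} \<subseteq> J_gens n"
  unfolding J_gens_def by fastforce+

lemma J_gens_cases [consumes 1, case_names one two three]:
  assumes "g \<in> J_gens n"
  obtains i where "1 \<le> i" "i \<le> n" "g = u' i ^ 2"
  | i j where "1 \<le> i" "i < j" "j \<le> n"
      "g \<in> {up i j ^ 2, um i j ^ 2, u' i * up i j - u' i * um i j - up i j * um i j,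
        u' i * up i j - u' i * u' j - up i j * u' j,
        u' i * u' j - u' i * um i j - u' j * um i j}"
  | i j k where "1 \<le> i" "i < j" "j < k" "k \<le> n"
      "g \<in> {up i j * up j k - up i j * up i k - up i k * up j k,
        um i j * up j k - um i j * um i k - um i k * up j k,
        - um i j * um j k + um i j * up i k - up i k * um j k,
        - up i j * um j k + up i j * um i k - um i k * um j k}"
  using assms unfolding J_gens_def by (elim UnE UN_E) (fastforce split: prod.splits)+

lemma J_gens_polys: "J_gens n \<subseteq> polys (pm_vars n)"
proof
  fix g assume "g \<in> J_gens n"
  then show "g \<in> polys (pm_vars n)"
    by (cases rule: J_gens_cases) (auto simp: pm_vars_def intro!: polys_intros)
qed

lemma ideal_J: "ideal (J_ideal n :: (pm_var, 'k::field) mpoly set) (pm_algebra n)"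
  and J_gens_subset_J: "(J_gens n :: (pm_var, 'k) mpoly set) \<subseteq> J_ideal n"
  unfolding J_ideal_def by (rule poly_genideal_ideal[OF J_gens_polys], rule poly_genideal_self[OF J_gens_polys])

lemma B_subst_linear: "x \<in> uvw_vars n \<Longrightarrow> B_subst x \<in> linear_forms (pm_vars n)"
  unfolding uvw_vars_def
  by (auto simp: B_subst_def pm_vars_def intro!: linear_forms_add linear_forms_diff linear_forms_pvar)

text \<open>The relations fall into two systems: one in the two squares and \<open>j1\<close>, the
  other in \<open>j2\<close> and \<open>j3\<close>.\<close>

lemma B_map_two:
  fixes i j :: nat
  defines "j1 \<equiv> u' i * up i j - u' i * um i j - up i j * um i j"
    and "j2 \<equiv> u' i * up i j - u' i * u' j - up i j * u' j"
    and "j3 \<equiv> u' i * u' j - u' i * um i j - u' j * um i j"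
  shows "B_map (v i j * w i j) = (up i j ^ 2 - um i j ^ 2 :: (pm_var, 'k::field) mpoly)"
    "B_map (u i * w i j - u j * v i j) = (j2 + j3 :: (pm_var, 'k) mpoly)"
    "B_map (- 2 * u i * w i j + v i j ^ 2) = (up i j ^ 2 + um i j ^ 2 - (j1 + j1) :: (pm_var, 'k) mpoly)"
    "B_map (2 * u i * w i j + w i j ^ 2) = (up i j ^ 2 + um i j ^ 2 + (j1 + j1) :: (pm_var, 'k) mpoly)"
    "B_map (u i * v i j - 2 * u i * u j - u j * w i j) = (j2 - j3 :: (pm_var, 'k) mpoly)"
  unfolding j1_def j2_def j3_def
  by (simp_all add: B_map_simps power2_eq_square algebra_simps)

text \<open>The signs of \<open>k1\<close> to \<open>k4\<close> form a Hadamard matrix of size 4: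
  its rows are orthogonal, so its inverse is the transpose divided by 4.\<close>

lemma B_map_three:
  fixes i j k :: nat
  defines "k1 \<equiv> up i j * up j k - up i j * up i k - up i k * up j k"
    and "k2 \<equiv> um i j * up j k - um i j * um i k - um i k * up j k"
    and "k3 \<equiv> - um i j * um j k + um i j * up i k - up i k * um j k"
    and "k4 \<equiv> - up i j * um j k + up i j * um i k - um i k * um j k"
  shows "B_map (v i j * w j k - w i j * w i k - v i k * v j k) = (k1 + k2 + k3 + k4 :: (pm_var, 'k::field) mpoly)"
    "B_map (w i j * w j k - v i j * w i k - w i k * w j k) = (k1 - k2 - k3 + k4 :: (pm_var, 'k) mpoly)"
    "B_map (v i j * v j k - v i j * v i k - v i k * w j k) = (k1 + k2 - k3 - k4 :: (pm_var, 'k) mpoly)"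
    "B_map (w i j * v j k - w i j * v i k - w i k * v j k) = (k1 - k2 + k3 - k4 :: (pm_var, 'k) mpoly)"
  unfolding k1_def k2_def k3_def k4_def
  by (simp_all add: B_map_simps algebra_simps)

lemma B_map_I_subset_J: "B_map ` I_ideal n \<subseteq> (J_ideal n :: (pm_var, 'k::field) mpoly set)"
proof -
  let ?J = "J_ideal n :: (pm_var, 'k) mpoly set"
  let ?P = "{p \<in> polys (uvw_vars n). B_map p \<in> ?J}"
  note J = poly_ideal_add[OF ideal_J] poly_ideal_diff[OF ideal_J]
  have "G_gens n \<subseteq> ?P"
  proof
    fix g :: "(uvw_var, 'k) mpoly" assume g: "g \<in> G_gens n"
    have "g \<in> polys (uvw_vars n)" using g G_subset_I poly_ideal_subset[OF ideal_I] by blast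
    moreover have "B_map g \<in> ?J"
      using g
    proof (cases rule: G_gens_cases)
      case (one i)
      then show ?thesis using J_gensI1[of i n] J_gens_subset_J by (auto simp: B_map_simps)
    next
      case (two i j)
      have "{up i j ^ 2, um i j ^ 2, u' i * up i j - u' i * um i j - up i j * um i j,
        u' i * up i j - u' i * u' j - up i j * u' j,
        u' i * u' j - u' i * um i j - u' j * um i j} \<subseteq> ?J"
        using J_gensI2[OF two(1-3)] J_gens_subset_J by (rule subset_trans)
      then show ?thesis using two(4)
        by (simp only: insert_subset) (elim insertE emptyE conjE, simp_all only: B_map_two J)
    next
      case (three i j k)
      have "{up i j * up j k - up i j * up i k - up i k * up j k,
        um i j * up j k - um i j * um i k - um i k * up j k,
        - um i j * um j k + um i j * up i k - up i k * um j k,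
        - up i j * um j k + up i j * um i k - um i k * um j k} \<subseteq> ?J"
        using J_gensI3[OF three(1-4)] J_gens_subset_J by (rule subset_trans)
      then show ?thesis using three(5)
        by (simp only: insert_subset) (elim insertE emptyE conjE, simp_all only: B_map_three J)
    qed
    ultimately show "g \<in> ?P" by blast
  qed
  moreover have "ideal ?P (uvw_algebra n)"
    unfolding B_map_eq by (rule poly_ideal_preimage[OF ideal_J B_subst_linear])
  ultimately have "I_ideal n \<subseteq> ?P" unfolding I_ideal_def by (rule poly_genideal_minimal[rotated])
  then show ?thesis by blast
qed

text \<open>Up to the factors \<open>2\<close> and \<open>4\<close> the generators of \<open>\<J>\<close> are images of elements of \<open>\<I>\<close>.\<close>

lemma J_subset_B_map_I:
  assumes two: "(2::'k::field) \<noteq> 0"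
  shows "(J_ideal n :: (pm_var, 'k) mpoly set) \<subseteq> B_map ` I_ideal n"
proof -
  let ?L = "B_map ` I_ideal n :: (pm_var, 'k) mpoly set"
  note ideal_L = poly_ideal_image[OF ideal_I B_map_iso[OF two], of n]
  note L = poly_ideal_add[OF ideal_L] poly_ideal_diff[OF ideal_L] poly_ideal_uminus[OF ideal_L]
  have BG: "B_map g \<in> ?L" if "g \<in> G_gens n" for g using that G_subset_I by blast
  have half: "g \<in> ?L" if "g + g \<in> ?L" for g
  proof -
    have "pconst (1 / 2) + pconst (1 / 2) = (1 :: (pm_var, 'k) mpoly)"
      using two by (simp flip: pconst_add)
    then have "pconst (1 / 2) * (g + g) = g"
      by (metis distrib_left distrib_right mult_1)
    with poly_ideal_mult[OF ideal_L that, of "pconst (1 / 2)"] show ?thesis by simp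
  qed
  have quarter: "g \<in> ?L" if "(g + g) + (g + g) \<in> ?L" for g by (rule half, rule half, rule that)
  have "J_gens n \<subseteq> ?L"
  proof
    fix g :: "(pm_var, 'k) mpoly" assume g: "g \<in> J_gens n"
    then show "g \<in> ?L"
    proof (cases rule: J_gens_cases)
      case (one i)
      then show ?thesis using BG[OF G_gensI1[of i n]] by (simp add: B_map_simps)
    next
      case (two i j)
      define j1 where "j1 = (u' i * up i j - u' i * um i j - up i j * um i j :: (pm_var, 'k) mpoly)"
      define j2 where "j2 = (u' i * up i j - u' i * u' j - up i j * u' j :: (pm_var, 'k) mpoly)"
      define j3 where "j3 = (u' i * u' j - u' i * um i j - u' j * um i j :: (pm_var, 'k) mpoly)"
      define p2 where "p2 = (up i j ^ 2 :: (pm_var, 'k) mpoly)"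
      define m2 where "m2 = (um i j ^ 2 :: (pm_var, 'k) mpoly)"
      have G: "p2 - m2 \<in> ?L" "j2 + j3 \<in> ?L" "p2 + m2 - (j1 + j1) \<in> ?L" "p2 + m2 + (j1 + j1) \<in> ?L" "j2 - j3 \<in> ?L"
        unfolding j1_def j2_def j3_def p2_def m2_def
        unfolding B_map_two[symmetric] by (rule BG, rule subsetD[OF G_gensI2[OF two(1-3)]], simp)+
      \<comment> \<open>Adding the third and fourth relation cancels \<open>j1\<close>; adding the
        first one twice cancels \<open>m2\<close> and leaves four copies of
        \<open>p2\<close>.\<close>
      have "(p2 + p2) + (p2 + p2) = (p2 + m2 - (j1 + j1)) + (p2 + m2 + (j1 + j1)) + (p2 - m2) + (p2 - m2)"
        by (simp add: algebra_simps)
      also have "\<dots> \<in> ?L" by (intro L G)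
      finally have "p2 \<in> ?L" by (rule quarter)
      moreover have "p2 - (p2 - m2) \<in> ?L" by (rule L(2)[OF \<open>p2 \<in> ?L\<close> G(1)])
      then have "m2 \<in> ?L" by simp
      moreover have "(j1 + j1) + (j1 + j1) = (p2 + m2 + (j1 + j1)) - (p2 + m2 - (j1 + j1))"
        by (simp add: algebra_simps)
      then have "(j1 + j1) + (j1 + j1) \<in> ?L" using L(2)[OF G(4,3)] by simp
      then have "j1 \<in> ?L" by (rule quarter)
      moreover have "j2 + j2 = (j2 + j3) + (j2 - j3)" "j3 + j3 = (j2 + j3) - (j2 - j3)"
        by (simp_all add: algebra_simps)
      then have j23: "j2 + j2 \<in> ?L" "j3 + j3 \<in> ?L" using L(1)[OF G(2,5)] L(2)[OF G(2,5)] by simp_all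
      note half[OF j23(1)] half[OF j23(2)]
      ultimately show ?thesis
        using two(4) unfolding p2_def m2_def j1_def j2_def j3_def by (elim insertE emptyE) (simp_all only:)
    next
      case (three i j k)
      define k1 where "k1 = (up i j * up j k - up i j * up i k - up i k * up j k :: (pm_var, 'k) mpoly)"
      define k2 where "k2 = (um i j * up j k - um i j * um i k - um i k * up j k :: (pm_var, 'k) mpoly)"
      define k3 where "k3 = (- um i j * um j k + um i j * up i k - up i k * um j k :: (pm_var, 'k) mpoly)"
      define k4 where "k4 = (- up i j * um j k + up i j * um i k - um i k * um j k :: (pm_var, 'k) mpoly)"
      have G: "k1 + k2 + k3 + k4 \<in> ?L" "k1 - k2 - k3 + k4 \<in> ?L" "k1 + k2 - k3 - k4 \<in> ?L" "k1 - k2 + k3 - k4 \<in> ?L"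
        unfolding k1_def k2_def k3_def k4_def
        unfolding B_map_three[symmetric] by (rule BG, rule subsetD[OF G_gensI3[OF three(1-4)]], simp)+
      let ?t1 = "k1 + k2 + k3 + k4" and ?t2 = "k1 - k2 - k3 + k4" and ?t3 = "k1 + k2 - k3 - k4" and ?t4 = "k1 - k2 + k3 - k4"
      \<comment> \<open>The transposed sign matrix of \<open>B_map_three\<close>: each column
        recovers four times one generator.\<close>
      have "(k1 + k1) + (k1 + k1) = ?t1 + ?t2 + ?t3 + ?t4" "(k2 + k2) + (k2 + k2) = ?t1 - ?t2 + ?t3 - ?t4"
        "(k3 + k3) + (k3 + k3) = ?t1 - ?t2 - ?t3 + ?t4" "(k4 + k4) + (k4 + k4) = ?t1 + ?t2 - ?t3 - ?t4"
        by (simp_all add: algebra_simps)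
      moreover have "?t1 + ?t2 + ?t3 + ?t4 \<in> ?L" "?t1 - ?t2 + ?t3 - ?t4 \<in> ?L"
        "?t1 - ?t2 - ?t3 + ?t4 \<in> ?L" "?t1 + ?t2 - ?t3 - ?t4 \<in> ?L"
        by (simp_all only: L G)
      ultimately have k4s: "(k1 + k1) + (k1 + k1) \<in> ?L" "(k2 + k2) + (k2 + k2) \<in> ?L"
        "(k3 + k3) + (k3 + k3) \<in> ?L" "(k4 + k4) + (k4 + k4) \<in> ?L"
        by (simp_all only:)
      note quarter[OF k4s(1)] quarter[OF k4s(2)] quarter[OF k4s(3)] quarter[OF k4s(4)]
      then show ?thesis
        using three(5) unfolding k1_def k2_def k3_def k4_def by (elim insertE emptyE) (simp_all only:)
    qed
  qed
  then show ?thesis unfolding J_ideal_def by (rule poly_genideal_minimal[OF ideal_L])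
qed

lemma two_neq_zero_if_CHAR:
  assumes "CHAR('k::field) \<noteq> 2" shows "(2::'k) \<noteq> 0"
proof
  assume "(2::'k) = 0"
  then have "CHAR('k) dvd 2" using of_nat_eq_0_iff_char_dvd[where 'a = 'k, of 2] by simp
  then have "CHAR('k) = 1" using assms dvd_imp_le[of "CHAR('k)" 2] by (cases "CHAR('k)") (auto simp: le_Suc_eq numeral_2_eq_2)
  then show False using of_nat_CHAR[where 'a = 'k] by simp
qed

section \<open>Initial terms, standard basis and assembly\<close>

context block_order
begin

lemma initial_term_one:
  "\<forall>i\<in>{1..n}. initial_term lt (u i ^ 2 :: (uvw_var, 'k::field) mpoly) = u i ^ 2"
  by (rule ballI, subst initial_term_lead_form[OF _ lead_form_uu]) (simp_all add: pvar_square)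

lemma initial_term_two:
  "\<forall>i j. 1 \<le> i \<and> i < j \<and> j \<le> n \<longrightarrow>
     initial_term lt (v i j * w i j :: (uvw_var, 'k::field) mpoly) = v i j * w i j
   \<and> initial_term lt (u i * w i j - u j * v i j :: (uvw_var, 'k) mpoly) = u j * v i j
   \<and> initial_term lt (- 2 * u i * w i j + v i j ^ 2 :: (uvw_var, 'k) mpoly) = v i j ^ 2
   \<and> initial_term lt (2 * u i * w i j + w i j ^ 2 :: (uvw_var, 'k) mpoly) = w i j ^ 2
   \<and> initial_term lt (u i * v i j - 2 * u i * u j - u j * w i j :: (uvw_var, 'k) mpoly) = u j * w i j"
proof (intro allI impI)
  fix i j assume ij: "1 \<le> i \<and> i < j \<and> j \<le> n"
  then have j: "j \<in> {1..n}" and ij': "1 \<le> i" "i < j" by auto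
  show "initial_term lt (v i j * w i j :: (uvw_var, 'k) mpoly) = v i j * w i j
   \<and> initial_term lt (u i * w i j - u j * v i j :: (uvw_var, 'k) mpoly) = u j * v i j
   \<and> initial_term lt (- 2 * u i * w i j + v i j ^ 2 :: (uvw_var, 'k) mpoly) = v i j ^ 2
   \<and> initial_term lt (2 * u i * w i j + w i j ^ 2 :: (uvw_var, 'k) mpoly) = w i j ^ 2
   \<and> initial_term lt (u i * v i j - 2 * u i * u j - u j * w i j :: (uvw_var, 'k) mpoly) = u j * w i j"
    by (simp only: initial_term_lead_form[OF j lead_form_vw[OF ij']]
        initial_term_lead_form[OF j lead_form_uv[OF ij']] initial_term_lead_form[OF j lead_form_vv[OF ij']]
        initial_term_lead_form[OF j lead_form_ww[OF ij']] initial_term_lead_form[OF j lead_form_uw[OF ij']])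
      (simp only: pvar_mult pvar_square simp_thms)
qed

lemma initial_term_three:
  "\<forall>i j k. 1 \<le> i \<and> i < j \<and> j < k \<and> k \<le> n \<longrightarrow>
     initial_term lt (v i j * w j k - w i j * w i k - v i k * v j k :: (uvw_var, 'k::field) mpoly)
       = v i k * v j k
   \<and> initial_term lt (w i j * w j k - v i j * w i k - w i k * w j k :: (uvw_var, 'k) mpoly)
       = w i k * w j k
   \<and> initial_term lt (v i j * v j k - v i j * v i k - v i k * w j k :: (uvw_var, 'k) mpoly)
       = v i k * w j k
   \<and> initial_term lt (w i j * v j k - w i j * v i k - w i k * v j k :: (uvw_var, 'k) mpoly)
       = w i k * v j k"
proof (intro allI impI)
  fix i j k assume ijk: "1 \<le> i \<and> i < j \<and> j < k \<and> k \<le> n"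
  then have k: "k \<in> {1..n}" and ijk': "1 \<le> i" "i < j" "j < k" by auto
  show "initial_term lt (v i j * w j k - w i j * w i k - v i k * v j k :: (uvw_var, 'k) mpoly)
       = v i k * v j k
   \<and> initial_term lt (w i j * w j k - v i j * w i k - w i k * w j k :: (uvw_var, 'k) mpoly)
       = w i k * w j k
   \<and> initial_term lt (v i j * v j k - v i j * v i k - v i k * w j k :: (uvw_var, 'k) mpoly)
       = v i k * w j k
   \<and> initial_term lt (w i j * v j k - w i j * v i k - w i k * v j k :: (uvw_var, 'k) mpoly)
       = w i k * v j k"
    by (simp only: initial_term_lead_form[OF k lead_form_vvk[OF ijk']]
        initial_term_lead_form[OF k lead_form_wwk[OF ijk']] initial_term_lead_form[OF k lead_form_vwk[OF ijk']]
        initial_term_lead_form[OF k lead_form_wvk[OF ijk']])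
      (simp only: pvar_mult simp_thms)
qed

lemma quotient_basis:
  assumes two: "(2::'k::field) \<noteq> 0"
  shows "is_basis (quotient_algebra (uvw_algebra n :: ('k, _) graded_algebra) (I_ideal n))
    (\<lambda>m. I_ideal n +>\<^bsub>uvw_algebra n\<^esub> pterm m) (block_squarefree_monomials n)"
proof (rule quotient_is_basisI[OF ideal_I])
  show "block_squarefree_monomials n \<subseteq> monomials (uvw_vars n)"
    by (auto simp: block_squarefree_monomials_def)
  show "\<exists>q\<in>supported (block_squarefree_monomials n). p - q \<in> I_ideal n"
    if "p \<in> polys (uvw_vars n)" for p :: "(uvw_var, 'k) mpoly"
    by (rule standard_rep[OF that[unfolded polys_eq_supported]]) (auto simp: std_below_def)
  show "q = 0" if "q \<in> supported (block_squarefree_monomials n)" "q \<in> I_ideal n"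
    for q :: "(uvw_var, 'k) mpoly"
    by (rule standard_in_I_ideal[OF two that(2,1)])
qed

end

lemma groebner_basis_G:
  assumes "(2::'k::field) \<noteq> 0" "monomial_order (uvw_vars n) lt" "extends_block_order n lt"
  shows "groebner_basis (uvw_vars n) lt (I_ideal n :: (uvw_var, 'k) mpoly set) (G_gens n)"
  unfolding groebner_basis_def initial_ideal_I[OF assms]
  using finite_G_gens initial_ideal_I(3)[OF assms] by simp

lemma standard_monomials_I:
  assumes "(2::'k::field) \<noteq> 0" "monomial_order (uvw_vars n) lt" "extends_block_order n lt"
  shows "standard_monomials (uvw_vars n) lt (I_ideal n :: (uvw_var, 'k) mpoly set) = block_squarefree_monomials n"
  unfolding standard_monomials_def initial_ideal_I[OF assms]
  by (auto simp: pterm_def polys_def block_squarefree_monomials_def)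

theorem theorem4p5:
  fixes n :: nat
  assumes char: "CHAR('k::field) \<noteq> 2"
  shows
    "(B_map :: (uvw_var, 'k) mpoly \<Rightarrow> (pm_var, 'k) mpoly)
       \<in> graded_algebra_iso 1 (uvw_algebra n) (pm_algebra n)
     \<and> (\<exists>Bbar \<in> graded_algebra_iso 1
           (quotient_algebra (uvw_algebra n :: ('k, _) graded_algebra) (I_ideal n))
           (quotient_algebra (pm_algebra n) (J_ideal n)).
          (\<forall>p\<in>carrier (uvw_algebra n).
             Bbar (I_ideal n +>\<^bsub>uvw_algebra n\<^esub> p) = J_ideal n +>\<^bsub>pm_algebra n\<^esub> B_map p) \<and>
          (\<forall>\<Phi> \<in> graded_algebra_iso 2 (quotient_algebra (pm_algebra n) (J_ideal n))
                    (cohomology_algebra (Y_space n)).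
             \<Phi> \<circ> Bbar \<in> graded_algebra_iso 2 (quotient_algebra (uvw_algebra n) (I_ideal n))
                    (cohomology_algebra (Y_space n))))
     \<and> (G_gens n :: (uvw_var, 'k) mpoly set) \<subseteq> deg_part (uvw_algebra n) 2
     \<and> (\<forall>lt. monomial_order (uvw_vars n) lt \<and> extends_block_order n lt \<longrightarrow>
          groebner_basis (uvw_vars n) lt
            (I_ideal n :: (uvw_var, 'k) mpoly set) (G_gens n)
          \<and> (\<forall>i\<in>{1..n}. initial_term lt (u i ^ 2 :: (uvw_var, 'k) mpoly) = u i ^ 2)
          \<and> (\<forall>i j. 1 \<le> i \<and> i < j \<and> j \<le> n \<longrightarrow>
               initial_term lt (v i j * w i j :: (uvw_var, 'k) mpoly) = v i j * w i j
             \<and> initial_term lt (u i * w i j - u j * v i j :: (uvw_var, 'k) mpoly) = u j * v i j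
             \<and> initial_term lt (- 2 * u i * w i j + v i j ^ 2 :: (uvw_var, 'k) mpoly) = v i j ^ 2
             \<and> initial_term lt (2 * u i * w i j + w i j ^ 2 :: (uvw_var, 'k) mpoly) = w i j ^ 2
             \<and> initial_term lt
                 (u i * v i j - 2 * u i * u j - u j * w i j :: (uvw_var, 'k) mpoly) = u j * w i j)
          \<and> (\<forall>i j k. 1 \<le> i \<and> i < j \<and> j < k \<and> k \<le> n \<longrightarrow>
               initial_term lt
                 (v i j * w j k - w i j * w i k - v i k * v j k :: (uvw_var, 'k) mpoly)
                   = v i k * v j k
             \<and> initial_term lt
                 (w i j * w j k - v i j * w i k - w i k * w j k :: (uvw_var, 'k) mpoly)
                   = w i k * w j k
             \<and> initial_term lt
                 (v i j * v j k - v i j * v i k - v i k * w j k :: (uvw_var, 'k) mpoly)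
                   = v i k * w j k
             \<and> initial_term lt
                 (w i j * v j k - w i j * v i k - w i k * v j k :: (uvw_var, 'k) mpoly)
                   = w i k * v j k)
          \<and> standard_monomials (uvw_vars n) lt (I_ideal n :: (uvw_var, 'k) mpoly set)
              = block_squarefree_monomials n)
     \<and> is_basis (quotient_algebra (uvw_algebra n :: ('k, _) graded_algebra) (I_ideal n))
         (\<lambda>m. I_ideal n +>\<^bsub>uvw_algebra n\<^esub> pterm m)
         (block_squarefree_monomials n)"
proof (intro conjI)
  have two: "(2::'k) \<noteq> 0" by (rule two_neq_zero_if_CHAR[OF char])
  note iso = B_map_iso[OF two, of n]
  have J: "B_map ` I_ideal n = (J_ideal n :: (pm_var, 'k) mpoly set)"
    by (rule equalityI[OF B_map_I_subset_J J_subset_B_map_I[OF two]])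
  note Bbar = quotient_algebra_iso[OF ideal_I iso, unfolded J]
  show "(B_map :: (uvw_var, 'k) mpoly \<Rightarrow> (pm_var, 'k) mpoly)
      \<in> graded_algebra_iso 1 (uvw_algebra n) (pm_algebra n)" by (rule iso)
  show "\<exists>Bbar \<in> graded_algebra_iso 1
           (quotient_algebra (uvw_algebra n :: ('k, _) graded_algebra) (I_ideal n))
           (quotient_algebra (pm_algebra n) (J_ideal n)).
          (\<forall>p\<in>carrier (uvw_algebra n).
             Bbar (I_ideal n +>\<^bsub>uvw_algebra n\<^esub> p) = J_ideal n +>\<^bsub>pm_algebra n\<^esub> B_map p) \<and>
          (\<forall>\<Phi> \<in> graded_algebra_iso 2 (quotient_algebra (pm_algebra n) (J_ideal n))
                    (cohomology_algebra (Y_space n)).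
             \<Phi> \<circ> Bbar \<in> graded_algebra_iso 2 (quotient_algebra (uvw_algebra n) (I_ideal n))
                    (cohomology_algebra (Y_space n)))"
    \<comment> \<open>For each grade-doubling isomorphism \<open>\<Phi>\<close> onto the cohomology
      algebra the degree factors multiply, 2 * 1 = 2, so the composite is again
      grade-doubling.\<close>
    using Bbar(2) graded_algebra_iso_comp[OF Bbar(1), where b = 2]
    by (intro bexI[OF _ Bbar(1)] conjI ballI) simp_all
  show "(G_gens n :: (uvw_var, 'k) mpoly set) \<subseteq> deg_part (uvw_algebra n) 2"
    unfolding deg_part_poly_algebra by (rule G_homogeneous)
  \<comment> \<open>The basis statement mentions no order, so some block order has to be supplied
    for the reduction; the weight order guarantees that one exists.\<close>
  obtain lt where lt: "block_order n lt" using exists_block_order by blast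
  show "is_basis (quotient_algebra (uvw_algebra n :: ('k, _) graded_algebra) (I_ideal n))
      (\<lambda>m. I_ideal n +>\<^bsub>uvw_algebra n\<^esub> pterm m) (block_squarefree_monomials n)"
    by (rule block_order.quotient_basis[OF lt two])
qed (rule allI, rule impI, erule conjE, intro conjI,
  (erule (1) groebner_basis_G[OF two_neq_zero_if_CHAR[OF char]]
    block_order.initial_term_one[OF block_order_if_monomial_order]
    block_order.initial_term_two[OF block_order_if_monomial_order]
    block_order.initial_term_three[OF block_order_if_monomial_order]
    standard_monomials_I[OF two_neq_zero_if_CHAR[OF char]])+)

end
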